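(* Let $n\ge 2$ and let $V\in L^\infty_{loc}(\mathbb R^n\setminus\{0\})$ be a real-valued homogeneous function of order $\alpha\in\mathbb R$ on $\mathbb R^n$. Assume that one of the following holds: (i) $\alpha=-2$; (ii) $\alpha>-2$ and $V\ge 0$ on $\mathbb R^n$; (iii) $\alpha<-2$ and $V\le 0$ on $\mathbb R^n$. Let $u\in L^2_{loc}(\mathbb R^n)$ be a real-valued weak solution to $-\Delta u=Vu$ on $\mathbb R^n$. If $\lim_{r\to\infty} r^m\int_{|x|>r}|u|^2=0$ for every $m\ge 0$, then $u\equiv 0$.
   Context: $V$ is homogeneous of order $\alpha$ if $V(tx)=t^\alpha V(x)$ for all $t>0$ and $x\ne 0$. A weak solution to $-\Delta u=Vu$ on $\mathbb R^n$ is a solution in the sense of distributions (in particular $Vu\in L^1_{loc}(\mathbb R^n)$). Equality $u\equiv 0$ is understood almost everywhere. *)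

theory Defs
  imports "HOL-Analysis.Analysis"
begin

definition partial_deriv :: "'n::finite \<Rightarrow> (real ^ 'n \<Rightarrow> real) \<Rightarrow> real ^ 'n \<Rightarrow> real" where
  "partial_deriv i f x = deriv (\<lambda>t. f (x + t *\<^sub>R axis i 1)) 0"

primrec Ck :: "nat \<Rightarrow> (real ^ 'n::finite \<Rightarrow> real) \<Rightarrow> bool" where
  "Ck 0 f \<longleftrightarrow> continuous_on UNIV f"
| "Ck (Suc k) f \<longleftrightarrow> (\<forall>x. f differentiable (at x)) \<and> (\<forall>i. Ck k (partial_deriv i f))"

definition laplacian :: "(real ^ 'n::finite \<Rightarrow> real) \<Rightarrow> real ^ 'n \<Rightarrow> real" where
  "laplacian f x = (\<Sum>i\<in>UNIV. partial_deriv i (partial_deriv i f) x)"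

definition test_function :: "(real ^ 'n::finite \<Rightarrow> real) \<Rightarrow> bool" where
  "test_function \<phi> \<longleftrightarrow> (\<forall>k. Ck k \<phi>) \<and> compact (closure {x. \<phi> x \<noteq> 0})"

definition L1_loc :: "(real ^ 'n::finite \<Rightarrow> real) \<Rightarrow> bool" where
  "L1_loc f \<longleftrightarrow> f \<in> borel_measurable lebesgue \<and>
     (\<forall>K. compact K \<longrightarrow> set_integrable lebesgue K f)"

definition L2_loc :: "(real ^ 'n::finite \<Rightarrow> real) \<Rightarrow> bool" where
  "L2_loc f \<longleftrightarrow> f \<in> borel_measurable lebesgue \<and>
     (\<forall>K. compact K \<longrightarrow> set_integrable lebesgue K (\<lambda>x. (f x)\<^sup>2))"

definition Linf_loc_on :: "(real ^ 'n::finite) set \<Rightarrow> (real ^ 'n \<Rightarrow> real) \<Rightarrow> bool" where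
  "Linf_loc_on \<Omega> f \<longleftrightarrow> f \<in> borel_measurable (lebesgue_on \<Omega>) \<and>
     (\<forall>K. compact K \<and> K \<subseteq> \<Omega> \<longrightarrow> (\<exists>C. AE x in lebesgue_on K. \<bar>f x\<bar> \<le> C))"

definition homogeneous_of_order :: "real \<Rightarrow> (real ^ 'n::finite \<Rightarrow> real) \<Rightarrow> bool" where
  "homogeneous_of_order \<alpha> V \<longleftrightarrow> (\<forall>t>0. \<forall>x. x \<noteq> 0 \<longrightarrow> V (t *\<^sub>R x) = t powr \<alpha> * V x)"

text \<open>Solutions of \<open>-\<Delta>u = V u\<close> on the whole space, in the sense of distributions. The requirement on
  \<open>V u\<close> is a genuine condition across the origin, where \<open>V\<close> may be singular. For real \<open>u\<close> and \<open>V\<close>,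
  real test functions suffice.\<close>
definition weak_solution :: "(real ^ 'n::finite \<Rightarrow> real) \<Rightarrow> (real ^ 'n \<Rightarrow> real) \<Rightarrow> bool" where
  "weak_solution V u \<longleftrightarrow> L1_loc u \<and> L1_loc (\<lambda>x. V x * u x) \<and>
     (\<forall>\<phi>. test_function \<phi> \<longrightarrow>
        (LINT x|lebesgue. u x * (- laplacian \<phi> x)) = (LINT x|lebesgue. V x * u x * \<phi> x))"

text \<open>Stated with the nonnegative integral, so that a tail integral that diverges is \<open>\<infinity>\<close> and not,
  as it would be for the Bochner integral, \<open>0\<close>.\<close>
definition rapidly_decaying_L2_tail :: "(real ^ 'n::finite \<Rightarrow> real) \<Rightarrow> bool" where
  "rapidly_decaying_L2_tail u \<longleftrightarrow> (\<forall>m::real\<ge>0.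
     ((\<lambda>r::real. ennreal (r powr m) *
        (\<integral>\<^sup>+x\<in>{x. norm x > r}. ennreal ((u x)\<^sup>2) \<partial>lebesgue)) \<longlongrightarrow> 0) at_top)"

end

theory Submission
  imports Defs
begin

text \<open>
  Write \<open>n\<close> for the dimension, \<open>u\<^sub>s(x) = u(x/s)\<close>, \<open>f = |x|\<^sup>2 V u\<close>, and
  \<open>\<langle>v, w\<rangle> = \<integral> |x|\<^bsup>2k+n\<^esup> v w dx\<close>. Rapid decay of \<open>u\<close> at infinity makes \<open>\<langle>u, u\<rangle>\<close> finite for all \<open>k\<close>,
  and since \<open>|V| \<le> C |x|\<^bsup>\<alpha>\<^esup>\<close> it makes \<open>\<langle>f, f\<rangle>\<close> finite for all large \<open>k\<close>; large weights also remove every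
  difficulty at the origin. The proof studies the normalised autocorrelation of \<open>u\<close> under dilations,
  \<open>G(s) = s\<^bsup>-k-n\<^esup> \<langle>u, u\<^sub>s\<rangle>\<close>. The factor makes \<open>v \<mapsto> s\<^bsup>-k-n\<^esup> v\<^sub>s\<close> an isometry, so that
  \<open>G(s) \<le> G(1)\<close> by Cauchy-Schwarz.

  In polar coordinates \<open>|x|\<^sup>2 \<Delta> = D\<^sup>2 + (n-2) D + \<Delta>\<^sub>S\<close>, where \<open>D = x \<cdot> \<nabla>\<close> generates the dilations and the
  spherical Laplacian \<open>\<Delta>\<^sub>S\<close> is symmetric and commutes with them. Pairing the equation for \<open>u\<close> with \<open>u\<^sub>s\<close>
  and the equation for \<open>u\<^sub>s\<close> with \<open>u\<close> and subtracting, the spherical parts and the second-order radial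
  parts cancel, and what remains is
  \<open>2 (2k+n+2) s\<^bsup>k+n+1\<^esup> G'(s) = \<langle>f, u\<^sub>s\<rangle> - \<langle>u, f\<^sub>s\<rangle>\<close>. Homogeneity of \<open>V\<close> gives
  \<open>\<langle>u, f\<^sub>s\<rangle> = s\<^bsup>-(\<alpha>+2)\<^esup> \<langle>f, u\<^sub>s\<rangle>\<close>. The three cases of the hypothesis say exactly that \<open>(\<alpha>+2) V \<ge> 0\<close>.
  So \<open>(1 - s\<^bsup>-(\<alpha>+2)\<^esup>) \<langle>f, u\<^sub>s\<rangle> \<ge> 0\<close> for \<open>s\<close> slightly larger than \<open>1\<close>, by continuity at \<open>s = 1\<close> or because
  \<open>f = 0\<close> (lemma \<open>correlation_sign\<close>). Therefore \<open>G(s) \<ge> G(1)\<close> (lemma \<open>correlation_ge\<close>), equality holds in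
  Cauchy-Schwarz, and \<open>u\<^sub>s = s\<^bsup>k+n\<^esup> u\<close> almost everywhere (lemma \<open>homogeneous_solution\<close>). For two
  consecutive values of \<open>k\<close> and a common \<open>s > 1\<close> this forces \<open>u = 0\<close> (lemma \<open>rigidity\<close>).

  Since \<open>u\<close> is only square integrable, the pairing is done with smooth kernels instead of derivatives
  of \<open>u\<close>. Let \<open>N(x, y) = |x|\<^bsup>2k\<^esup> g(|y - x|\<^sup>2 / |x|\<^sup>2)\<close> with a smooth \<open>g\<close> supported near \<open>0\<close>. For fixed \<open>y \<noteq> 0\<close> the
  function \<open>|x|\<^sup>2 N(x, sy)\<close> of \<open>x\<close> is a test function that vanishes near the origin, and so is
  \<open>|y|\<^sup>2 N(x, sy)\<close> as a function of \<open>y\<close> for fixed \<open>x \<noteq> 0\<close>. As \<open>N\<close> is invariant under simultaneous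
  rotations and homogeneous under simultaneous dilations, the difference of the Laplacians of these two
  functions is a multiple, depending only on \<open>s\<close>, of \<open>\<partial>\<^sub>s (s\<^bsup>-k\<^esup> N(x, sy))\<close> (lemma \<open>kern_lap_point\<close>). Integrated against
  \<open>u(x) u(y)\<close> this is a smoothed form of the formula for \<open>G'\<close> (lemma \<open>virial_identity\<close>), and no cutoff
  errors occur. Letting \<open>g\<close> concentrate at \<open>0\<close> recovers the correlations themselves, uniformly for
  \<open>1 \<le> s \<le> 2\<close> (lemma \<open>kern_corr_limit\<close>).
\<close>

section \<open>Test functions smooth away from the origin\<close>

text \<open>The powers of \<open>t\<close> make the family closed under differentiation, so that all derivatives of the bump
  \<open>flat 0\<close> stay explicit.\<close>
definition flat :: "nat \<Rightarrow> real \<Rightarrow> real" where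
  "flat k t = (if t \<le> 0 then 0 else exp (- 1 / t) / t ^ k)"

lemma flat_nonneg: "0 \<le> flat k t"
  by (simp add: flat_def)

lemma flat_eq_0: "t \<le> 0 \<Longrightarrow> flat k t = 0"
  by (simp add: flat_def)

lemma flat_mult_power: "0 \<le> t \<Longrightarrow> flat (k + m) t * t ^ m = flat k t"
  by (auto simp: flat_def power_add field_simps)

lemma flat_le_fact: "flat k t \<le> fact k"
proof (cases "t \<le> 0")
  case False
  then have t: "0 < t" by simp
  have "(1 / t) ^ k / fact k \<le> exp (1 / t)"
  proof -
    have "summable (\<lambda>j. (1 / t) ^ j / fact j)"
      using summable_exp[of "1 / t"] by (simp add: field_simps)
    then have "(\<Sum>j\<in>{k}. (1 / t) ^ j / fact j) \<le> (\<Sum>j. (1 / t) ^ j / fact j)"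
      by (rule sum_le_suminf) (use t in auto)
    then show ?thesis by (simp add: exp_def field_simps)
  qed
  then have "(1 / t) ^ k \<le> fact k * exp (1 / t)" by (simp add: divide_le_eq mult.commute)
  then show ?thesis using t
    by (simp add: flat_def exp_minus field_simps)
qed (simp add: flat_def)

text \<open>At \<open>0\<close> the difference quotient is dominated by a multiple of \<open>|h|\<close>, because \<open>flat k h\<close> is
  \<open>flat (k + 2) h \<cdot> h\<^sup>2\<close> and \<open>flat (k + 2)\<close> is bounded.\<close>
lemma has_real_derivative_flat:
  "(flat k has_real_derivative (flat (k + 2) t - of_nat k * flat (k + 1) t)) (at t)"
proof -
  consider "t < 0" | "t = 0" | "0 < t" by linarith
  then show ?thesis
  proof cases
    case 1
    have "((\<lambda>_. 0) has_real_derivative 0) (at t)" by simp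
    then have "(flat k has_real_derivative 0) (at t)"
      by (rule has_field_derivative_transform_within_open[where S="{..<0}"])
         (use 1 in \<open>auto simp: flat_def\<close>)
    then show ?thesis using 1 by (simp add: flat_def)
  next
    case 2
    have bnd: "\<bar>flat k h / h\<bar> \<le> fact (k + 2) * \<bar>h\<bar>" for h
    proof (cases "h \<le> 0")
      case False
      then have "flat k h = flat (k + 2) h * h ^ 2" using flat_mult_power[of h k 2] by simp
      then have "flat k h / h = flat (k + 2) h * h" using False by (simp add: power2_eq_square)
      then show ?thesis using False flat_le_fact[of "k + 2" h] flat_nonneg[of "k + 2" h]
        by (simp add: abs_mult mult_right_mono)
    next
      case True
      then have "flat k h = 0" by (simp add: flat_def)
      then show ?thesis by (simp del: fact_Suc)
    qed
    have "((\<lambda>h. flat k h / h) \<longlongrightarrow> 0) (at 0)"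
    proof (rule Lim_null_comparison)
      show "\<forall>\<^sub>F h in at 0. norm (flat k h / h) \<le> fact (k + 2) * \<bar>h\<bar>"
        using bnd by (simp del: fact_Suc)
      show "((\<lambda>h::real. fact (k + 2) * \<bar>h\<bar>) \<longlongrightarrow> 0) (at 0)"
        by (auto intro!: tendsto_eq_intros simp del: fact_Suc)
    qed
    then show ?thesis using 2 by (simp add: DERIV_def flat_def)
  next
    case 3
    have "((\<lambda>t. exp (- inverse t) * inverse t ^ k) has_real_derivative
        exp (- inverse t) * inverse t ^ (k + 2) - of_nat k * (exp (- inverse t) * inverse t ^ (k + 1))) (at t)"
    proof -
      have "((\<lambda>t. exp (- inverse t) * inverse t ^ k) has_real_derivative
          exp (- inverse t) * inverse t ^ 2 * inverse t ^ k
          - exp (- inverse t) * (of_nat k * inverse t ^ 2 * inverse t ^ (k - 1))) (at t)"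
        using 3 by (auto intro!: derivative_eq_intros simp: algebra_simps power2_eq_square)
      then show ?thesis by (cases k) (auto simp: algebra_simps power2_eq_square)
    qed
    then have "((\<lambda>t. exp (- inverse t) * inverse t ^ k) has_real_derivative
        (flat (k + 2) t - of_nat k * flat (k + 1) t)) (at t)"
      using 3 by (simp add: flat_def divide_simps)
    then show ?thesis
      by (rule has_field_derivative_transform_within_open[where S="{0<..}"])
         (use 3 in \<open>auto simp: flat_def divide_simps\<close>)
  qed
qed

lemmas has_real_derivative_flat' = DERIV_chain2[OF has_real_derivative_flat]

lemma differentiable_flat: "flat k differentiable (at t)"
  using has_real_derivative_flat real_differentiable_def by blast

lemma flat_measurable [measurable]: "flat k \<in> borel_measurable borel"
  by (intro borel_measurable_continuous_onI continuous_at_imp_continuous_on ballI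
      DERIV_isCont[OF has_real_derivative_flat])

text \<open>An algebra of functions that are smooth off the origin, given by generators so that closure under
  partial derivatives is an induction. The values at the origin itself are irrelevant: the functions
  of interest vanish near it.\<close>
inductive_set punctured_smooth :: "(real ^ 'n::finite \<Rightarrow> real) set" where
  const: "(\<lambda>_. c) \<in> punctured_smooth"
| coord: "(\<lambda>x. x $ i) \<in> punctured_smooth"
| inverse_sq: "(\<lambda>x. inverse (x \<bullet> x)) \<in> punctured_smooth"
| add: "f \<in> punctured_smooth \<Longrightarrow> g \<in> punctured_smooth \<Longrightarrow> (\<lambda>x. f x + g x) \<in> punctured_smooth"
| mult: "f \<in> punctured_smooth \<Longrightarrow> g \<in> punctured_smooth \<Longrightarrow> (\<lambda>x. f x * g x) \<in> punctured_smooth"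
| flat: "f \<in> punctured_smooth \<Longrightarrow> (\<lambda>x. flat k (f x)) \<in> punctured_smooth"

lemma punctured_smooth_sum:
  "finite I \<Longrightarrow> (\<And>i. i \<in> I \<Longrightarrow> f i \<in> punctured_smooth) \<Longrightarrow> (\<lambda>x. \<Sum>i\<in>I. f i x) \<in> punctured_smooth"
  by (induction I rule: finite_induct) (auto intro: punctured_smooth.intros)

lemma punctured_smooth_diff:
  assumes "f \<in> punctured_smooth" "g \<in> punctured_smooth"
  shows "(\<lambda>x. f x - g x) \<in> punctured_smooth"
  using punctured_smooth.add[OF assms(1) punctured_smooth.mult[OF punctured_smooth.const[of "-1"] assms(2)]]
  by simp

lemma punctured_smooth_power: "f \<in> punctured_smooth \<Longrightarrow> (\<lambda>x. f x ^ m) \<in> punctured_smooth"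
  by (induction m) (auto intro: punctured_smooth.intros)

lemma punctured_smooth_inner_const: "(\<lambda>x. x \<bullet> a) \<in> punctured_smooth"
  unfolding inner_vec_def by (intro punctured_smooth_sum) (auto intro: punctured_smooth.intros)

lemma punctured_smooth_inner_self: "(\<lambda>x. x \<bullet> x) \<in> punctured_smooth"
  unfolding inner_vec_def by (intro punctured_smooth_sum) (auto intro: punctured_smooth.intros)

lemma punctured_smooth_differentiable:
  "f \<in> punctured_smooth \<Longrightarrow> x \<noteq> 0 \<Longrightarrow> f differentiable (at x)"
proof (induction rule: punctured_smooth.induct)
  case (coord i)
  show ?case using bounded_linear_vec_nth bounded_linear_imp_differentiable by blast
next
  case inverse_sq
  then show ?case
    by (intro differentiable_inverse) (auto intro!: differentiable_inner)
next
  case (flat f k)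
  then show ?case using differentiable_chain_at[of f x "flat k"] differentiable_flat
    by (simp add: o_def)
qed auto

lemma punctured_smooth_partial:
  fixes f :: "real ^ 'n::finite \<Rightarrow> real" and i :: 'n
  shows "f \<in> punctured_smooth \<Longrightarrow>
    \<exists>f'\<in>punctured_smooth. \<forall>x. x \<noteq> 0 \<longrightarrow> ((\<lambda>t. f (x + t *\<^sub>R axis i 1)) has_real_derivative f' x) (at 0)"
proof (induction rule: punctured_smooth.induct)
  case (const c)
  show ?case by (rule bexI[of _ "\<lambda>_. 0"]) (auto intro: punctured_smooth.intros)
next
  case (coord j)
  show ?case
    by (rule bexI[of _ "\<lambda>_. axis i 1 $ j"])
       (auto intro!: derivative_eq_intros punctured_smooth.intros)
next
  case inverse_sq
  have "((\<lambda>t. inverse ((x + t *\<^sub>R axis i 1) \<bullet> (x + t *\<^sub>R axis i 1)))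
      has_real_derivative (- 2) * x $ i * inverse (x \<bullet> x) * inverse (x \<bullet> x)) (at 0)"
    if "x \<noteq> 0" for x :: "real ^ 'n"
    using that
    by (auto simp: inner_add_left inner_add_right inner_axis inner_axis' power2_eq_square
        intro!: derivative_eq_intros)
  moreover have "(\<lambda>x. (- 2) * x $ i * inverse (x \<bullet> x) * inverse (x \<bullet> x)) \<in> punctured_smooth"
    by (intro punctured_smooth.intros)
  ultimately show ?case by (intro bexI) auto
next
  case (add f g)
  then obtain f' g' where "f' \<in> punctured_smooth" "g' \<in> punctured_smooth"
    "\<forall>x. x \<noteq> 0 \<longrightarrow> ((\<lambda>t. f (x + t *\<^sub>R axis i 1)) has_real_derivative f' x) (at 0)"
    "\<forall>x. x \<noteq> 0 \<longrightarrow> ((\<lambda>t. g (x + t *\<^sub>R axis i 1)) has_real_derivative g' x) (at 0)"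
    by blast
  then show ?case
    by (intro bexI[of _ "\<lambda>x. f' x + g' x"]) (auto intro!: punctured_smooth.intros derivative_eq_intros)
next
  case (mult f g)
  then obtain f' g' where "f' \<in> punctured_smooth" "g' \<in> punctured_smooth"
    "\<forall>x. x \<noteq> 0 \<longrightarrow> ((\<lambda>t. f (x + t *\<^sub>R axis i 1)) has_real_derivative f' x) (at 0)"
    "\<forall>x. x \<noteq> 0 \<longrightarrow> ((\<lambda>t. g (x + t *\<^sub>R axis i 1)) has_real_derivative g' x) (at 0)"
    by blast
  with mult show ?case
    by (intro bexI[of _ "\<lambda>x. f' x * g x + f x * g' x"])
       (auto intro!: punctured_smooth.intros derivative_eq_intros)
next
  case (flat f k)
  then obtain f' where "f' \<in> punctured_smooth"
    "\<forall>x. x \<noteq> 0 \<longrightarrow> ((\<lambda>t. f (x + t *\<^sub>R axis i 1)) has_real_derivative f' x) (at 0)"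
    by blast
  note f' = this
  have "((\<lambda>t. flat k (f (x + t *\<^sub>R axis i 1))) has_real_derivative
      (flat (k + 2) (f x) - of_nat k * flat (k + 1) (f x)) * f' x) (at 0)" if "x \<noteq> 0" for x
    using has_real_derivative_flat'[of "\<lambda>t. f (x + t *\<^sub>R axis i 1)" "f' x" 0 UNIV k] f'(2) that
    by simp
  moreover have "(\<lambda>x. (flat (k + 2) (f x) - of_nat k * flat (k + 1) (f x)) * f' x) \<in> punctured_smooth"
    by (intro punctured_smooth.intros punctured_smooth_diff flat(1) f'(1))
  ultimately show ?case by (intro bexI) auto
qed

lemma eventually_line_nonzero:
  fixes x v :: "real ^ 'n::finite"
  assumes "x \<noteq> 0"
  shows "\<forall>\<^sub>F t in nhds 0. x + t *\<^sub>R v \<noteq> 0"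
proof -
  have "((\<lambda>t::real. x + t *\<^sub>R v) \<longlongrightarrow> x + 0 *\<^sub>R v) (nhds 0)"
    by (intro tendsto_intros filterlim_ident)
  then show ?thesis using assms tendsto_imp_eventually_ne by fastforce
qed

lemma partial_deriv_eqI:
  assumes "\<And>y. y \<noteq> 0 \<Longrightarrow> f y = g y" "x \<noteq> 0"
    "((\<lambda>t. g (x + t *\<^sub>R axis i 1)) has_real_derivative D) (at 0)"
  shows "partial_deriv i f x = D"
proof -
  have "\<forall>\<^sub>F t in nhds 0. f (x + t *\<^sub>R axis i 1) = g (x + t *\<^sub>R axis i 1)"
    using eventually_line_nonzero[OF assms(2), of "axis i 1"] by eventually_elim (use assms(1) in auto)
  then have "deriv (\<lambda>t. f (x + t *\<^sub>R axis i 1)) 0 = deriv (\<lambda>t. g (x + t *\<^sub>R axis i 1)) 0"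
    by (intro deriv_cong_ev) auto
  then show ?thesis unfolding partial_deriv_def using DERIV_imp_deriv[OF assms(3)] by simp
qed

lemma differentiable_punctured:
  assumes "f \<in> punctured_smooth" "\<And>x. x \<noteq> 0 \<Longrightarrow> \<phi> x = f x" "0 < r" "\<And>x. norm x < r \<Longrightarrow> \<phi> x = 0"
  shows "\<phi> differentiable (at x)"
proof (cases "x = 0")
  case True
  have "(\<lambda>_. 0) differentiable (at x)" by simp
  then show ?thesis
    by (rule differentiable_transform_within[where d=r])
       (use assms True in \<open>auto simp: dist_norm\<close>)
next
  case False
  have *: "f x' = \<phi> x'" if "dist x' x < norm x" for x'
    using assms(2)[of x'] that by (cases "x' = 0") (auto simp: dist_norm)
  have "f differentiable (at x)" using punctured_smooth_differentiable assms(1) False by blast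
  then show ?thesis
    by (rule differentiable_transform_within[where d="norm x"])
       (use False * in auto)
qed

lemma partial_deriv_eq_0:
  fixes \<phi> :: "real ^ 'n::finite \<Rightarrow> real"
  assumes "\<And>x. norm x < r \<Longrightarrow> \<phi> x = 0" "norm x < r"
  shows "partial_deriv i \<phi> x = 0"
proof -
  have "((\<lambda>t::real. norm (x + t *\<^sub>R axis i 1)) \<longlongrightarrow> norm (x + 0 *\<^sub>R axis i 1)) (nhds 0)"
    by (intro tendsto_intros filterlim_ident)
  then have "\<forall>\<^sub>F t in nhds 0. norm (x + t *\<^sub>R axis i 1) < r"
    using assms(2) by (intro order_tendstoD(2)) simp_all
  then have "\<forall>\<^sub>F t in nhds 0. \<phi> (x + t *\<^sub>R axis i 1) = 0"
    by eventually_elim (rule assms(1))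
  then have "deriv (\<lambda>t. \<phi> (x + t *\<^sub>R axis i 1)) 0 = deriv (\<lambda>t. 0) 0"
    by (intro deriv_cong_ev) auto
  then show ?thesis by (simp add: partial_deriv_def)
qed

lemma laplacian_eq_0:
  fixes \<phi> :: "real ^ 'n::finite \<Rightarrow> real"
  assumes "\<And>x. norm x < r \<Longrightarrow> \<phi> x = 0" "norm x < r"
  shows "laplacian \<phi> x = 0"
proof -
  have "partial_deriv i \<phi> y = 0" if "norm y < r" for i y
    using assms(1) that by (rule partial_deriv_eq_0)
  then have "partial_deriv i (partial_deriv i \<phi>) x = 0" for i
    using assms(2) by (rule partial_deriv_eq_0)
  then show ?thesis by (simp add: laplacian_def)
qed

text \<open>Both assumptions on \<open>\<phi>\<close> pass to its partial derivatives, which gives all orders of smoothness at once.\<close>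
lemma Ck_punctured:
  assumes "f \<in> punctured_smooth" "\<And>x. x \<noteq> 0 \<Longrightarrow> \<phi> x = f x" "0 < r" "\<And>x. norm x < r \<Longrightarrow> \<phi> x = 0"
  shows "Ck k \<phi>"
  using assms
proof (induction k arbitrary: \<phi> f)
  case (Suc k)
  have diff: "\<phi> differentiable (at x)" for x
    using differentiable_punctured[OF Suc.prems] .
  have "Ck k (partial_deriv i \<phi>)" for i
  proof -
    obtain f' where f': "f' \<in> punctured_smooth"
      "\<And>x. x \<noteq> 0 \<Longrightarrow> ((\<lambda>t. f (x + t *\<^sub>R axis i 1)) has_real_derivative f' x) (at 0)"
      using punctured_smooth_partial[OF Suc.prems(1), of i] by blast
    have z: "partial_deriv i \<phi> x = 0" if "norm x < r" for x
      using Suc.prems(4) that by (rule partial_deriv_eq_0)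
    show ?thesis
    proof (rule Suc.IH[OF f'(1) _ Suc.prems(3) z])
      show "partial_deriv i \<phi> x = f' x" if "x \<noteq> 0" for x
        by (rule partial_deriv_eqI[OF Suc.prems(2) that f'(2)[OF that]])
    qed
  qed
  then show ?case using diff by simp
next
  case 0
  have "\<phi> differentiable (at x)" for x
    using differentiable_punctured[OF 0] .
  then show ?case
    by (auto intro!: continuous_at_imp_continuous_on differentiable_imp_continuous_within)
qed

lemma test_function_punctured:
  assumes "f \<in> punctured_smooth" "\<And>x. x \<noteq> 0 \<Longrightarrow> \<phi> x = f x"
    "0 < r" "\<And>x. norm x < r \<Longrightarrow> \<phi> x = 0" "\<And>x. R < norm x \<Longrightarrow> \<phi> x = 0"
  shows "test_function \<phi>"
  unfolding test_function_def
proof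
  show "\<forall>k. Ck k \<phi>" using Ck_punctured[OF assms(1-4)] by blast
  have "{x. \<phi> x \<noteq> 0} \<subseteq> cball 0 R" using assms(5) by (force simp: not_less[symmetric])
  then have "bounded {x. \<phi> x \<noteq> 0}" using bounded_cball bounded_subset by blast
  then show "compact (closure {x. \<phi> x \<noteq> 0})" by simp
qed

section \<open>Laplacians of the correlation kernel\<close>

lemma laplacian_eqI:
  fixes \<phi> :: "real ^ 'n::finite \<Rightarrow> real"
  assumes x: "x \<noteq> 0"
    and D1: "\<And>i y. y \<noteq> 0 \<Longrightarrow> ((\<lambda>t. \<phi> (y + t *\<^sub>R axis i 1)) has_real_derivative \<phi>' i y) (at 0)"
    and D2: "\<And>i. ((\<lambda>t. \<phi>' i (x + t *\<^sub>R axis i 1)) has_real_derivative \<phi>'' i) (at 0)"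
  shows "laplacian \<phi> x = (\<Sum>i\<in>UNIV. \<phi>'' i)"
  unfolding laplacian_def
  by (intro sum.cong refl partial_deriv_eqI[OF _ x D2] partial_deriv_eqI[OF refl _ D1])

text \<open>The variable of the kernel. It is invariant under simultaneous rotations and dilations of \<open>x\<close> and \<open>z\<close>,
  and as a function of \<open>z\<close> it is a polynomial.\<close>
definition sqratio :: "real ^ 'n::finite \<Rightarrow> real ^ 'n \<Rightarrow> real" where
  "sqratio x z = ((z - x) \<bullet> (z - x)) / (x \<bullet> x)"

lemma inner_axis_one: "x \<bullet> axis i (1::real) = x $ i" "axis i (1::real) \<bullet> x = x $ i"
  for x :: "real ^ 'n::finite"
  by (simp_all add: inner_axis inner_axis')

lemma has_real_derivative_inner_self:
  fixes x :: "real ^ 'n::finite"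
  shows "((\<lambda>t. (x + t *\<^sub>R axis i 1) \<bullet> (x + t *\<^sub>R axis i 1)) has_real_derivative 2 * x $ i) (at 0)"
  by (auto simp: inner_add_left inner_add_right inner_axis_one intro!: derivative_eq_intros)

lemma has_real_derivative_component:
  fixes x :: "real ^ 'n::finite"
  shows "((\<lambda>t. (x + t *\<^sub>R axis i 1) $ i) has_real_derivative 1) (at 0)"
  by (auto intro!: derivative_eq_intros)

lemma sqratio_deriv_centre:
  fixes x z :: "real ^ 'n::finite"
  assumes "x \<noteq> 0"
  shows "((\<lambda>t. sqratio (x + t *\<^sub>R axis i 1) z) has_real_derivative
      2 * ((1 - sqratio x z) * x $ i - z $ i) / (x \<bullet> x)) (at 0)"
proof -
  have "((\<lambda>t. (z - (x + t *\<^sub>R axis i 1)) \<bullet> (z - (x + t *\<^sub>R axis i 1))) has_real_derivative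
      2 * (x $ i - z $ i)) (at 0)"
    by (auto simp: inner_add_left inner_add_right inner_diff_left inner_diff_right inner_axis_one
        intro!: derivative_eq_intros)
  from DERIV_divide[OF this has_real_derivative_inner_self] assms
  show ?thesis
    by (simp add: sqratio_def field_simps power2_eq_square)
qed

lemma sqratio_deriv_point:
  fixes x y :: "real ^ 'n::finite"
  assumes "x \<noteq> 0"
  shows "((\<lambda>t. sqratio x (s *\<^sub>R (y + t *\<^sub>R axis i 1))) has_real_derivative
      2 * s * (s * y $ i - x $ i) / (x \<bullet> x)) (at 0)"
proof -
  have "((\<lambda>t. (s *\<^sub>R (y + t *\<^sub>R axis i 1) - x) \<bullet> (s *\<^sub>R (y + t *\<^sub>R axis i 1) - x)) has_real_derivative
      2 * s * (s * y $ i - x $ i)) (at 0)"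
    by (auto simp: inner_add_left inner_add_right inner_diff_left inner_diff_right inner_axis_one
        scaleR_add_right algebra_simps intro!: derivative_eq_intros)
  from DERIV_cdivide[OF this, of "x \<bullet> x"] show ?thesis by (simp add: sqratio_def)
qed

text \<open>Second partial derivatives of functions of \<open>x \<bullet> x\<close>, \<open>x \<bullet> z\<close>, \<open>z \<bullet> z\<close> have this shape in each coordinate.\<close>
lemma sum_vec_quadratic:
  fixes x z :: "real ^ 'n::finite"
  shows "(\<Sum>i\<in>UNIV. A + B * (x $ i * x $ i) + C * (x $ i * z $ i) + D * (z $ i * z $ i))
    = A * CARD('n) + B * (x \<bullet> x) + C * (x \<bullet> z) + D * (z \<bullet> z)"
  by (simp add: sum.distrib sum_distrib_left[symmetric] inner_vec_def mult.commute)

text \<open>Eliminates the inner product, so that the Laplacians below become expressions in the two scale-invariant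
  quantities \<open>q\<close> and \<open>\<beta>\<close>.\<close>
lemma inner_via_sqratio:
  assumes "x \<noteq> 0"
  shows "x \<bullet> z = (x \<bullet> x + z \<bullet> z - sqratio x z * (x \<bullet> x)) / 2"
  using assms by (simp add: sqratio_def inner_diff_left inner_diff_right inner_commute field_simps)

text \<open>The terms with \<open>g2\<close> agree with those in \<open>laplacian_kernel_point\<close>: in polar coordinates they come from
  the spherical Laplacian and the squared radial derivative, which act in the same way on both
  arguments of a rotation-invariant homogeneous kernel.\<close>
lemma laplacian_kernel_centre:
  fixes x z :: "real ^ 'n::finite" and g g1 g2 :: "real \<Rightarrow> real" and q \<beta> :: real
  assumes x: "x \<noteq> 0" and k: "0 < k"
    and g: "\<And>t. (g has_real_derivative g1 t) (at t)" "\<And>t. (g1 has_real_derivative g2 t) (at t)"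
  defines "q \<equiv> sqratio x z" and "\<beta> \<equiv> (z \<bullet> z) / (x \<bullet> x)"
  shows "laplacian (\<lambda>x. (x \<bullet> x) * ((x \<bullet> x) ^ k * g (sqratio x z))) x =
    (x \<bullet> x) ^ k * ((real k + 1) * (2 * CARD('n) + 4 * real k) * g q
      + (4 * real k * (1 - q - \<beta>) + 2 * CARD('n) * (1 - q)) * g1 q + 4 * q * \<beta> * g2 q)"
proof -
  obtain l where l: "k = Suc l" using k gr0_conv_Suc by blast
  define w where "w i y = (1 - sqratio y z) * y $ i - z $ i" for i and y :: "real ^ 'n"
  have Dq: "((\<lambda>t. sqratio (y + t *\<^sub>R axis i 1) z) has_real_derivative 2 * w i y / (y \<bullet> y)) (at 0)"
    if "y \<noteq> 0" for y i
    using sqratio_deriv_centre[OF that] by (simp add: w_def)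
  have Dg: "((\<lambda>t. g (sqratio (y + t *\<^sub>R axis i 1) z)) has_real_derivative
      g1 (sqratio y z) * (2 * w i y / (y \<bullet> y))) (at 0)" if "y \<noteq> 0" for y i
    using DERIV_chain2[OF _ Dq[OF that], of g] g(1) by simp
  have Dg1: "((\<lambda>t. g1 (sqratio (y + t *\<^sub>R axis i 1) z)) has_real_derivative
      g2 (sqratio y z) * (2 * w i y / (y \<bullet> y))) (at 0)" if "y \<noteq> 0" for y i
    using DERIV_chain2[OF _ Dq[OF that], of g1] g(2) by simp
  have Dw: "((\<lambda>t. w i (y + t *\<^sub>R axis i 1)) has_real_derivative
      1 - sqratio y z - 2 * w i y / (y \<bullet> y) * y $ i) (at 0)" if "y \<noteq> 0" for y i
    unfolding w_def
    by (rule derivative_eq_intros Dq[OF that] has_real_derivative_component refl)+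
       (simp add: w_def)
  have Dp: "((\<lambda>t. ((y + t *\<^sub>R axis i 1) \<bullet> (y + t *\<^sub>R axis i 1)) ^ m) has_real_derivative
      real m * (y \<bullet> y) ^ (m - 1) * (2 * y $ i)) (at 0)" for y :: "real ^ 'n" and i m
    by (rule derivative_eq_intros has_real_derivative_inner_self refl)+ simp
  define F1 where "F1 i y = (y \<bullet> y) ^ k * (2 * (real k + 1) * y $ i * g (sqratio y z)
      + 2 * w i y * g1 (sqratio y z))" for i y
  define F2 where "F2 i = real k * (x \<bullet> x) ^ (k - 1) * (2 * x $ i) *
        (2 * (real k + 1) * x $ i * g q + 2 * w i x * g1 q)
      + (x \<bullet> x) ^ k * (2 * (real k + 1) * (g q + x $ i * (g1 q * (2 * w i x / (x \<bullet> x))))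
        + 2 * ((1 - q - 2 * w i x / (x \<bullet> x) * x $ i) * g1 q + w i x * (g2 q * (2 * w i x / (x \<bullet> x)))))"
    for i
  have "laplacian (\<lambda>x. (x \<bullet> x) * ((x \<bullet> x) ^ k * g (sqratio x z))) x = (\<Sum>i\<in>UNIV. F2 i)"
  proof (rule laplacian_eqI[OF x])
    show "((\<lambda>t. (y + t *\<^sub>R axis i 1) \<bullet> (y + t *\<^sub>R axis i 1) *
          (((y + t *\<^sub>R axis i 1) \<bullet> (y + t *\<^sub>R axis i 1)) ^ k * g (sqratio (y + t *\<^sub>R axis i 1) z)))
        has_real_derivative F1 i y) (at 0)" if y: "y \<noteq> 0" for i y
    proof -
      have "((\<lambda>t. ((y + t *\<^sub>R axis i 1) \<bullet> (y + t *\<^sub>R axis i 1)) ^ Suc k * g (sqratio (y + t *\<^sub>R axis i 1) z))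
        has_real_derivative (real (Suc k) * (y \<bullet> y) ^ (Suc k - 1) * (2 * y $ i)) * g (sqratio y z)
           + (g1 (sqratio y z) * (2 * w i y / (y \<bullet> y))) * (y \<bullet> y) ^ Suc k) (at 0)"
        using DERIV_mult[OF Dp[of y i "Suc k"] Dg[OF y]] by simp
      moreover have "(real (Suc k) * (y \<bullet> y) ^ (Suc k - 1) * (2 * y $ i)) * g (sqratio y z)
           + (g1 (sqratio y z) * (2 * w i y / (y \<bullet> y))) * (y \<bullet> y) ^ Suc k = F1 i y"
        using y by (simp add: F1_def field_simps)
      ultimately show ?thesis by (simp add: mult.assoc)
    qed
    show "((\<lambda>t. F1 i (x + t *\<^sub>R axis i 1)) has_real_derivative F2 i) (at 0)" for i
      unfolding F1_def
      by (rule DERIV_cong, (rule Dp has_real_derivative_component Dg[OF x] Dg1[OF x] Dw[OF x]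
             DERIV_cmult DERIV_mult DERIV_add)+)
         (simp add: F2_def q_def algebra_simps add_divide_distrib)
  qed
  also have "\<dots> = (\<Sum>i\<in>UNIV.
     (x \<bullet> x) ^ l * ((x \<bullet> x) * (2 * (real k + 1) * g q + 2 * (1 - q) * g1 q))
     + (x \<bullet> x) ^ l * (4 * real k * (real k + 1) * g q + 4 * real k * (1 - q) * g1 q
         + 4 * (real k + 1) * (1 - q) * g1 q - 4 * (1 - q) * g1 q + 4 * (1 - q)^2 * g2 q) * (x $ i * x $ i)
     + (x \<bullet> x) ^ l * (- 4 * real k * g1 q - 4 * (real k + 1) * g1 q + 4 * g1 q - 8 * (1 - q) * g2 q)
        * (x $ i * z $ i)
     + (x \<bullet> x) ^ l * (4 * g2 q) * (z $ i * z $ i))"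
    using x by (intro sum.cong refl)
      (simp add: F2_def w_def l q_def[symmetric], simp add: field_simps power2_eq_square)
  also have "\<dots> = (x \<bullet> x) ^ k * ((real k + 1) * (2 * CARD('n) + 4 * real k) * g q
      + (4 * real k * (1 - q - \<beta>) + 2 * CARD('n) * (1 - q)) * g1 q + 4 * q * \<beta> * g2 q)"
    unfolding sum_vec_quadratic unfolding inner_via_sqratio[OF x, of z] q_def[symmetric] \<beta>_def l
    using x by (simp add: field_simps power2_eq_square)
  finally show ?thesis .
qed

lemma laplacian_kernel_point:
  fixes x y :: "real ^ 'n::finite" and g g1 g2 :: "real \<Rightarrow> real" and C s q \<beta> :: real
  assumes x: "x \<noteq> 0" and y: "y \<noteq> 0"
    and g: "\<And>t. (g has_real_derivative g1 t) (at t)" "\<And>t. (g1 has_real_derivative g2 t) (at t)"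
  defines "q \<equiv> sqratio x (s *\<^sub>R y)" and "\<beta> \<equiv> ((s *\<^sub>R y) \<bullet> (s *\<^sub>R y)) / (x \<bullet> x)"
  shows "laplacian (\<lambda>y. (y \<bullet> y) * (C * g (sqratio x (s *\<^sub>R y)))) y =
    C * (2 * CARD('n) * g q + (- 4 * (1 - q - \<beta>) + 2 * CARD('n) * \<beta>) * g1 q + 4 * q * \<beta> * g2 q)"
proof -
  define w where "w i y = s * (s * y $ i - x $ i)" for i and y :: "real ^ 'n"
  have Dq: "((\<lambda>t. sqratio x (s *\<^sub>R (y + t *\<^sub>R axis i 1))) has_real_derivative 2 * w i y / (x \<bullet> x)) (at 0)"
    for y i
    using sqratio_deriv_point[OF x] by (simp add: w_def mult.assoc)
  have Dg: "((\<lambda>t. g (sqratio x (s *\<^sub>R (y + t *\<^sub>R axis i 1)))) has_real_derivative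
      g1 (sqratio x (s *\<^sub>R y)) * (2 * w i y / (x \<bullet> x))) (at 0)" for y i
    using DERIV_chain2[OF _ Dq, of g] g(1) by simp
  have Dg1: "((\<lambda>t. g1 (sqratio x (s *\<^sub>R (y + t *\<^sub>R axis i 1)))) has_real_derivative
      g2 (sqratio x (s *\<^sub>R y)) * (2 * w i y / (x \<bullet> x))) (at 0)" for y i
    using DERIV_chain2[OF _ Dq, of g1] g(2) by simp
  have Dw: "((\<lambda>t. w i (y + t *\<^sub>R axis i 1)) has_real_derivative s * s) (at 0)" for y i
    unfolding w_def by (rule derivative_eq_intros has_real_derivative_component refl)+ simp
  define F1 where "F1 i y = C * (2 * y $ i * g (sqratio x (s *\<^sub>R y))
      + (y \<bullet> y) * (g1 (sqratio x (s *\<^sub>R y)) * (2 * w i y / (x \<bullet> x))))" for i y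
  define F2 where "F2 i = C * (2 * g q + 2 * (2 * y $ i) * (g1 q * (2 * w i y / (x \<bullet> x)))
      + (y \<bullet> y) * (g2 q * (2 * w i y / (x \<bullet> x)) * (2 * w i y / (x \<bullet> x)) + g1 q * (2 * (s * s) / (x \<bullet> x))))"
    for i
  have "laplacian (\<lambda>y. (y \<bullet> y) * (C * g (sqratio x (s *\<^sub>R y)))) y = (\<Sum>i\<in>UNIV. F2 i)"
  proof (rule laplacian_eqI[OF y])
    show "((\<lambda>t. (y + t *\<^sub>R axis i 1) \<bullet> (y + t *\<^sub>R axis i 1) *
        (C * g (sqratio x (s *\<^sub>R (y + t *\<^sub>R axis i 1))))) has_real_derivative F1 i y) (at 0)" for i y
      by (rule DERIV_cong, (rule has_real_derivative_inner_self Dg DERIV_cmult DERIV_mult DERIV_add)+)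
         (simp add: F1_def algebra_simps)
    show "((\<lambda>t. F1 i (y + t *\<^sub>R axis i 1)) has_real_derivative F2 i) (at 0)" for i
      unfolding F1_def
      by (rule DERIV_cong, (rule has_real_derivative_inner_self has_real_derivative_component
             Dg Dg1 Dw DERIV_cdivide DERIV_cmult DERIV_mult DERIV_add)+)
         (simp add: F2_def q_def, simp add: algebra_simps add_divide_distrib)
  qed
  also have "\<dots> = (\<Sum>i\<in>UNIV.
     C * (2 * g q + (y \<bullet> y) * g1 q * 2 * s^2 / (x \<bullet> x))
     + C * ((y \<bullet> y) * g2 q * 4 * s^2 / (x \<bullet> x)^2) * (x $ i * x $ i)
     + C * (- 8 * s * g1 q / (x \<bullet> x) - 8 * s^3 * (y \<bullet> y) * g2 q / (x \<bullet> x)^2) * (x $ i * y $ i)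
     + C * (8 * s^2 * g1 q / (x \<bullet> x) + 4 * s^4 * (y \<bullet> y) * g2 q / (x \<bullet> x)^2) * (y $ i * y $ i))"
    using x by (intro sum.cong refl)
      (simp add: F2_def w_def, simp add: field_simps power2_eq_square power3_eq_cube power4_eq_xxxx)
  also have "\<dots> = C * (2 * CARD('n) * g q + (y \<bullet> y) * g1 q * 2 * s^2 / (x \<bullet> x) * CARD('n)
     + (y \<bullet> y) * g2 q * 4 * s^2 / (x \<bullet> x)
     + (- 8 * g1 q / (x \<bullet> x) - 8 * s^2 * (y \<bullet> y) * g2 q / (x \<bullet> x)^2) * (x \<bullet> (s *\<^sub>R y))
     + (8 * s^2 * g1 q / (x \<bullet> x) + 4 * s^4 * (y \<bullet> y) * g2 q / (x \<bullet> x)^2) * (y \<bullet> y))"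
    unfolding sum_vec_quadratic
    using x by (simp add: field_simps power2_eq_square power3_eq_cube)
  also have "\<dots> = C * (2 * CARD('n) * g q + (- 4 * (1 - q - \<beta>) + 2 * CARD('n) * \<beta>) * g1 q + 4 * q * \<beta> * g2 q)"
    unfolding inner_via_sqratio[OF x, of "s *\<^sub>R y"] q_def[symmetric] \<beta>_def
    using x by (simp add: field_simps power2_eq_square power4_eq_xxxx)
  finally show ?thesis .
qed

section \<open>Integration over pairs of comparable points\<close>

lemma nn_integral_lborel_affine:
  fixes t :: "'a::euclidean_space"
  assumes [measurable]: "f \<in> borel_measurable borel" and c: "c \<noteq> 0"
  shows "(\<integral>\<^sup>+x. f x \<partial>lborel) = ennreal (\<bar>c\<bar> ^ DIM('a)) * (\<integral>\<^sup>+x. f (t + c *\<^sub>R x) \<partial>lborel)"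
  by (subst lborel_affine[OF c, of t])
     (simp add: nn_integral_density nn_integral_distr nn_integral_cmult ennreal_power)

lemma integrable_lborel_affine:
  fixes t :: "'a::euclidean_space" and f :: "'a \<Rightarrow> real"
  assumes f: "integrable lborel f" and c: "c \<noteq> 0"
  shows "integrable lborel (\<lambda>x. f (t + c *\<^sub>R x))"
proof -
  have [measurable]: "f \<in> borel_measurable borel" using f by auto
  show ?thesis using f c unfolding integrable_iff_bounded
    by (subst (asm) nn_integral_lborel_affine[where c=c and t=t])
       (auto simp: ennreal_mult_less_top)
qed

lemma integral_lborel_affine:
  fixes t :: "'a::euclidean_space" and f :: "'a \<Rightarrow> real"
  assumes [measurable]: "f \<in> borel_measurable borel" and c: "c \<noteq> 0"
  shows "(LINT x|lborel. f x) = \<bar>c\<bar> ^ DIM('a) * (LINT x|lborel. f (t + c *\<^sub>R x))"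
  by (subst lborel_affine[OF c, of t])
     (simp add: integral_density integral_distr)

lemma AE_lborel_affine:
  fixes t :: "'a::euclidean_space"
  assumes c: "c \<noteq> 0" and "AE x in lborel. P x"
  shows "AE x in lborel. P (t + c *\<^sub>R x)"
proof -
  obtain N where N: "{x. \<not> P x} \<subseteq> N" "N \<in> null_sets lborel"
    using assms(2) by (auto elim: AE_E simp: null_sets_def)
  then have [measurable]: "N \<in> sets borel" by auto
  have "(\<integral>\<^sup>+x. indicator N x \<partial>lborel) = 0"
    using N(2) by (simp add: null_sets_def)
  then have "(\<integral>\<^sup>+x. indicator N (t + c *\<^sub>R x) \<partial>lborel) = 0"
    using c by (subst (asm) nn_integral_lborel_affine[where c=c and t=t]) auto
  then have "AE x in lborel. indicator N (t + c *\<^sub>R x) = (0::ennreal)"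
    by (subst (asm) nn_integral_0_iff_AE) auto
  then show ?thesis
    by eventually_elim (use N(1) in \<open>auto simp: indicator_def split: if_splits\<close>)
qed

text \<open>With bump width at most \<open>1/2\<close> and dilation factor \<open>s\<close> between \<open>1/2\<close> and \<open>2\<close>, every kernel evaluated at
  \<open>(x, s y)\<close> is supported here.\<close>
definition comparable :: "((real ^ 'n::finite) \<times> (real ^ 'n)) set" where
  "comparable = {(x, y). norm x \<le> 4 * norm y \<and> norm y \<le> 4 * norm x}"

text \<open>The exponent is the one for which a kernel homogeneous of degree \<open>2 k\<close> in the pair \<open>(x, y)\<close> defines a
  bounded bilinear form, since integrating it in one variable contributes \<open>CARD('n)\<close> further powers.\<close>
definition weight_L2 :: "nat \<Rightarrow> (real ^ 'n::finite \<Rightarrow> real) \<Rightarrow> bool" where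
  "weight_L2 k v \<longleftrightarrow> v \<in> borel_measurable borel \<and>
     integrable lborel (\<lambda>x. norm x ^ (2 * k + CARD('n)) * (v x)\<^sup>2)"

text \<open>One function that dominates all kernels and their derivatives, up to a constant depending on the bump
  width. It supplies integrability over pairs and the domination for differentiating in \<open>s\<close>.\<close>
definition majorant :: "nat \<Rightarrow> real ^ 'n::finite \<Rightarrow> real ^ 'n \<Rightarrow> real" where
  "majorant k x y = (x \<bullet> x) ^ k * indicator comparable (x, y)"

lemma comparable_measurable [measurable]:
  "(comparable :: ((real ^ 'n::finite) \<times> (real ^ 'n)) set) \<in> sets (borel \<Otimes>\<^sub>M borel)"
proof -
  have "comparable = {p \<in> space (borel \<Otimes>\<^sub>M borel).
      norm (fst p) \<le> 4 * norm (snd p) \<and> norm (snd p :: real ^ 'n) \<le> 4 * norm (fst p :: real ^ 'n)}"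
    by (auto simp: comparable_def space_pair_measure)
  also have "\<dots> \<in> sets (borel \<Otimes>\<^sub>M borel)" by measurable
  finally show ?thesis .
qed

lemma majorant_measurable [measurable]:
  "(\<lambda>(x, y). majorant k x y) \<in> borel_measurable (borel \<Otimes>\<^sub>M borel)"
  unfolding majorant_def by measurable

lemma majorant_nonneg: "0 \<le> majorant k x y"
  by (simp add: majorant_def)

lemma emeasure_cball_four_norm:
  "emeasure lborel (cball (0 :: real ^ 'n::finite) (4 * norm x)) =
    ennreal (unit_ball_vol CARD('n) * 4 ^ CARD('n) * norm x ^ CARD('n))"
  by (subst emeasure_cball) (auto simp: power_mult_distrib mult_ac)

lemma nn_integral_majorant_snd:
  fixes x :: "real ^ 'n::finite"
  shows "(\<integral>\<^sup>+y. ennreal (majorant k x y) \<partial>lborel) \<le>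
    ennreal (unit_ball_vol CARD('n) * 4 ^ CARD('n) * norm x ^ (2 * k + CARD('n)))"
proof -
  have "(\<integral>\<^sup>+y. ennreal (majorant k x y) \<partial>lborel) \<le>
      (\<integral>\<^sup>+y. ennreal ((x \<bullet> x) ^ k) * indicator (cball (0 :: real ^ 'n) (4 * norm x)) y \<partial>lborel)"
    by (intro nn_integral_mono)
       (auto simp: majorant_def comparable_def indicator_def)
  also have "\<dots> = ennreal ((x \<bullet> x) ^ k) * emeasure lborel (cball (0 :: real ^ 'n) (4 * norm x))"
    by (subst nn_integral_cmult) (auto intro!: borel_measurable_indicator)
  also have "\<dots> = ennreal (unit_ball_vol CARD('n) * 4 ^ CARD('n) * norm x ^ (2 * k + CARD('n)))"
    unfolding emeasure_cball_four_norm
    by (subst ennreal_mult[symmetric])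
       (auto simp: power_add power_mult[symmetric] dot_square_norm mult_ac unit_ball_vol_nonneg)
  finally show ?thesis .
qed

lemma nn_integral_majorant_fst:
  fixes y :: "real ^ 'n::finite"
  shows "(\<integral>\<^sup>+x. ennreal (majorant k x y) \<partial>lborel) \<le>
    ennreal (unit_ball_vol CARD('n) * 4 ^ CARD('n) * 16 ^ k * norm y ^ (2 * k + CARD('n)))"
proof -
  have "(\<integral>\<^sup>+x. ennreal (majorant k x y) \<partial>lborel) \<le>
      (\<integral>\<^sup>+x. ennreal ((16 * (y \<bullet> y)) ^ k) * indicator (cball (0 :: real ^ 'n) (4 * norm y)) x \<partial>lborel)"
  proof (intro nn_integral_mono)
    fix x :: "real ^ 'n"
    have "(x \<bullet> x) ^ k \<le> (16 * (y \<bullet> y)) ^ k" if "norm x \<le> 4 * norm y"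
      using power_mono[OF that, of 2] by (intro power_mono) (auto simp: dot_square_norm power_mult_distrib)
    then show "ennreal (majorant k x y) \<le> ennreal ((16 * (y \<bullet> y)) ^ k) * indicator (cball (0 :: real ^ 'n) (4 * norm y)) x"
      by (auto simp: majorant_def comparable_def indicator_def intro!: ennreal_leI)
  qed
  also have "\<dots> = ennreal ((16 * (y \<bullet> y)) ^ k) * emeasure lborel (cball (0 :: real ^ 'n) (4 * norm y))"
    by (subst nn_integral_cmult) (auto intro!: borel_measurable_indicator)
  also have "\<dots> = ennreal (unit_ball_vol CARD('n) * 4 ^ CARD('n) * 16 ^ k * norm y ^ (2 * k + CARD('n)))"
    unfolding emeasure_cball_four_norm
    by (subst ennreal_mult[symmetric])
       (auto simp: power_add power_mult[symmetric] dot_square_norm mult_ac power_mult_distrib unit_ball_vol_nonneg)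
  finally show ?thesis .
qed

lemma weight_L2_finite:
  fixes v :: "real ^ 'n::finite \<Rightarrow> real"
  assumes "weight_L2 k v"
  shows "(\<integral>\<^sup>+x. ennreal (norm x ^ (2 * k + CARD('n)) * (v x)\<^sup>2) \<partial>lborel) < \<infinity>"
  using assms unfolding weight_L2_def
  by (auto simp: integrable_iff_bounded)

text \<open>The two halves of Schur's test: \<open>majorant\<close> integrates in either variable to a multiple of the weight
  at the other one.\<close>
lemma integrable_sq_majorant:
  fixes v :: "real ^ 'n::finite \<Rightarrow> real"
  assumes v: "weight_L2 k v"
  shows "integrable (lborel \<Otimes>\<^sub>M lborel) (\<lambda>(x, y). (v x)\<^sup>2 * majorant k x y)"
    and "integrable (lborel \<Otimes>\<^sub>M lborel) (\<lambda>(x, y). (v y)\<^sup>2 * majorant k x y)"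
proof -
  have [measurable]: "v \<in> borel_measurable borel" using v by (simp add: weight_L2_def)
  have fin: "(\<integral>\<^sup>+x. ennreal (C * (norm x ^ (2 * k + CARD('n)) * (v x)\<^sup>2)) \<partial>lborel) < \<infinity>"
    if "0 \<le> C" for C
    using weight_L2_finite[OF v] that
    by (simp add: ennreal_mult nn_integral_cmult ennreal_mult_less_top)
  show "integrable (lborel \<Otimes>\<^sub>M lborel) (\<lambda>(x, y). (v x)\<^sup>2 * majorant k x y)"
  proof (rule integrableI_nonneg)
    have "(\<integral>\<^sup>+ p. ennreal (case p of (x, y) \<Rightarrow> (v x)\<^sup>2 * majorant k x y) \<partial>(lborel \<Otimes>\<^sub>M lborel))
      = (\<integral>\<^sup>+x. (\<integral>\<^sup>+y. ennreal ((v x)\<^sup>2 * majorant k x y) \<partial>lborel) \<partial>lborel)"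
      by (subst lborel.nn_integral_fst[symmetric]) auto
    also have "\<dots> = (\<integral>\<^sup>+x. ennreal ((v x)\<^sup>2) * (\<integral>\<^sup>+y. ennreal (majorant k x y) \<partial>lborel) \<partial>lborel)"
      by (simp add: ennreal_mult majorant_nonneg nn_integral_cmult)
    also have "\<dots> \<le> (\<integral>\<^sup>+x. ennreal ((v x)\<^sup>2) *
        ennreal (unit_ball_vol CARD('n) * 4 ^ CARD('n) * norm x ^ (2 * k + CARD('n))) \<partial>lborel)"
      by (intro nn_integral_mono mult_left_mono nn_integral_majorant_snd) auto
    also have "\<dots> = (\<integral>\<^sup>+x. ennreal (unit_ball_vol CARD('n) * 4 ^ CARD('n)
        * (norm x ^ (2 * k + CARD('n)) * (v x)\<^sup>2)) \<partial>lborel)"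
      by (intro nn_integral_cong) (simp add: ennreal_mult[symmetric] unit_ball_vol_nonneg mult_ac)
    also have "\<dots> < \<infinity>" by (rule fin) (simp add: unit_ball_vol_nonneg)
    finally show "(\<integral>\<^sup>+ p. ennreal (case p of (x, y) \<Rightarrow> (v x)\<^sup>2 * majorant k x y) \<partial>(lborel \<Otimes>\<^sub>M lborel)) < \<infinity>" .
  qed (auto simp: majorant_nonneg)
  show "integrable (lborel \<Otimes>\<^sub>M lborel) (\<lambda>(x, y). (v y)\<^sup>2 * majorant k x y)"
  proof (rule integrableI_nonneg)
    have "(\<integral>\<^sup>+ p. ennreal (case p of (x, y) \<Rightarrow> (v y)\<^sup>2 * majorant k x y) \<partial>(lborel \<Otimes>\<^sub>M lborel))
      = (\<integral>\<^sup>+y. (\<integral>\<^sup>+x. ennreal ((v y)\<^sup>2 * majorant k x y) \<partial>lborel) \<partial>lborel)"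
      by (subst lborel_pair.nn_integral_snd[symmetric]) auto
    also have "\<dots> = (\<integral>\<^sup>+y. ennreal ((v y)\<^sup>2) * (\<integral>\<^sup>+x. ennreal (majorant k x y) \<partial>lborel) \<partial>lborel)"
      by (simp add: ennreal_mult majorant_nonneg nn_integral_cmult)
    also have "\<dots> \<le> (\<integral>\<^sup>+x. ennreal ((v x)\<^sup>2) *
        ennreal (unit_ball_vol CARD('n) * 4 ^ CARD('n) * 16 ^ k * norm x ^ (2 * k + CARD('n))) \<partial>lborel)"
      by (intro nn_integral_mono mult_left_mono nn_integral_majorant_fst) auto
    also have "\<dots> = (\<integral>\<^sup>+x. ennreal (unit_ball_vol CARD('n) * 4 ^ CARD('n) * 16 ^ k
        * (norm x ^ (2 * k + CARD('n)) * (v x)\<^sup>2)) \<partial>lborel)"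
      by (intro nn_integral_cong) (simp add: ennreal_mult[symmetric] unit_ball_vol_nonneg mult_ac)
    also have "\<dots> < \<infinity>" by (rule fin) (simp add: unit_ball_vol_nonneg)
    finally show "(\<integral>\<^sup>+ p. ennreal (case p of (x, y) \<Rightarrow> (v y)\<^sup>2 * majorant k x y) \<partial>(lborel \<Otimes>\<^sub>M lborel)) < \<infinity>" .
  qed (auto simp: majorant_nonneg)
qed

lemma abs_mult_le_squares: "\<bar>a * b\<bar> \<le> (a\<^sup>2 + b\<^sup>2)" for a b :: real
proof -
  have "2 * (\<bar>a\<bar> * \<bar>b\<bar>) \<le> \<bar>a\<bar>\<^sup>2 + \<bar>b\<bar>\<^sup>2" using sum_squares_bound[of "\<bar>a\<bar>" "\<bar>b\<bar>"] by simp
  moreover have "0 \<le> \<bar>a\<bar> * \<bar>b\<bar>" by simp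
  ultimately show ?thesis unfolding abs_mult power2_abs by linarith
qed

lemma integrable_product_majorant:
  fixes v w :: "real ^ 'n::finite \<Rightarrow> real"
  assumes v: "weight_L2 k v" and w: "weight_L2 k w"
    and K: "(\<lambda>(x, y). K x y) \<in> borel_measurable (borel \<Otimes>\<^sub>M borel)"
      "\<And>x y. \<bar>K x y\<bar> \<le> C * majorant k x y"
  shows "integrable (lborel \<Otimes>\<^sub>M lborel) (\<lambda>(x, y). v x * w y * K x y)"
    and "integrable (lborel \<Otimes>\<^sub>M lborel) (\<lambda>(x, y). v x * w x * K x y)"
    and "integrable (lborel \<Otimes>\<^sub>M lborel) (\<lambda>(x, y). (v y)\<^sup>2 * K x y)"
proof -
  note [measurable] = K(1)
  have [measurable]: "v \<in> borel_measurable borel" "w \<in> borel_measurable borel"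
    using v w by (auto simp: weight_L2_def)
  have b: "\<bar>a * b * K x y\<bar> \<le> C * (a\<^sup>2 * majorant k x y + b\<^sup>2 * majorant k x y)" for a b x y
  proof -
    have "\<bar>a * b * K x y\<bar> \<le> (a\<^sup>2 + b\<^sup>2) * (C * majorant k x y)"
      unfolding abs_mult[of "a * b"]
      by (intro mult_mono abs_mult_le_squares K(2)) auto
    then show ?thesis by (simp add: algebra_simps)
  qed
  note I = integrable_sq_majorant[OF v] integrable_sq_majorant[OF w]
  show "integrable (lborel \<Otimes>\<^sub>M lborel) (\<lambda>(x, y). v x * w y * K x y)"
    by (rule Bochner_Integration.integrable_bound[OF
          integrable_mult_right[where c=C, OF Bochner_Integration.integrable_add[OF I(1) I(4)]]])
       (auto simp: split_beta' intro!: order.trans[OF b] order.trans[OF _ abs_ge_self])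
  show "integrable (lborel \<Otimes>\<^sub>M lborel) (\<lambda>(x, y). v x * w x * K x y)"
    by (rule Bochner_Integration.integrable_bound[OF
          integrable_mult_right[where c=C, OF Bochner_Integration.integrable_add[OF I(1) I(3)]]])
       (auto simp: split_beta' intro!: order.trans[OF b] order.trans[OF _ abs_ge_self])
  show "integrable (lborel \<Otimes>\<^sub>M lborel) (\<lambda>(x, y). (v y)\<^sup>2 * K x y)"
    unfolding power2_eq_square[of "v _"]
    by (rule Bochner_Integration.integrable_bound[OF
          integrable_mult_right[where c=C, OF Bochner_Integration.integrable_add[OF I(2) I(2)]]])
       (auto simp: split_beta' intro!: order.trans[OF b] order.trans[OF _ abs_ge_self])
qed

text \<open>Differentiation under the integral sign: difference quotients along a sequence are dominated by \<open>W\<close>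
  through the mean value inequality.\<close>
lemma DERIV_integral_dominated:
  fixes F F' :: "real \<Rightarrow> 'a \<Rightarrow> real"
  assumes s0: "s0 \<in> {a<..<b}"
    and int: "\<And>s. s \<in> {a<..<b} \<Longrightarrow> integrable M (F s)"
    and D: "\<And>s z. z \<in> space M \<Longrightarrow> s \<in> {a<..<b} \<Longrightarrow> ((\<lambda>s. F s z) has_real_derivative F' s z) (at s)"
    and m: "F' s0 \<in> borel_measurable M"
    and W: "integrable M W"
    and bnd: "\<And>s z. z \<in> space M \<Longrightarrow> s \<in> {a<..<b} \<Longrightarrow> \<bar>F' s z\<bar> \<le> W z"
  shows "((\<lambda>s. integral\<^sup>L M (F s)) has_real_derivative integral\<^sup>L M (F' s0)) (at s0)"
  unfolding has_field_derivative_iff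
proof (rule tendsto_at_iff_sequentially[THEN iffD2], intro allI impI)
  fix X :: "nat \<Rightarrow> real" assume X: "\<forall>i. X i \<in> UNIV - {s0}" "X \<longlonglongrightarrow> s0"
  define h where "h i = (if X i \<in> {a<..<b} then X i else (s0 + b) / 2)" for i
  have h: "h i \<in> {a<..<b}" "h i \<noteq> s0" for i using X s0 by (auto simp: h_def)
  have "\<forall>\<^sub>F i in sequentially. X i \<in> {a<..<b}"
    using X(2) s0 by (auto simp: tendsto_def)
  then have hX: "\<forall>\<^sub>F i in sequentially. h i = X i" by eventually_elim (simp add: h_def)
  have hlim: "h \<longlonglongrightarrow> s0"
    using X(2) by (rule Lim_transform_eventually) (use hX in eventually_elim, simp)
  have "(\<lambda>i. integral\<^sup>L M (\<lambda>z. (F (h i) z - F s0 z) / (h i - s0))) \<longlonglongrightarrow> integral\<^sup>L M (F' s0)"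
  proof (rule integral_dominated_convergence[where w=W])
    show "(\<lambda>z. (F (h i) z - F s0 z) / (h i - s0)) \<in> borel_measurable M" for i
      using int[OF h(1)] int[OF s0] by (auto intro!: borel_measurable_divide borel_measurable_diff)
    show "AE z in M. (\<lambda>i. (F (h i) z - F s0 z) / (h i - s0)) \<longlonglongrightarrow> F' s0 z"
    proof (rule AE_I2)
      fix z assume "z \<in> space M"
      from D[OF this s0] have "((\<lambda>s. (F s z - F s0 z) / (s - s0)) \<longlongrightarrow> F' s0 z) (at s0)"
        by (simp add: has_field_derivative_iff)
      then show "(\<lambda>i. (F (h i) z - F s0 z) / (h i - s0)) \<longlonglongrightarrow> F' s0 z"
        using hlim h(2) unfolding tendsto_at_iff_sequentially by (auto simp: o_def)
    qed
    show "AE z in M. norm ((F (h i) z - F s0 z) / (h i - s0)) \<le> W z" for i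
    proof (rule AE_I2)
      fix z assume z: "z \<in> space M"
      have seg: "closed_segment s0 (h i) \<subseteq> {a<..<b}"
        using s0 h(1)[of i] by (simp add: closed_segment_subset)
      have "norm (F (h i) z - F s0 z) \<le> W z * norm (h i - s0)"
        by (rule field_differentiable_bound[OF convex_closed_segment, of s0 "h i" "\<lambda>s. F s z" "\<lambda>s. F' s z"])
           (use seg bnd[OF z] in \<open>auto intro!: has_field_derivative_at_within D[OF z]\<close>)
      then show "norm ((F (h i) z - F s0 z) / (h i - s0)) \<le> W z"
        using h(2)[of i] by (simp add: divide_le_eq abs_divide)
    qed
  qed (use m W in auto)
  moreover have "integral\<^sup>L M (\<lambda>z. (F (h i) z - F s0 z) / (h i - s0)) =
      (integral\<^sup>L M (F (h i)) - integral\<^sup>L M (F s0)) / (h i - s0)" for i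
    using int[OF h(1)] int[OF s0] by simp
  ultimately have "(\<lambda>i. (integral\<^sup>L M (F (h i)) - integral\<^sup>L M (F s0)) / (h i - s0)) \<longlonglongrightarrow> integral\<^sup>L M (F' s0)"
    by (simp only:)
  then have "(\<lambda>i. (integral\<^sup>L M (F (X i)) - integral\<^sup>L M (F s0)) / (X i - s0)) \<longlonglongrightarrow> integral\<^sup>L M (F' s0)"
    by (rule Lim_transform_eventually) (use hX in eventually_elim, simp)
  then show "((\<lambda>y. (integral\<^sup>L M (F y) - integral\<^sup>L M (F s0)) / (y - s0)) \<circ> X) \<longlonglongrightarrow> integral\<^sup>L M (F' s0)"
    by (simp add: o_def)
qed

section \<open>Density of continuous functions in the weighted space\<close>

definition weight_norm2 :: "nat \<Rightarrow> (real ^ 'n::finite \<Rightarrow> real) \<Rightarrow> real" where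
  "weight_norm2 k v = (LINT x|lborel. norm x ^ (2 * k + CARD('n)) * (v x)\<^sup>2)"

lemma weight_L2_measurable: "weight_L2 k v \<Longrightarrow> v \<in> borel_measurable borel"
  by (simp add: weight_L2_def)

lemma weight_norm2_nonneg: "0 \<le> weight_norm2 k v"
  unfolding weight_norm2_def by (intro Bochner_Integration.integral_nonneg) auto

lemma integrable_weight_mult:
  fixes v w :: "real ^ 'n::finite \<Rightarrow> real"
  assumes "weight_L2 k v" "weight_L2 k w"
  shows "integrable lborel (\<lambda>x. norm x ^ (2 * k + CARD('n)) * (v x * w x))"
proof (rule Bochner_Integration.integrable_bound)
  show "integrable lborel (\<lambda>x. norm x ^ (2 * k + CARD('n)) * (v x)\<^sup>2 + norm x ^ (2 * k + CARD('n)) * (w x)\<^sup>2)"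
    using assms unfolding weight_L2_def by auto
  show "(\<lambda>x. norm x ^ (2 * k + CARD('n)) * (v x * w x)) \<in> borel_measurable lborel"
    using assms[THEN weight_L2_measurable] by measurable
  show "AE x in lborel. norm (norm x ^ (2 * k + CARD('n)) * (v x * w x)) \<le>
    norm (norm x ^ (2 * k + CARD('n)) * (v x)\<^sup>2 + norm x ^ (2 * k + CARD('n)) * (w x)\<^sup>2)"
  proof (rule AE_I2)
    fix x
    have "norm x ^ (2 * k + CARD('n)) * \<bar>v x * w x\<bar> \<le> norm x ^ (2 * k + CARD('n)) * ((v x)\<^sup>2 + (w x)\<^sup>2)"
      by (intro mult_left_mono abs_mult_le_squares) auto
    then show "norm (norm x ^ (2 * k + CARD('n)) * (v x * w x)) \<le>
      norm (norm x ^ (2 * k + CARD('n)) * (v x)\<^sup>2 + norm x ^ (2 * k + CARD('n)) * (w x)\<^sup>2)"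
      by (simp add: abs_mult distrib_left)
  qed
qed

lemma weight_L2_diff:
  fixes v w :: "real ^ 'n::finite \<Rightarrow> real"
  assumes v: "weight_L2 k v" and w: "weight_L2 k w"
  shows "weight_L2 k (\<lambda>x. v x - w x)"
proof -
  have "integrable lborel (\<lambda>x. norm x ^ (2 * k + CARD('n)) * (v x)\<^sup>2
      + norm x ^ (2 * k + CARD('n)) * (w x)\<^sup>2 - 2 * (norm x ^ (2 * k + CARD('n)) * (v x * w x)))"
    using v w integrable_weight_mult[OF v w] unfolding weight_L2_def
    by (intro Bochner_Integration.integrable_diff Bochner_Integration.integrable_add integrable_mult_right) auto
  then have "integrable lborel (\<lambda>x. norm x ^ (2 * k + CARD('n)) * (v x - w x)\<^sup>2)"
    by (simp add: power2_diff algebra_simps)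
  then show ?thesis using v w by (auto simp: weight_L2_def)
qed

lemma integrable_bounded_cball:
  fixes h :: "'a::euclidean_space \<Rightarrow> real"
  assumes "h \<in> borel_measurable borel" "\<And>x. \<bar>h x\<bar> \<le> B * indicator (cball 0 R) x"
  shows "integrable lborel h"
proof (rule Bochner_Integration.integrable_bound)
  show "integrable lborel (\<lambda>x. B * indicator (cball (0::'a) R) x :: real)"
    by (intro integrable_mult_right integrable_real_indicator) (use emeasure_bounded_finite[OF bounded_cball] in auto)
  show "AE x in lborel. norm (h x) \<le> norm (B * indicator (cball 0 R) x :: real)"
    using assms(2) by (auto intro!: AE_I2 order.trans[OF assms(2)])
qed (use assms in auto)

lemma weight_L2_bounded:
  fixes v :: "real ^ 'n::finite \<Rightarrow> real"
  assumes v: "v \<in> borel_measurable borel" and b: "\<And>x. \<bar>v x\<bar> \<le> B" and s: "\<And>x. R < norm x \<Longrightarrow> v x = 0"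
  shows "weight_L2 k v"
proof -
  have "\<bar>norm x ^ m * (v x)\<^sup>2\<bar> \<le> (\<bar>R\<bar> ^ m * B\<^sup>2) * indicator (cball 0 R) x" for x m
  proof (cases "norm x \<le> R")
    case True
    have "(v x)\<^sup>2 \<le> B\<^sup>2" using power_mono[OF b[of x], of 2] by simp
    moreover have "norm x ^ m \<le> \<bar>R\<bar> ^ m" using True by (intro power_mono) auto
    ultimately show ?thesis using True by (simp add: abs_mult mult_mono)
  qed (use s in auto)
  then show ?thesis using v unfolding weight_L2_def
    by (intro conjI integrable_bounded_cball) auto
qed

text \<open>A measurable function is an almost everywhere limit of continuous functions. Truncating it in space and
  in height first gives the approximants a common bounded majorant with compact support.\<close>
lemma weight_L2_approx_continuous:
  fixes v :: "real ^ 'n::finite \<Rightarrow> real"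
  assumes v: "weight_L2 k v" and e: "0 < e"
  shows "\<exists>\<phi> R B. continuous_on UNIV \<phi> \<and> (\<forall>x. R < norm x \<longrightarrow> \<phi> x = 0) \<and> (\<forall>x. \<bar>\<phi> x\<bar> \<le> B)
    \<and> weight_norm2 k (\<lambda>x. v x - \<phi> x) < e"
proof -
  have [measurable]: "v \<in> borel_measurable borel" using v by (rule weight_L2_measurable)
  let ?W = "\<lambda>x::real^'n. norm x ^ (2 * k + CARD('n))"
  \<comment> \<open>truncation to height \<open>N\<close>, times a continuous cutoff that is \<open>1\<close> for \<open>|x| \<le> N\<close> and \<open>0\<close> for \<open>|x| > N + 1\<close>\<close>
  define cut where "cut N h x = max 0 (min 1 (real N + 1 - norm x)) * max (- real N) (min (real N) (h x))"
    for N :: nat and h and x :: "real ^ 'n"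
  have cut_bound: "\<bar>cut N h x\<bar> \<le> real N" for N h x
  proof -
    have "\<bar>max 0 (min 1 (real N + 1 - norm x))\<bar> * \<bar>max (- real N) (min (real N) (h x))\<bar> \<le> 1 * real N"
      by (intro mult_mono) auto
    then show ?thesis by (simp add: cut_def abs_mult)
  qed
  have cut_supp: "cut N h x = 0" if "real N + 1 < norm x" for N h x
    using that by (simp add: cut_def)
  have cut_L2: "weight_L2 k (cut N h)" if "h \<in> borel_measurable borel" for N h
  proof (rule weight_L2_bounded[OF _ cut_bound cut_supp])
    show "cut N h \<in> borel_measurable borel"
      using that unfolding cut_def[abs_def] by measurable
  qed
  have cut_v: "\<bar>v x - cut N v x\<bar> \<le> \<bar>v x\<bar>" for N x
  proof -
    define t where "t = max 0 (min 1 (real N + 1 - norm x))"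
    define c where "c = max (- real N) (min (real N) (v x))"
    have t: "0 \<le> t" "t \<le> 1" by (auto simp: t_def)
    have cut: "cut N v x = t * c" by (simp add: cut_def t_def c_def)
    consider "0 \<le> v x" "0 \<le> c" "c \<le> v x" | "v x \<le> 0" "c \<le> 0" "v x \<le> c"
      unfolding c_def by linarith
    then show ?thesis
    proof cases
      case 1
      then have "t * c \<le> c" "0 \<le> t * c" using t by (simp_all add: mult_left_le_one_le)
      then show ?thesis using 1 by (simp add: cut)
    next
      case 2
      then have "c \<le> t * c" "t * c \<le> 0" using t
        by (simp_all add: mult_nonneg_nonpos mult_le_cancel_right1)
      then show ?thesis using 2 by (simp add: cut)
    qed
  qed
  have "(\<lambda>N. LINT x|lborel. ?W x * (v x - cut N v x)\<^sup>2) \<longlonglongrightarrow> (LINT x::real^'n|lborel. (0::real))"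
  proof (rule integral_dominated_convergence[where w="\<lambda>x. ?W x * (v x)\<^sup>2"])
    show "integrable lborel (\<lambda>x. ?W x * (v x)\<^sup>2)" using v by (simp add: weight_L2_def)
    show "AE x in lborel. (\<lambda>N. ?W x * (v x - cut N v x)\<^sup>2) \<longlonglongrightarrow> 0"
    proof (rule AE_I2)
      fix x
      have "\<forall>\<^sub>F N in sequentially. nat \<lceil>\<bar>v x\<bar> + norm x\<rceil> \<le> N" by (rule eventually_ge_at_top)
      then have "\<forall>\<^sub>F N in sequentially. ?W x * (v x - cut N v x)\<^sup>2 = 0"
      proof eventually_elim
        case (elim N)
        then have "\<bar>v x\<bar> + norm x \<le> real N" by linarith
        then have "\<bar>v x\<bar> \<le> real N" "norm x \<le> real N" using norm_ge_zero[of x] abs_ge_zero[of "v x"] by linarith+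
        then have "cut N v x = v x" by (simp add: cut_def)
        then show ?case by simp
      qed
      then show "(\<lambda>N. ?W x * (v x - cut N v x)\<^sup>2) \<longlonglongrightarrow> 0" by (rule tendsto_eventually)
    qed
    show "AE x in lborel. norm (?W x * (v x - cut N v x)\<^sup>2) \<le> ?W x * (v x)\<^sup>2" for N
      using cut_v by (auto intro!: AE_I2 mult_left_mono simp: abs_mult abs_le_square_iff)
  qed (simp_all add: cut_def)
  then have "(\<lambda>N. LINT x|lborel. ?W x * (v x - cut N v x)\<^sup>2) \<longlonglongrightarrow> 0" by simp
  from order_tendstoD(2)[OF this, of "e / 4"] e
  obtain N where N: "(LINT x|lborel. ?W x * (v x - cut N v x)\<^sup>2) < e / 4"
    by (auto simp: eventually_sequentially)
  have "v measurable_on UNIV"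
    by (rule lebesgue_measurable_imp_measurable_on) (auto intro: measurable_completion)
  then obtain N0 g where g: "negligible N0" "\<And>j::nat. continuous_on UNIV (g j)"
    "\<And>x. x \<notin> N0 \<Longrightarrow> (\<lambda>j. g j x) \<longlonglongrightarrow> v x"
    unfolding measurable_on_def by auto
  have [measurable]: "g j \<in> borel_measurable borel" for j
    using g(2) by (rule borel_measurable_continuous_onI)
  have "(\<lambda>j. LINT x|lborel. ?W x * (cut N v x - cut N (g j) x)\<^sup>2) \<longlonglongrightarrow> (LINT x::real^'n|lborel. (0::real))"
  proof (rule integral_dominated_convergence[where
        w="\<lambda>x. ((real N + 1) ^ (2 * k + CARD('n)) * (2 * real N)\<^sup>2) * indicator (cball 0 (real N + 1)) x"])
    show "integrable lborel (\<lambda>x::real^'n. ((real N + 1) ^ (2 * k + CARD('n)) * (2 * real N)\<^sup>2) * indicator (cball 0 (real N + 1)) x)"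
      by (intro integrable_mult_right integrable_real_indicator) (use emeasure_bounded_finite[OF bounded_cball] in auto)
    have "AE x in lebesgue. x \<notin> N0" using g(1) by (simp add: AE_not_in negligible_iff_null_sets)
    then have "AE x in lborel. x \<notin> N0" by (simp add: AE_completion_iff)
    then show "AE x in lborel. (\<lambda>j. ?W x * (cut N v x - cut N (g j) x)\<^sup>2) \<longlonglongrightarrow> 0"
    proof eventually_elim
      case (elim x)
      have "(\<lambda>j. ?W x * (cut N v x - cut N (g j) x)\<^sup>2) \<longlonglongrightarrow> ?W x * (cut N v x - cut N v x)\<^sup>2"
        unfolding cut_def by (intro tendsto_intros g(3) elim)
      then show ?case by simp
    qed
    show "AE x in lborel. norm (?W x * (cut N v x - cut N (g j) x)\<^sup>2) \<le>
      ((real N + 1) ^ (2 * k + CARD('n)) * (2 * real N)\<^sup>2) * indicator (cball 0 (real N + 1)) x" for j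
    proof (rule AE_I2)
      fix x :: "real ^ 'n"
      show "norm (?W x * (cut N v x - cut N (g j) x)\<^sup>2) \<le>
        ((real N + 1) ^ (2 * k + CARD('n)) * (2 * real N)\<^sup>2) * indicator (cball 0 (real N + 1)) x"
      proof (cases "norm x \<le> real N + 1")
        case True
        have "\<bar>cut N v x - cut N (g j) x\<bar> \<le> \<bar>2 * real N\<bar>"
          using cut_bound[of N v x] cut_bound[of N "g j" x] by linarith
        then have "(cut N v x - cut N (g j) x)\<^sup>2 \<le> (2 * real N)\<^sup>2"
          by (simp only: abs_le_square_iff)
        moreover have "?W x \<le> (real N + 1) ^ (2 * k + CARD('n))"
          using True by (intro power_mono) auto
        ultimately show ?thesis using True by (simp add: abs_mult mult_mono)
      qed (use cut_supp in auto)
    qed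
  qed (simp_all add: cut_def)
  then have "(\<lambda>j. LINT x|lborel. ?W x * (cut N v x - cut N (g j) x)\<^sup>2) \<longlonglongrightarrow> 0" by simp
  from order_tendstoD(2)[OF this, of "e / 4"] e
  obtain j where j: "(LINT x|lborel. ?W x * (cut N v x - cut N (g j) x)\<^sup>2) < e / 4"
    by (auto simp: eventually_sequentially)
  have L: "weight_L2 k (cut N v)" "weight_L2 k (cut N (g j))" using cut_L2 by auto
  note D = weight_L2_diff[OF v L(1)] weight_L2_diff[OF L] weight_L2_diff[OF v L(2)]
  have "weight_norm2 k (\<lambda>x. v x - cut N (g j) x) \<le>
    (LINT x|lborel. 2 * (?W x * (v x - cut N v x)\<^sup>2) + 2 * (?W x * (cut N v x - cut N (g j) x)\<^sup>2))"
    unfolding weight_norm2_def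
  proof (rule integral_mono)
    fix x
    have "(v x - cut N (g j) x)\<^sup>2 \<le> 2 * (v x - cut N v x)\<^sup>2 + 2 * (cut N v x - cut N (g j) x)\<^sup>2"
      using sum_squares_bound[of "v x - cut N v x" "cut N v x - cut N (g j) x"]
      by (simp add: power2_eq_square algebra_simps)
    then have "?W x * (v x - cut N (g j) x)\<^sup>2 \<le> ?W x * (2 * (v x - cut N v x)\<^sup>2 + 2 * (cut N v x - cut N (g j) x)\<^sup>2)"
      by (intro mult_left_mono) auto
    then show "?W x * (v x - cut N (g j) x)\<^sup>2 \<le>
        2 * (?W x * (v x - cut N v x)\<^sup>2) + 2 * (?W x * (cut N v x - cut N (g j) x)\<^sup>2)"
      by (simp add: algebra_simps)
  qed (use D in \<open>auto simp: weight_L2_def\<close>)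
  also have "\<dots> = 2 * (LINT x|lborel. ?W x * (v x - cut N v x)\<^sup>2) + 2 * (LINT x|lborel. ?W x * (cut N v x - cut N (g j) x)\<^sup>2)"
    using D by (simp add: weight_L2_def)
  also have "\<dots> < e" using N j by simp
  finally have "weight_norm2 k (\<lambda>x. v x - cut N (g j) x) < e" .
  moreover have "continuous_on UNIV (cut N (g j))"
    unfolding cut_def by (intro continuous_intros g(2))
  ultimately show ?thesis using cut_supp cut_bound by blast
qed

section \<open>The kernel as an approximate identity\<close>

text \<open>A bump in \<open>y\<close> around \<open>x\<close> of width \<open>\<epsilon> |x|\<close>. The prefactor is an even power of the norm, hence polynomial
  in \<open>x\<close>.\<close>
definition kern :: "nat \<Rightarrow> real \<Rightarrow> real ^ 'n::finite \<Rightarrow> real ^ 'n \<Rightarrow> real" where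
  "kern k \<epsilon> x y = (x \<bullet> x) ^ k * (flat 0 (1 - sqratio x y / \<epsilon>\<^sup>2) / \<epsilon> ^ CARD('n))"

definition bump_mass :: "'n::finite itself \<Rightarrow> real" where
  "bump_mass _ = (LINT z::real^'n|lborel. flat 0 (1 - z \<bullet> z))"

lemma sqratio_measurable [measurable]:
  assumes [measurable]: "f \<in> borel_measurable M" "g \<in> borel_measurable M"
  shows "(\<lambda>x. sqratio (f x) (g x)) \<in> borel_measurable M"
  unfolding sqratio_def by measurable

lemma kern_measurable [measurable]:
  assumes [measurable]: "f \<in> borel_measurable M" "g \<in> borel_measurable M"
  shows "(\<lambda>x. kern k \<epsilon> (f x) (g x)) \<in> borel_measurable M"
  unfolding kern_def by measurable

lemma kern_nonneg: "0 < \<epsilon> \<Longrightarrow> 0 \<le> kern k \<epsilon> x y"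
  by (simp add: kern_def flat_nonneg)

text \<open>Outside the cone \<open>|y - x| < \<epsilon> |x|\<close> the argument of the bump is nonpositive.\<close>
lemma flat_sqratio_support:
  fixes x y :: "real ^ 'n::finite"
  assumes "0 < \<epsilon>" "x \<noteq> 0" "\<epsilon> * norm x \<le> norm (y - x)"
  shows "flat j (1 - sqratio x y / \<epsilon>\<^sup>2) = 0"
proof (rule flat_eq_0)
  have "(\<epsilon> * norm x)\<^sup>2 \<le> (norm (y - x))\<^sup>2" using assms by (intro power_mono) auto
  then have "\<epsilon>\<^sup>2 \<le> sqratio x y"
    using assms by (simp add: sqratio_def dot_square_norm power_mult_distrib field_simps)
  then show "1 - sqratio x y / \<epsilon>\<^sup>2 \<le> 0" using assms(1) by (simp add: field_simps)
qed

lemma kern_support: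
  fixes x y :: "real ^ 'n::finite"
  assumes "0 < \<epsilon>" "0 < k" "kern k \<epsilon> x y \<noteq> 0"
  shows "x \<noteq> 0" "norm (y - x) < \<epsilon> * norm x"
proof -
  show x: "x \<noteq> 0" using assms(2,3) by (auto simp: kern_def)
  show "norm (y - x) < \<epsilon> * norm x"
    using flat_sqratio_support[OF assms(1) x, of y 0] assms(3) by (auto simp: kern_def not_less[symmetric])
qed

lemma comparable_scaled:
  fixes x y :: "real ^ 'n::finite"
  assumes "norm (s *\<^sub>R y - x) \<le> \<epsilon> * norm x" "\<epsilon> \<le> 1/2" "1/2 \<le> s" "s \<le> 2"
  shows "norm x \<le> 4 * norm y" "norm y \<le> 4 * norm x"
proof -
  have e: "\<epsilon> * norm x \<le> norm x / 2" using mult_right_mono[OF assms(2), of "norm x"] by simp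
  have "norm x \<le> norm (s *\<^sub>R y) + norm (s *\<^sub>R y - x)"
    using norm_triangle_ineq4[of "s *\<^sub>R y" "s *\<^sub>R y - x"] by simp
  then have "norm x \<le> 2 * (s * norm y)" using assms e by simp
  moreover have "s * norm y \<le> 2 * norm y" using assms by (intro mult_right_mono) auto
  ultimately show "norm x \<le> 4 * norm y" by simp
  have "norm (s *\<^sub>R y) \<le> norm x + norm (s *\<^sub>R y - x)"
    using norm_triangle_sub[of "s *\<^sub>R y" x] by simp
  then have "s * norm y \<le> 3/2 * norm x" using assms e by simp
  moreover have "1/2 * norm y \<le> s * norm y" using assms by (intro mult_right_mono) auto
  ultimately show "norm y \<le> 4 * norm x" using norm_ge_zero[of x] by linarith
qed

lemma kern_le_majorant:
  fixes x y :: "real ^ 'n::finite"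
  assumes "0 < \<epsilon>" "\<epsilon> \<le> 1/2" "0 < k" "1/2 \<le> s" "s \<le> 2"
  shows "\<bar>kern k \<epsilon> x (s *\<^sub>R y)\<bar> \<le> 1 / \<epsilon> ^ CARD('n) * majorant k x y"
proof (cases "kern k \<epsilon> x (s *\<^sub>R y) = 0")
  case True
  then show ?thesis using assms majorant_nonneg[of k x y] by simp
next
  case False
  have "(x, y) \<in> comparable"
    using comparable_scaled[OF less_imp_le[OF kern_support(2)[OF assms(1,3) False]] assms(2,4,5)]
    by (simp add: comparable_def)
  moreover have "(x \<bullet> x) ^ k * (flat 0 (1 - sqratio x (s *\<^sub>R y) / \<epsilon>\<^sup>2) / \<epsilon> ^ CARD('n)) \<le> (x \<bullet> x) ^ k * (1 / \<epsilon> ^ CARD('n))"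
    using assms flat_le_fact[of 0] by (intro mult_left_mono divide_right_mono) auto
  ultimately have "kern k \<epsilon> x (s *\<^sub>R y) \<le> 1 / \<epsilon> ^ CARD('n) * majorant k x y"
    by (simp add: majorant_def kern_def)
  then show ?thesis using kern_nonneg[OF assms(1), of k x "s *\<^sub>R y"] by simp
qed

lemma kern_le_majorant1:
  fixes x y :: "real ^ 'n::finite"
  assumes "0 < \<epsilon>" "\<epsilon> \<le> 1/2" "0 < k"
  shows "\<bar>kern k \<epsilon> x y\<bar> \<le> 1 / \<epsilon> ^ CARD('n) * majorant k x y"
  using kern_le_majorant[OF assms, of 1 x y] by simp

lemma integrable_bump: "integrable lborel (\<lambda>z::real^'n::finite. flat 0 (1 - z \<bullet> z))"
proof (rule integrable_bounded_cball[where B=1 and R=1])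
  fix z :: "real ^ 'n"
  show "\<bar>flat 0 (1 - z \<bullet> z)\<bar> \<le> 1 * indicator (cball 0 1) z"
  proof (cases "norm z \<le> 1")
    case True
    then show ?thesis using flat_nonneg[of 0] flat_le_fact[of 0] by simp
  next
    case False
    then have "1 \<le> z \<bullet> z" using power_mono[of 1 "norm z" 2] by (simp add: dot_square_norm)
    then show ?thesis by (simp add: flat_eq_0)
  qed
qed measurable

lemma bump_mass_pos: "0 < bump_mass TYPE('n::finite)"
proof -
  have "bump_mass TYPE('n) \<noteq> 0"
  proof
    assume "bump_mass TYPE('n) = 0"
    then have "AE z::real^'n in lborel. flat 0 (1 - z \<bullet> z) = 0"
      using integrable_bump flat_nonneg unfolding bump_mass_def
      by (subst (asm) integral_nonneg_eq_0_iff_AE) auto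
    then have "AE z::real^'n in lborel. z \<notin> ball 0 1"
    proof eventually_elim
      case (elim z)
      then show ?case
        using power_strict_mono[of "norm z" 1 2] by (auto simp: flat_def dot_square_norm split: if_splits)
    qed
    then have "ball (0::real^'n) 1 \<in> null_sets lborel"
      by (subst AE_iff_null_sets) auto
    then show False using unit_ball_vol_pos[of "CARD('n)"] by (simp add: null_sets_def emeasure_ball)
  qed
  moreover have "0 \<le> bump_mass TYPE('n)"
    unfolding bump_mass_def by (intro Bochner_Integration.integral_nonneg flat_nonneg)
  ultimately show ?thesis by simp
qed

text \<open>Substituting \<open>y = x + \<epsilon> |x| z\<close> turns the kernel into a fixed bump, so the mass is exactly a constant times
  the weight. It is for this exactness that the kernel is normalised by \<open>|x|\<close> and is not symmetric.\<close>
lemma kern_integral_snd: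
  fixes x :: "real ^ 'n::finite"
  assumes "0 < \<epsilon>" "0 < k"
  shows "(LINT y|lborel. kern k \<epsilon> x y) = bump_mass TYPE('n) * norm x ^ (2 * k + CARD('n))"
proof (cases "x = 0")
  case True
  then show ?thesis using assms by (simp add: kern_def power_0_left)
next
  case False
  define c where "c = \<epsilon> * norm x"
  have c: "c \<noteq> 0" "0 < c" using False assms by (auto simp: c_def)
  have "kern k \<epsilon> x (x + c *\<^sub>R z) = (x \<bullet> x) ^ k / \<epsilon> ^ CARD('n) * flat 0 (1 - z \<bullet> z)" for z
  proof -
    have "sqratio x (x + c *\<^sub>R z) / \<epsilon>\<^sup>2 = z \<bullet> z"
      using False assms by (simp add: sqratio_def c_def dot_square_norm power2_eq_square field_simps)
    then show ?thesis by (simp add: kern_def)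
  qed
  then have "(LINT y|lborel. kern k \<epsilon> x y) = \<bar>c\<bar> ^ CARD('n) * ((x \<bullet> x) ^ k / \<epsilon> ^ CARD('n) * bump_mass TYPE('n))"
    by (subst integral_lborel_affine[OF _ c(1), of _ x]) (simp_all add: bump_mass_def)
  also have "\<dots> = bump_mass TYPE('n) * norm x ^ (2 * k + CARD('n))"
    using c assms by (simp add: c_def power_mult_distrib power_add power_mult[symmetric] dot_square_norm abs_mult)
  finally show ?thesis .
qed

text \<open>In the other variable a bound suffices, but it must not depend on \<open>\<epsilon>\<close>, which the cruder \<open>majorant\<close> could
  not give.\<close>
lemma kern_integral_fst_le:
  fixes y :: "real ^ 'n::finite"
  assumes e: "0 < \<epsilon>" "\<epsilon> \<le> 1/2" and k: "0 < k"
  shows "(LINT x|lborel. kern k \<epsilon> x y) \<le> unit_ball_vol CARD('n) * 2 ^ CARD('n) * 4 ^ k * norm y ^ (2 * k + CARD('n))"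
proof -
  let ?h = "\<lambda>x::real^'n. ((4 * (y \<bullet> y)) ^ k / \<epsilon> ^ CARD('n)) * indicator (cball y (2 * \<epsilon> * norm y)) x"
  have le: "kern k \<epsilon> x y \<le> ?h x" for x
  proof (cases "kern k \<epsilon> x y = 0")
    case True
    then show ?thesis using e by simp
  next
    case False
    note s = kern_support[OF e(1) k False]
    have e': "\<epsilon> * norm x \<le> norm x / 2" using mult_right_mono[OF e(2), of "norm x"] by simp
    have "norm x \<le> norm y + norm (y - x)"
      using norm_triangle_ineq4[of y "y - x"] by simp
    then have xy: "norm x \<le> 2 * norm y" using s e' by linarith
    have "norm (y - x) \<le> \<epsilon> * (2 * norm y)" using s(2) mult_left_mono[OF xy, of \<epsilon>] e by linarith
    then have m: "x \<in> cball y (2 * \<epsilon> * norm y)" by (simp add: dist_norm mult_ac)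
    have "x \<bullet> x \<le> 4 * (y \<bullet> y)" using power_mono[OF xy, of 2] by (simp add: dot_square_norm power_mult_distrib)
    then have "(x \<bullet> x) ^ k * (flat 0 (1 - sqratio x y / \<epsilon>\<^sup>2) / \<epsilon> ^ CARD('n)) \<le> (4 * (y \<bullet> y)) ^ k * (1 / \<epsilon> ^ CARD('n))"
      using e flat_le_fact[of 0] flat_nonneg[of 0]
      by (intro mult_mono power_mono divide_right_mono) auto
    then show ?thesis using m by (simp add: kern_def)
  qed
  have i: "integrable lborel ?h"
    using emeasure_bounded_finite[OF bounded_cball, of y "2 * \<epsilon> * norm y"]
    by (intro integrable_mult_right integrable_real_indicator) auto
  have "(LINT x|lborel. kern k \<epsilon> x y) \<le> (LINT x|lborel. ?h x)"
  proof (rule integral_mono[OF _ i le])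
    show "integrable lborel (\<lambda>x. kern k \<epsilon> x y)"
      by (rule Bochner_Integration.integrable_bound[OF i])
         (use le kern_nonneg[OF e(1), of k _ y] e in \<open>auto intro!: AE_I2 order.trans[OF _ abs_ge_self]\<close>)
  qed
  also have "\<dots> = ((4 * (y \<bullet> y)) ^ k / \<epsilon> ^ CARD('n)) * measure lborel (cball y (2 * \<epsilon> * norm y))"
    by simp
  also have "\<dots> = unit_ball_vol CARD('n) * 2 ^ CARD('n) * 4 ^ k * norm y ^ (2 * k + CARD('n))"
    using e by (subst content_cball)
      (auto simp: power_mult_distrib power_add power_mult[symmetric] dot_square_norm)
  finally show ?thesis .
qed

context
  fixes k :: nat and \<epsilon> :: real
  assumes k: "0 < k" and e: "0 < \<epsilon>" "\<epsilon> \<le> 1/2"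
begin

lemma integrable_kern_products:
  fixes v w :: "real ^ 'n::finite \<Rightarrow> real"
  assumes v: "weight_L2 k v" and w: "weight_L2 k w"
  shows "integrable (lborel \<Otimes>\<^sub>M lborel) (\<lambda>(x, y). v x * w y * kern k \<epsilon> x y)"
    and "integrable (lborel \<Otimes>\<^sub>M lborel) (\<lambda>(x, y). v x * w x * kern k \<epsilon> x y)"
    and "integrable (lborel \<Otimes>\<^sub>M lborel) (\<lambda>(x, y). (v y)\<^sup>2 * kern k \<epsilon> x y)"
  by (rule integrable_product_majorant[OF v w _ kern_le_majorant1[OF e k]]; measurable)+

lemma kern_diagonal:
  fixes v w :: "real ^ 'n::finite \<Rightarrow> real"
  assumes v: "weight_L2 k v" and w: "weight_L2 k w"
  shows "(LINT (x, y)|(lborel \<Otimes>\<^sub>M lborel). v x * w x * kern k \<epsilon> x y) =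
    bump_mass TYPE('n) * (LINT x|lborel. norm x ^ (2 * k + CARD('n)) * (v x * w x))"
proof -
  have "(LINT (x, y)|(lborel \<Otimes>\<^sub>M lborel). v x * w x * kern k \<epsilon> x y) =
      (LINT x|lborel. LINT y|lborel. v x * w x * kern k \<epsilon> x y)"
    using lborel_pair.integral_fst[OF integrable_kern_products(2)[OF v w]] by simp
  also have "\<dots> = (LINT x|lborel. bump_mass TYPE('n) * (norm x ^ (2 * k + CARD('n)) * (v x * w x)))"
    by (simp add: kern_integral_snd[OF e(1) k] mult_ac)
  finally show ?thesis by simp
qed

lemma kern_offdiagonal_sq_le:
  fixes v :: "real ^ 'n::finite \<Rightarrow> real"
  assumes v: "weight_L2 k v"
  shows "(LINT (x, y)|(lborel \<Otimes>\<^sub>M lborel). (v y)\<^sup>2 * kern k \<epsilon> x y) \<le>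
    unit_ball_vol CARD('n) * 2 ^ CARD('n) * 4 ^ k * weight_norm2 k v"
proof -
  have "(LINT (x, y)|(lborel \<Otimes>\<^sub>M lborel). (v y)\<^sup>2 * kern k \<epsilon> x y) =
      (LINT y|lborel. LINT x|lborel. (v y)\<^sup>2 * kern k \<epsilon> x y)"
    using lborel_pair.integral_snd[OF integrable_kern_products(3)[OF v v]] by simp
  also have "\<dots> \<le> (LINT y|lborel. unit_ball_vol CARD('n) * 2 ^ CARD('n) * 4 ^ k * (norm y ^ (2 * k + CARD('n)) * (v y)\<^sup>2))"
  proof (rule integral_mono)
    show "integrable lborel (\<lambda>y. LINT x|lborel. (v y)\<^sup>2 * kern k \<epsilon> x y)"
      by (rule lborel_pair.integrable_snd[OF integrable_kern_products(3)[OF v v]])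
    fix y
    have "(v y)\<^sup>2 * (LINT x|lborel. kern k \<epsilon> x y) \<le> (v y)\<^sup>2 *
       (unit_ball_vol CARD('n) * 2 ^ CARD('n) * 4 ^ k * norm y ^ (2 * k + CARD('n)))"
      by (intro mult_left_mono kern_integral_fst_le e k) auto
    then show "(LINT x|lborel. (v y)\<^sup>2 * kern k \<epsilon> x y) \<le>
      unit_ball_vol CARD('n) * 2 ^ CARD('n) * 4 ^ k * (norm y ^ (2 * k + CARD('n)) * (v y)\<^sup>2)"
      by (simp add: mult_ac)
  qed (use v in \<open>simp add: weight_L2_def\<close>)
  finally show ?thesis by (simp add: weight_norm2_def)
qed

end

definition dilate :: "real \<Rightarrow> (real ^ 'n::finite \<Rightarrow> real) \<Rightarrow> real ^ 'n \<Rightarrow> real" where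
  "dilate s v x = v (x /\<^sub>R s)"

lemma dilate_1 [simp]: "dilate 1 w = w"
  by (rule ext) (simp add: dilate_def)

lemma weight_L2_dilate:
  fixes w :: "real ^ 'n::finite \<Rightarrow> real"
  assumes w: "weight_L2 k w" and s: "0 < s"
  shows "weight_L2 k (dilate s w)"
proof -
  have [measurable]: "w \<in> borel_measurable borel" using w by (rule weight_L2_measurable)
  let ?F = "\<lambda>x. norm x ^ (2 * k + CARD('n)) * (w x)\<^sup>2"
  have "integrable lborel ?F" using w by (simp add: weight_L2_def)
  then have "integrable lborel (\<lambda>x. ?F (0 + (1 / s) *\<^sub>R x))"
    using s by (intro integrable_lborel_affine) auto
  moreover have "norm x ^ (2 * k + CARD('n)) * (w (x /\<^sub>R s))\<^sup>2 = s ^ (2 * k + CARD('n)) * ?F (0 + (1 / s) *\<^sub>R x)" for x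
    using s by (simp add: power_divide divide_inverse power_mult_distrib power_inverse)
  ultimately show ?thesis by (simp add: weight_L2_def dilate_def[abs_def])
qed

lemma weight_norm2_dilate:
  fixes w :: "real ^ 'n::finite \<Rightarrow> real"
  assumes w: "weight_L2 k w" and s: "0 < s"
  shows "weight_norm2 k (dilate s w) = s ^ (2 * k + 2 * CARD('n)) * weight_norm2 k w"
proof -
  have [measurable]: "w \<in> borel_measurable borel" using w by (rule weight_L2_measurable)
  have "weight_norm2 k (dilate s w) =
      s ^ CARD('n) * (LINT x|lborel. s ^ (2 * k + CARD('n)) * (norm x ^ (2 * k + CARD('n)) * (w x)\<^sup>2))"
    unfolding weight_norm2_def dilate_def using s
    by (subst integral_lborel_affine[where c=s and t=0]) (auto simp: power_mult_distrib mult.assoc)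
  also have "\<dots> = s ^ CARD('n) * (s ^ (2 * k + CARD('n)) * weight_norm2 k w)"
    by (simp only: integral_mult_right_zero weight_norm2_def)
  finally show ?thesis by (simp add: power_add mult_2 mult_2_right mult_ac)
qed

text \<open>Measures how far \<open>w\<close> is from being constant at scale \<open>\<epsilon>\<close>. It bounds the error of replacing the kernel by a
  delta function on the diagonal, and it scales exactly under dilations, which makes the bound
  uniform in \<open>s\<close>.\<close>
definition energy :: "nat \<Rightarrow> real \<Rightarrow> (real ^ 'n::finite \<Rightarrow> real) \<Rightarrow> real" where
  "energy k \<epsilon> w = (LINT (x, y)|(lborel \<Otimes>\<^sub>M lborel). (w y - w x)\<^sup>2 * kern k \<epsilon> x y)"

lemma energy_nonneg: "0 < \<epsilon> \<Longrightarrow> 0 \<le> energy k \<epsilon> w"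
  unfolding energy_def by (intro Bochner_Integration.integral_nonneg) (auto simp: kern_nonneg)

context
  fixes k :: nat and \<epsilon> :: real
  assumes k: "0 < k" and e: "0 < \<epsilon>" "\<epsilon> \<le> 1/2"
begin

lemma integrable_energy:
  fixes w :: "real ^ 'n::finite \<Rightarrow> real"
  assumes w: "weight_L2 k w"
  shows "integrable (lborel \<Otimes>\<^sub>M lborel) (\<lambda>(x, y). (w y - w x)\<^sup>2 * kern k \<epsilon> x y)"
proof -
  note I = integrable_kern_products[OF k e w w]
  have "integrable (lborel \<Otimes>\<^sub>M lborel) (\<lambda>(x, y). (w y)\<^sup>2 * kern k \<epsilon> x y
     + w x * w x * kern k \<epsilon> x y - 2 * (w x * w y * kern k \<epsilon> x y))"
    using Bochner_Integration.integrable_diff[OF Bochner_Integration.integrable_add[OF I(3) I(2)]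
        integrable_mult_right[where c=2, OF I(1)]]
    by (simp add: split_beta')
  then show ?thesis by (simp add: power2_diff algebra_simps power2_eq_square)
qed

text \<open>Reduces \<open>energy\<close> to a dense class: the constant in front of the distance does not depend on \<open>\<epsilon>\<close>.\<close>
lemma energy_perturb:
  fixes w \<phi> :: "real ^ 'n::finite \<Rightarrow> real"
  assumes w: "weight_L2 k w" and \<phi>: "weight_L2 k \<phi>"
  shows "energy k \<epsilon> w \<le> 3 * energy k \<epsilon> \<phi> + 3 * (bump_mass TYPE('n)
    + unit_ball_vol CARD('n) * 2 ^ CARD('n) * 4 ^ k) * weight_norm2 k (\<lambda>x. w x - \<phi> x)"
proof -
  define d where "d x = w x - \<phi> x" for x
  have d: "weight_L2 k d" unfolding d_def using weight_L2_diff[OF w \<phi>] .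
  note I = integrable_energy[OF \<phi>] integrable_kern_products(3)[OF k e d d] integrable_kern_products(2)[OF k e d d]
  have "energy k \<epsilon> w \<le> (LINT p|(lborel \<Otimes>\<^sub>M lborel).
     3 * (case p of (x, y) \<Rightarrow> (\<phi> y - \<phi> x)\<^sup>2 * kern k \<epsilon> x y) +
     (3 * (case p of (x, y) \<Rightarrow> (d y)\<^sup>2 * kern k \<epsilon> x y)
       + 3 * (case p of (x, y) \<Rightarrow> d x * d x * kern k \<epsilon> x y)))"
    unfolding energy_def
  proof (rule integral_mono)
    fix p :: "(real^'n) \<times> (real^'n)"
    obtain x y where p: "p = (x, y)" by (cases p)
    have sq: "(a + b + c)\<^sup>2 \<le> 3 * a\<^sup>2 + 3 * b\<^sup>2 + 3 * (c * c)" for a b c :: real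
      using sum_squares_bound[of a b] sum_squares_bound[of a c] sum_squares_bound[of b c]
      by (simp add: power2_eq_square algebra_simps)
    have "(w y - w x)\<^sup>2 \<le> 3 * (\<phi> y - \<phi> x)\<^sup>2 + 3 * (d y)\<^sup>2 + 3 * (d x * d x)"
      using sq[of "\<phi> y - \<phi> x" "d y" "- d x"] by (simp add: d_def algebra_simps)
    from mult_right_mono[OF this kern_nonneg[OF e(1)]]
    show "(case p of (x, y) \<Rightarrow> (w y - w x)\<^sup>2 * kern k \<epsilon> x y) \<le>
     3 * (case p of (x, y) \<Rightarrow> (\<phi> y - \<phi> x)\<^sup>2 * kern k \<epsilon> x y) +
     (3 * (case p of (x, y) \<Rightarrow> (d y)\<^sup>2 * kern k \<epsilon> x y)
       + 3 * (case p of (x, y) \<Rightarrow> d x * d x * kern k \<epsilon> x y))"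
      by (simp add: p algebra_simps)
  qed (use I integrable_energy[OF w] in auto)
  also have "\<dots> = 3 * energy k \<epsilon> \<phi> + (3 * (LINT (x, y)|(lborel \<Otimes>\<^sub>M lborel). (d y)\<^sup>2 * kern k \<epsilon> x y)
      + 3 * (LINT (x, y)|(lborel \<Otimes>\<^sub>M lborel). d x * d x * kern k \<epsilon> x y))"
    using I unfolding energy_def by simp
  also have "\<dots> \<le> 3 * energy k \<epsilon> \<phi> + (3 * (unit_ball_vol CARD('n) * 2 ^ CARD('n) * 4 ^ k * weight_norm2 k d)
      + 3 * (bump_mass TYPE('n) * weight_norm2 k d))"
    using kern_offdiagonal_sq_le[OF k e d] unfolding kern_diagonal[OF k e d d]
    by (intro add_left_mono add_mono) (auto simp: weight_norm2_def power2_eq_square)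
  also have "d = (\<lambda>x. w x - \<phi> x)" by (rule ext) (simp add: d_def)
  finally show ?thesis by (simp add: algebra_simps)
qed

text \<open>On the diagonal the kernel has mass \<open>bump_mass\<close> times the weight, so the left side is the integral of
  \<open>v(x) (w(y) - w(x)) N(x, y)\<close>. The weighted inequality of arithmetic and geometric means, with free
  parameter \<open>t\<close>, stands in for Cauchy-Schwarz.\<close>
lemma kern_approximates_diagonal:
  fixes v w :: "real ^ 'n::finite \<Rightarrow> real"
  assumes v: "weight_L2 k v" and w: "weight_L2 k w" and t: "0 < t"
  shows "\<bar>(LINT (x, y)|(lborel \<Otimes>\<^sub>M lborel). v x * w y * kern k \<epsilon> x y)
      - bump_mass TYPE('n) * (LINT x|lborel. norm x ^ (2 * k + CARD('n)) * (v x * w x))\<bar>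
    \<le> t * bump_mass TYPE('n) * weight_norm2 k v + energy k \<epsilon> w / t"
proof -
  note I = integrable_kern_products(1)[OF k e v w] integrable_kern_products(2)[OF k e v w]
  note J = integrable_kern_products(2)[OF k e v v] integrable_energy[OF w]
  have "(LINT (x, y)|(lborel \<Otimes>\<^sub>M lborel). v x * w y * kern k \<epsilon> x y)
      - bump_mass TYPE('n) * (LINT x|lborel. norm x ^ (2 * k + CARD('n)) * (v x * w x))
    = (LINT p|(lborel \<Otimes>\<^sub>M lborel). (case p of (x, y) \<Rightarrow> v x * w y * kern k \<epsilon> x y)
        - (case p of (x, y) \<Rightarrow> v x * w x * kern k \<epsilon> x y))"
    unfolding kern_diagonal[OF k e v w, symmetric]
    by (rule Bochner_Integration.integral_diff[OF I, symmetric])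
  also have "\<bar>\<dots>\<bar> \<le> (LINT p|(lborel \<Otimes>\<^sub>M lborel). t * (case p of (x, y) \<Rightarrow> v x * v x * kern k \<epsilon> x y)
        + (1 / t) * (case p of (x, y) \<Rightarrow> (w y - w x)\<^sup>2 * kern k \<epsilon> x y))"
    unfolding real_norm_def[symmetric]
  proof (rule order.trans[OF integral_norm_bound integral_mono])
    show "integrable (lborel \<Otimes>\<^sub>M lborel) (\<lambda>p. norm ((case p of (x, y) \<Rightarrow> v x * w y * kern k \<epsilon> x y)
        - (case p of (x, y) \<Rightarrow> v x * w x * kern k \<epsilon> x y)))"
      using I by (intro integrable_norm Bochner_Integration.integrable_diff)
    show "integrable (lborel \<Otimes>\<^sub>M lborel) (\<lambda>p. t * (case p of (x, y) \<Rightarrow> v x * v x * kern k \<epsilon> x y)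
        + (1 / t) * (case p of (x, y) \<Rightarrow> (w y - w x)\<^sup>2 * kern k \<epsilon> x y))"
      using J by (intro integrable_mult_right Bochner_Integration.integrable_add)
    fix p :: "(real^'n) \<times> (real^'n)"
    obtain x y where p: "p = (x, y)" by (cases p)
    have am: "\<bar>a * b\<bar> \<le> t * (a * a) + (1 / t) * b\<^sup>2" for a b
    proof -
      have st: "sqrt t * sqrt t = t" "sqrt t \<noteq> 0" using t by auto
      have "\<bar>(sqrt t * a) * (b / sqrt t)\<bar> \<le> (sqrt t * a)\<^sup>2 + (b / sqrt t)\<^sup>2" by (rule abs_mult_le_squares)
      also have "(sqrt t * a)\<^sup>2 + (b / sqrt t)\<^sup>2 = t * (a * a) + (1 / t) * b\<^sup>2"
        using t by (simp add: power_mult_distrib power_divide power2_eq_square[of a])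
      finally show ?thesis using st(2) by simp
    qed
    show "norm ((case p of (x, y) \<Rightarrow> v x * w y * kern k \<epsilon> x y)
        - (case p of (x, y) \<Rightarrow> v x * w x * kern k \<epsilon> x y)) \<le> t * (case p of (x, y) \<Rightarrow> v x * v x * kern k \<epsilon> x y)
        + (1 / t) * (case p of (x, y) \<Rightarrow> (w y - w x)\<^sup>2 * kern k \<epsilon> x y)"
    proof -
      have "v x * w y * kern k \<epsilon> x y - v x * w x * kern k \<epsilon> x y = v x * (w y - w x) * kern k \<epsilon> x y"
        by (simp add: algebra_simps)
      then have "\<bar>v x * w y * kern k \<epsilon> x y - v x * w x * kern k \<epsilon> x y\<bar>
          = \<bar>v x * (w y - w x)\<bar> * kern k \<epsilon> x y"
        using kern_nonneg[OF e(1), of k x y] by (simp add: abs_mult)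
      then show ?thesis
        using mult_right_mono[OF am[of "v x" "w y - w x"] kern_nonneg[OF e(1), of k x y]]
        by (simp add: p algebra_simps)
    qed
  qed
  also have "\<dots> = t * bump_mass TYPE('n) * weight_norm2 k v + energy k \<epsilon> w / t"
    using J kern_diagonal[OF k e v v] by (simp add: weight_norm2_def energy_def power2_eq_square)
  finally show ?thesis .
qed

lemma energy_dilate:
  fixes w :: "real ^ 'n::finite \<Rightarrow> real"
  assumes w: "weight_L2 k w" and s: "0 < s"
  shows "energy k \<epsilon> (dilate s w) = s ^ (2 * k + 2 * CARD('n)) * energy k \<epsilon> w"
proof -
  have w': "weight_L2 k (\<lambda>x. w (x /\<^sub>R s))"
    using weight_L2_dilate[OF w s] by (simp add: dilate_def[abs_def])
  have [measurable]: "w \<in> borel_measurable borel" using w by (rule weight_L2_measurable)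
  have "energy k \<epsilon> (\<lambda>x. w (x /\<^sub>R s)) = (LINT x|lborel. LINT y|lborel. (w (y /\<^sub>R s) - w (x /\<^sub>R s))\<^sup>2 * kern k \<epsilon> x y)"
    unfolding energy_def using lborel_pair.integral_fst[OF integrable_energy[OF w']] by simp
  also have "\<dots> = (LINT x|lborel. s ^ CARD('n) * (LINT y|lborel. (w y - w (x /\<^sub>R s))\<^sup>2 * kern k \<epsilon> x (s *\<^sub>R y)))"
    using s by (subst integral_lborel_affine[where c=s and t=0]) auto
  also have "\<dots> = s ^ CARD('n) * (LINT x|lborel. s ^ CARD('n) *
      (LINT y|lborel. (w y - w x)\<^sup>2 * kern k \<epsilon> (s *\<^sub>R x) (s *\<^sub>R y)))"
    using s by (subst integral_lborel_affine[where c=s and t=0]) auto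
  also have "\<dots> = s ^ CARD('n) * (LINT x|lborel. s ^ CARD('n) *
      (LINT y|lborel. s ^ (2 * k) * ((w y - w x)\<^sup>2 * kern k \<epsilon> x y)))"
  proof -
    have "kern k \<epsilon> (s *\<^sub>R x) (s *\<^sub>R y) = s ^ (2 * k) * kern k \<epsilon> x y" for x y :: "real ^ 'n"
    proof -
      have "sqratio (s *\<^sub>R x) (s *\<^sub>R y) = sqratio x y"
        using s by (simp add: sqratio_def scaleR_diff_right[symmetric])
      then show ?thesis by (simp add: kern_def power_mult power2_eq_square power_mult_distrib mult_ac)
    qed
    then show ?thesis by (simp add: mult_ac)
  qed
  also have "\<dots> = s ^ (2 * k + 2 * CARD('n)) * energy k \<epsilon> w"
    unfolding energy_def using lborel_pair.integral_fst[OF integrable_energy[OF w]]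
    by (simp add: power_add mult_2)
  finally show ?thesis by (simp add: dilate_def[abs_def])
qed

end

text \<open>Uniform continuity on a ball large enough to contain all pairs \<open>(x, y)\<close> in the support of the kernel
  for which \<open>\<phi> x\<close> and \<open>\<phi> y\<close> differ.\<close>
lemma energy_continuous_small:
  fixes \<phi> :: "real ^ 'n::finite \<Rightarrow> real"
  assumes c: "continuous_on UNIV \<phi>" and supp: "\<And>x. R < norm x \<Longrightarrow> \<phi> x = 0"
    and k: "0 < k" and d: "0 < d"
  shows "\<exists>\<epsilon>0>0. \<forall>\<epsilon>. 0 < \<epsilon> \<and> \<epsilon> < \<epsilon>0 \<and> \<epsilon> \<le> 1/2 \<longrightarrow> energy k \<epsilon> \<phi> < d"
proof -
  have [measurable]: "\<phi> \<in> borel_measurable borel" using c by (rule borel_measurable_continuous_onI)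
  define r where "r = \<bar>R\<bar> + 1"
  have r: "0 < r" "R < r" by (auto simp: r_def)
  define cb where "cb x = indicat_real (cball (0::real^'n) (2 * r)) x" for x
  have cb: "weight_L2 k cb"
    by (rule weight_L2_bounded[where B=1 and R="2*r"])
       (auto simp: cb_def[abs_def] intro!: borel_measurable_indicator split: split_indicator)
  define A where "A = bump_mass TYPE('n) * (LINT x|lborel. norm x ^ (2 * k + CARD('n)) * (cb x * cb x))"
  have A: "0 \<le> A"
    unfolding A_def using bump_mass_pos[where 'n='n]
    by (intro mult_nonneg_nonneg Bochner_Integration.integral_nonneg) (auto simp: cb_def)
  obtain \<eta> where \<eta>: "0 < \<eta>" "\<eta>\<^sup>2 * A < d"
  proof -
    have "0 < d / (A + 1)" using A d by simp
    moreover have "(sqrt (d / (A + 1)))\<^sup>2 * A < d"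
    proof -
      have "(sqrt (d / (A + 1)))\<^sup>2 * A = d * (A / (A + 1))" using A d by simp
      also have "\<dots> < d * 1" using A d by (intro mult_strict_left_mono) auto
      finally show ?thesis by simp
    qed
    ultimately show ?thesis using that[of "sqrt (d / (A + 1))"] by simp
  qed
  have "uniformly_continuous_on (cball 0 (3 * r)) \<phi>"
    by (intro compact_uniformly_continuous continuous_on_subset[OF c]) auto
  then obtain \<delta> where \<delta>: "0 < \<delta>" "\<And>x y. x \<in> cball 0 (3 * r) \<Longrightarrow> y \<in> cball 0 (3 * r) \<Longrightarrow> dist y x < \<delta> \<Longrightarrow> dist (\<phi> y) (\<phi> x) < \<eta>"
    unfolding uniformly_continuous_on_def using \<eta>(1) by meson
  show ?thesis
  proof (intro exI[of _ "\<delta> / (2 * r)"] conjI allI impI)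
    show "0 < \<delta> / (2 * r)" using \<delta> r by simp
    fix \<epsilon> assume "0 < \<epsilon> \<and> \<epsilon> < \<delta> / (2 * r) \<and> \<epsilon> \<le> 1/2"
    then have e: "0 < \<epsilon>" "\<epsilon> \<le> 1/2" and ed: "\<epsilon> * (2 * r) < \<delta>" using r by (auto simp: field_simps)
    have pt: "(\<phi> y - \<phi> x)\<^sup>2 * kern k \<epsilon> x y \<le> \<eta>\<^sup>2 * (cb x * cb x * kern k \<epsilon> x y)" for x y
    proof (cases "kern k \<epsilon> x y = 0 \<or> \<phi> y = \<phi> x")
      case True
      then show ?thesis using kern_nonneg[OF e(1), of k x y] by (auto simp: cb_def)
    next
      case False
      then have nz: "kern k \<epsilon> x y \<noteq> 0" by simp
      note s = kern_support[OF e(1) k nz]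
      have e': "\<epsilon> * norm x \<le> norm x / 2" using mult_right_mono[OF e(2), of "norm x"] by simp
      have t1: "norm x \<le> norm y + norm (y - x)" using norm_triangle_ineq4[of y "y - x"] by simp
      have t2: "norm y \<le> norm x + norm (y - x)" using norm_triangle_sub[of y x] by simp
      have "norm x \<le> R \<or> norm y \<le> R" using False supp[of x] supp[of y] by linarith
      then have x2: "norm x \<le> 2 * r"
      proof
        assume "norm y \<le> R"
        then show ?thesis using t1 e' s(2) r by linarith
      qed (use r in linarith)
      have y3: "norm y \<le> 3 * r" using t2 e' s x2 by linarith
      have "\<epsilon> * norm x \<le> \<epsilon> * (2 * r)" using x2 e by (intro mult_left_mono) auto
      then have "dist y x < \<delta>" using s(2) ed by (simp add: dist_norm)
      then have "\<bar>\<phi> y - \<phi> x\<bar> < \<eta>" using \<delta>(2)[of x y] x2 y3 r by (simp add: dist_real_def)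
      then have "(\<phi> y - \<phi> x)\<^sup>2 \<le> \<eta>\<^sup>2" using power_mono[of "\<bar>\<phi> y - \<phi> x\<bar>" \<eta> 2] by simp
      then show ?thesis using x2 kern_nonneg[OF e(1), of k x y] by (simp add: cb_def mult_right_mono)
    qed
    note I = integrable_kern_products(2)[OF k e cb cb]
    have "energy k \<epsilon> \<phi> \<le> (LINT p|(lborel \<Otimes>\<^sub>M lborel). \<eta>\<^sup>2 * (case p of (x, y) \<Rightarrow> cb x * cb x * kern k \<epsilon> x y))"
      unfolding energy_def
    proof (rule integral_mono)
      show "integrable (lborel \<Otimes>\<^sub>M lborel) (\<lambda>(x, y). (\<phi> y - \<phi> x)\<^sup>2 * kern k \<epsilon> x y)"
        by (rule Bochner_Integration.integrable_bound[OF integrable_mult_right[where c="\<eta>\<^sup>2", OF I]])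
           (use pt kern_nonneg[OF e(1), of k "_ :: real ^ 'n"] in
             \<open>auto simp: split_beta' abs_mult intro!: AE_I2\<close>)
    qed (use pt I in auto)
    also have "\<dots> = \<eta>\<^sup>2 * A"
      using kern_diagonal[OF k e cb cb] by (simp add: A_def)
    finally show "energy k \<epsilon> \<phi> < d" using \<eta>(2) by simp
  qed
qed

lemma energy_small:
  fixes w :: "real ^ 'n::finite \<Rightarrow> real"
  assumes w: "weight_L2 k w" and k: "0 < k" and d: "0 < d"
  shows "\<exists>\<epsilon>0>0. \<forall>\<epsilon>. 0 < \<epsilon> \<and> \<epsilon> < \<epsilon>0 \<and> \<epsilon> \<le> 1/2 \<longrightarrow> energy k \<epsilon> w < d"
proof -
  define B where "B = 3 * (bump_mass TYPE('n) + unit_ball_vol CARD('n) * 2 ^ CARD('n) * 4 ^ k)"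
  have B: "0 < B"
    unfolding B_def using bump_mass_pos[where 'n='n] unit_ball_vol_nonneg[of "CARD('n)"]
    by (intro mult_pos_pos add_pos_nonneg) auto
  obtain \<phi> R b where \<phi>: "continuous_on UNIV \<phi>" "\<And>x. R < norm x \<Longrightarrow> \<phi> x = 0" "\<And>x. \<bar>\<phi> x\<bar> \<le> b"
    "weight_norm2 k (\<lambda>x. w x - \<phi> x) < d / (2 * B)"
    using weight_L2_approx_continuous[OF w, of "d / (2 * B)"] d B by auto
  have \<phi>2: "weight_L2 k \<phi>"
    using \<phi> by (intro weight_L2_bounded[where B=b and R=R] borel_measurable_continuous_onI) auto
  obtain \<epsilon>0 where e0: "0 < \<epsilon>0" "\<And>\<epsilon>. 0 < \<epsilon> \<and> \<epsilon> < \<epsilon>0 \<and> \<epsilon> \<le> 1/2 \<Longrightarrow> energy k \<epsilon> \<phi> < d / 6"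
    using energy_continuous_small[OF \<phi>(1,2) k, where d="d / 6"] d by auto
  show ?thesis
  proof (intro exI[of _ \<epsilon>0] conjI allI impI e0(1))
    fix \<epsilon> assume e: "0 < \<epsilon> \<and> \<epsilon> < \<epsilon>0 \<and> \<epsilon> \<le> 1/2"
    have "energy k \<epsilon> w \<le> 3 * energy k \<epsilon> \<phi> + B * weight_norm2 k (\<lambda>x. w x - \<phi> x)"
      unfolding B_def using energy_perturb[OF k _ _ w \<phi>2] e by simp
    also have "\<dots> < 3 * (d / 6) + B * (d / (2 * B))"
      using e0(2)[OF e] \<phi>(4) B by (intro add_strict_mono mult_strict_left_mono) auto
    also have "\<dots> = d" using B by simp
    finally show "energy k \<epsilon> w < d" .
  qed
qed

section \<open>Dilating the kernel\<close>

text \<open>The derivative of \<open>kern k \<epsilon> x (s y) / s\<^bsup>k\<^esup>\<close> with respect to \<open>s\<close>, in closed form; see \<open>kern_scale_derivative\<close>.\<close>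
definition kern_ds :: "nat \<Rightarrow> real \<Rightarrow> real \<Rightarrow> real ^ 'n::finite \<Rightarrow> real ^ 'n \<Rightarrow> real" where
  "kern_ds k \<epsilon> s x y = (let q = sqratio x (s *\<^sub>R y); \<beta> = ((s *\<^sub>R y) \<bullet> (s *\<^sub>R y)) / (x \<bullet> x) in
     - ((x \<bullet> x) ^ k * (real k * (flat 0 (1 - q / \<epsilon>\<^sup>2) / \<epsilon> ^ CARD('n))
        + (1 - q - \<beta>) * (- flat 2 (1 - q / \<epsilon>\<^sup>2) / \<epsilon> ^ CARD('n) / \<epsilon>\<^sup>2)) / s ^ (k + 1)))"

text \<open>The Laplacian in \<open>x\<close> of \<open>|x|\<^sup>2 kern k \<epsilon> x (s y)\<close>, in closed form; see \<open>kern_lap_centre\<close>.\<close>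
definition kern_lap :: "nat \<Rightarrow> real \<Rightarrow> real \<Rightarrow> real ^ 'n::finite \<Rightarrow> real ^ 'n \<Rightarrow> real" where
  "kern_lap k \<epsilon> s x y = (let q = sqratio x (s *\<^sub>R y); \<beta> = ((s *\<^sub>R y) \<bullet> (s *\<^sub>R y)) / (x \<bullet> x) in
     (x \<bullet> x) ^ k * ((real k + 1) * (2 * CARD('n) + 4 * real k) * (flat 0 (1 - q / \<epsilon>\<^sup>2) / \<epsilon> ^ CARD('n))
      + (4 * real k * (1 - q - \<beta>) + 2 * CARD('n) * (1 - q)) * (- flat 2 (1 - q / \<epsilon>\<^sup>2) / \<epsilon> ^ CARD('n) / \<epsilon>\<^sup>2)
      + 4 * q * \<beta> * ((flat 4 (1 - q / \<epsilon>\<^sup>2) - 2 * flat 3 (1 - q / \<epsilon>\<^sup>2)) / \<epsilon> ^ CARD('n) / \<epsilon>\<^sup>2 / \<epsilon>\<^sup>2)))"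

lemma profile_derivatives:
  fixes \<epsilon> c :: real
  assumes "\<epsilon> \<noteq> 0"
  shows "((\<lambda>q. flat 0 (1 - q / \<epsilon>\<^sup>2) / c) has_real_derivative (- flat 2 (1 - t / \<epsilon>\<^sup>2) / c / \<epsilon>\<^sup>2)) (at t)"
    and "((\<lambda>q. - flat 2 (1 - q / \<epsilon>\<^sup>2) / c / \<epsilon>\<^sup>2) has_real_derivative
      ((flat 4 (1 - t / \<epsilon>\<^sup>2) - 2 * flat 3 (1 - t / \<epsilon>\<^sup>2)) / c / \<epsilon>\<^sup>2 / \<epsilon>\<^sup>2)) (at t)"
proof -
  have lin: "((\<lambda>q. 1 - q / \<epsilon>\<^sup>2) has_real_derivative - (1 / \<epsilon>\<^sup>2)) (at t)"
    using DERIV_diff[OF DERIV_const DERIV_cdivide[OF DERIV_ident], of 1 "\<epsilon>\<^sup>2" t] by simp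
  have "((\<lambda>q. flat j (1 - q / \<epsilon>\<^sup>2)) has_real_derivative
      (flat (j + 2) (1 - t / \<epsilon>\<^sup>2) - real j * flat (j + 1) (1 - t / \<epsilon>\<^sup>2)) * - (1 / \<epsilon>\<^sup>2)) (at t)" for j
    by (rule has_real_derivative_flat'[OF lin])
  note D = this
  show "((\<lambda>q. flat 0 (1 - q / \<epsilon>\<^sup>2) / c) has_real_derivative (- flat 2 (1 - t / \<epsilon>\<^sup>2) / c / \<epsilon>\<^sup>2)) (at t)"
    by (rule DERIV_cong[OF DERIV_cdivide[OF D[of 0], of c]]) (simp add: field_simps numeral_eq_Suc)
  show "((\<lambda>q. - flat 2 (1 - q / \<epsilon>\<^sup>2) / c / \<epsilon>\<^sup>2) has_real_derivative
      ((flat 4 (1 - t / \<epsilon>\<^sup>2) - 2 * flat 3 (1 - t / \<epsilon>\<^sup>2)) / c / \<epsilon>\<^sup>2 / \<epsilon>\<^sup>2)) (at t)"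
  proof (rule DERIV_cong)
    show "((\<lambda>q. - flat 2 (1 - q / \<epsilon>\<^sup>2) / c / \<epsilon>\<^sup>2) has_real_derivative
      - ((flat 4 (1 - t / \<epsilon>\<^sup>2) - 2 * flat 3 (1 - t / \<epsilon>\<^sup>2)) * - (1 / \<epsilon>\<^sup>2)) / c / \<epsilon>\<^sup>2) (at t)"
      using DERIV_cdivide[OF DERIV_cdivide[OF DERIV_minus[OF D[of 2]], of c], of "\<epsilon>\<^sup>2"] by simp
  qed simp
qed

text \<open>Since \<open>sqratio\<close> is invariant under joint dilations, \<open>s\<close> times its derivative in \<open>s\<close> is minus its radial
  derivative in \<open>x\<close>, and the latter is \<open>1 - q - \<beta>\<close>.\<close>
lemma kern_scale_derivative:
  fixes x y :: "real ^ 'n::finite"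
  assumes e: "0 < \<epsilon>" and k: "0 < k" and s: "0 < s"
  shows "((\<lambda>s. kern k \<epsilon> x (s *\<^sub>R y) / s ^ k) has_real_derivative kern_ds k \<epsilon> s x y) (at s)"
proof (cases "x = 0")
  case True
  then have "kern_ds k \<epsilon> s x y = 0" "kern k \<epsilon> x (s *\<^sub>R y) / s ^ k = 0" for s
    using k by (simp_all add: kern_def kern_ds_def Let_def)
  then show ?thesis by (simp only: DERIV_const)
next
  case False
  define g where "g q = flat 0 (1 - q / \<epsilon>\<^sup>2) / \<epsilon> ^ CARD('n)" for q
  define g1 where "g1 q = - flat 2 (1 - q / \<epsilon>\<^sup>2) / \<epsilon> ^ CARD('n) / \<epsilon>\<^sup>2" for q
  let ?q = "sqratio x (s *\<^sub>R y)" and ?b = "((s *\<^sub>R y) \<bullet> (s *\<^sub>R y)) / (x \<bullet> x)"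
  have Dn: "((\<lambda>s. (s *\<^sub>R y - x) \<bullet> (s *\<^sub>R y - x)) has_real_derivative 2 * (s * (y \<bullet> y) - x \<bullet> y)) (at s)"
    by (auto simp: inner_diff_left inner_diff_right inner_commute algebra_simps intro!: derivative_eq_intros)
  have Dq: "((\<lambda>s. sqratio x (s *\<^sub>R y)) has_real_derivative - (1 - ?q - ?b) / s) (at s)"
  proof (rule DERIV_cong)
    show "((\<lambda>s. sqratio x (s *\<^sub>R y)) has_real_derivative 2 * (s * (y \<bullet> y) - x \<bullet> y) / (x \<bullet> x)) (at s)"
      using DERIV_cdivide[OF Dn, of "x \<bullet> x"] by (simp add: sqratio_def)
    have "s * (x \<bullet> y) = (x \<bullet> x + (s *\<^sub>R y) \<bullet> (s *\<^sub>R y) - ?q * (x \<bullet> x)) / 2"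
      using inner_via_sqratio[OF False, of "s *\<^sub>R y"] by simp
    then have E: "2 * (s * (y \<bullet> y) - x \<bullet> y) = - (x \<bullet> x - ?q * (x \<bullet> x) - s * s * (y \<bullet> y)) / s"
      using s by (simp add: field_simps)
    show "2 * (s * (y \<bullet> y) - x \<bullet> y) / (x \<bullet> x) = - (1 - ?q - ?b) / s"
      unfolding E using False s by (simp add: field_simps)
  qed
  have Dg: "((\<lambda>s. g (sqratio x (s *\<^sub>R y))) has_real_derivative g1 ?q * (- (1 - ?q - ?b) / s)) (at s)"
  proof (rule DERIV_chain2[OF _ Dq])
    show "(g has_real_derivative g1 ?q) (at ?q)"
      unfolding g_def g1_def using e by (intro profile_derivatives(1)) simp
  qed
  have Ds: "((\<lambda>s. s ^ k) has_real_derivative real k * s ^ (k - 1)) (at s)"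
    by (auto intro!: derivative_eq_intros)
  have sk: "s ^ k \<noteq> 0" using s by simp
  have kk: "s ^ k = s * s ^ (k - 1)" using k by (simp add: power_eq_if)
  have *: "(g1 ?q * (- (1 - ?q - ?b) / s) * s ^ k - g ?q * (real k * s ^ (k - 1))) / (s ^ k * s ^ k)
      = - ((real k * g ?q + (1 - ?q - ?b) * g1 ?q) / s ^ (k + 1))"
    using s unfolding power_add kk by (simp add: field_simps)
  from DERIV_cmult[OF DERIV_divide[OF Dg Ds sk], of "(x \<bullet> x) ^ k"]
  show ?thesis unfolding *
    by (simp add: kern_def kern_ds_def Let_def g_def g1_def)
qed

lemma kern_zero_far:
  fixes x z :: "real ^ 'n::finite"
  assumes e: "0 < \<epsilon>" "\<epsilon> \<le> 1/2" and k: "0 < k" and far: "2 * norm x < norm z \<or> 2 * norm z < norm x"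
  shows "kern k \<epsilon> x z = 0"
proof (rule ccontr)
  assume "kern k \<epsilon> x z \<noteq> 0"
  note s = kern_support(2)[OF e(1) k this]
  have "\<epsilon> * norm x \<le> norm x / 2" using mult_right_mono[OF e(2), of "norm x"] by simp
  moreover have "norm x \<le> norm z + norm (z - x)" using norm_triangle_ineq4[of z "z - x"] by simp
  moreover have "norm z \<le> norm x + norm (z - x)" using norm_triangle_sub[of z x] by simp
  ultimately show False using s far norm_ge_zero[of x] by linarith
qed

lemma kern_lap_centre:
  fixes x y :: "real ^ 'n::finite"
  assumes e: "0 < \<epsilon>" "\<epsilon> \<le> 1/2" and k: "0 < k" and y: "s *\<^sub>R y \<noteq> 0"
  shows "laplacian (\<lambda>x. (x \<bullet> x) * kern k \<epsilon> x (s *\<^sub>R y)) x = kern_lap k \<epsilon> s x y"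
proof (cases "x = 0")
  case True
  have "laplacian (\<lambda>x. (x \<bullet> x) * kern k \<epsilon> x (s *\<^sub>R y)) x = 0"
  proof (rule laplacian_eq_0[where r="norm (s *\<^sub>R y) / 2"])
    show "x \<bullet> x * kern k \<epsilon> x (s *\<^sub>R y) = 0" if "norm x < norm (s *\<^sub>R y) / 2" for x
      using that kern_zero_far[OF e k, of x "s *\<^sub>R y"] by auto
  qed (use True y in auto)
  then show ?thesis using k True by (simp add: kern_lap_def Let_def)
next
  case False
  then show ?thesis
    using laplacian_kernel_centre[OF False k profile_derivatives[of \<epsilon> "\<epsilon> ^ CARD('n)"], of "s *\<^sub>R y"] e
    unfolding kern_def kern_lap_def Let_def by simp
qed

text \<open>On a rotation-invariant kernel the Laplacians in \<open>x\<close> and \<open>y\<close>, taken after multiplication by \<open>|x|\<^sup>2\<close> and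
  \<open>|y|\<^sup>2\<close>, have the same spherical part, and they differ by
  \<open>D\<^sub>x\<^sup>2 - D\<^sub>y\<^sup>2 + (n+2)(D\<^sub>x - D\<^sub>y) = (D\<^sub>x + D\<^sub>y + n + 2)(D\<^sub>x - D\<^sub>y)\<close> applied to the kernel, where \<open>D\<^sub>x\<close>, \<open>D\<^sub>y\<close>
  are the radial derivatives. By homogeneity \<open>D\<^sub>x + D\<^sub>y\<close> is multiplication by \<open>2k\<close>, so only a first-order
  term is left, and it is a derivative in the dilation parameter.\<close>
lemma kern_lap_point:
  fixes x y :: "real ^ 'n::finite"
  assumes e: "0 < \<epsilon>" "\<epsilon> \<le> 1/2" and k: "0 < k" and s: "0 < s" and x: "x \<noteq> 0"
  shows "laplacian (\<lambda>y. (y \<bullet> y) * kern k \<epsilon> x (s *\<^sub>R y)) y = kern_lap k \<epsilon> s x y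
    + 2 * (2 * real k + CARD('n) + 2) * s ^ (k + 1) * kern_ds k \<epsilon> s x y"
proof (cases "y = 0")
  case True
  have "laplacian (\<lambda>y. (y \<bullet> y) * kern k \<epsilon> x (s *\<^sub>R y)) y = 0"
  proof (rule laplacian_eq_0[where r="norm x / (2 * s)"])
    show "y \<bullet> y * kern k \<epsilon> x (s *\<^sub>R y) = 0" if "norm y < norm x / (2 * s)" for y
      using that s by (subst kern_zero_far[OF e k]) (auto simp: field_simps)
  qed (use True x s in auto)
  moreover have "flat j (1 - sqratio x (s *\<^sub>R y) / \<epsilon>\<^sup>2) = 0" for j
    using True x mult_right_mono[of \<epsilon> 1 "norm x"] e by (intro flat_sqratio_support) auto
  ultimately show ?thesis by (simp add: kern_lap_def kern_ds_def Let_def)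
next
  case y: False
  define g0 where "g0 = flat 0 (1 - sqratio x (s *\<^sub>R y) / \<epsilon>\<^sup>2) / \<epsilon> ^ CARD('n)"
  define g1 where "g1 = - flat 2 (1 - sqratio x (s *\<^sub>R y) / \<epsilon>\<^sup>2) / \<epsilon> ^ CARD('n) / \<epsilon>\<^sup>2"
  define g2 where "g2 = (flat 4 (1 - sqratio x (s *\<^sub>R y) / \<epsilon>\<^sup>2) - 2 * flat 3 (1 - sqratio x (s *\<^sub>R y) / \<epsilon>\<^sup>2)) / \<epsilon> ^ CARD('n) / \<epsilon>\<^sup>2 / \<epsilon>\<^sup>2"
  define b where "b = ((s *\<^sub>R y) \<bullet> (s *\<^sub>R y)) / (x \<bullet> x)"
  define q where "q = sqratio x (s *\<^sub>R y)"
  define a where "a = (x \<bullet> x) ^ k"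
  have lp: "laplacian (\<lambda>y. (y \<bullet> y) * kern k \<epsilon> x (s *\<^sub>R y)) y =
      a * (2 * CARD('n) * g0 + (- 4 * (1 - q - b) + 2 * CARD('n) * b) * g1 + 4 * q * b * g2)"
    using laplacian_kernel_point[OF x y profile_derivatives[of \<epsilon> "\<epsilon> ^ CARD('n)"], of "(x \<bullet> x) ^ k" s] e
    unfolding kern_def g0_def g1_def g2_def b_def q_def a_def by simp
  have kl: "kern_lap k \<epsilon> s x y = a * ((real k + 1) * (2 * CARD('n) + 4 * real k) * g0
      + (4 * real k * (1 - q - b) + 2 * CARD('n) * (1 - q)) * g1 + 4 * q * b * g2)"
    unfolding kern_lap_def Let_def g0_def g1_def g2_def b_def q_def a_def ..
  have kd: "s ^ (k + 1) * kern_ds k \<epsilon> s x y = - (a * (real k * g0 + (1 - q - b) * g1))"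
    using s unfolding kern_ds_def Let_def g0_def g1_def b_def q_def a_def by simp
  show ?thesis unfolding lp kl mult.assoc[of _ "s ^ (k + 1)"] kd by (simp add: algebra_simps)
qed

text \<open>On the support of the bump both scale-invariant quantities are bounded: \<open>q \<le> 1\<close>, and \<open>\<beta> \<le> 64\<close> because
  \<open>|s y| \<le> 2 \<cdot> 4 |x|\<close>.\<close>
lemma flat_majorant:
  fixes x y :: "real ^ 'n::finite"
  assumes e: "0 < \<epsilon>" "\<epsilon> \<le> 1/2" and k: "0 < k" and s: "1/2 \<le> s" "s \<le> 2"
  defines "q \<equiv> sqratio x (s *\<^sub>R y)" and "\<beta> \<equiv> ((s *\<^sub>R y) \<bullet> (s *\<^sub>R y)) / (x \<bullet> x)"
  assumes c: "0 \<le> q \<Longrightarrow> q \<le> 1 \<Longrightarrow> 0 \<le> \<beta> \<Longrightarrow> \<beta> \<le> 64 \<Longrightarrow> \<bar>c\<bar> \<le> B" and B: "0 \<le> B"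
  shows "\<bar>(x \<bullet> x) ^ k * (c * flat j (1 - q / \<epsilon>\<^sup>2))\<bar> \<le> B * fact j * majorant k x y"
proof (cases "(x \<bullet> x) ^ k * (c * flat j (1 - q / \<epsilon>\<^sup>2)) = 0")
  case True
  then show ?thesis using B majorant_nonneg[of k x y] by (simp only: True abs_zero) simp
next
  case False
  then have x: "x \<noteq> 0" using k by auto
  have "\<not> \<epsilon> * norm x \<le> norm (s *\<^sub>R y - x)"
    using flat_sqratio_support[OF e(1) x, of "s *\<^sub>R y" j] False by (auto simp: q_def)
  then have d: "norm (s *\<^sub>R y - x) \<le> \<epsilon> * norm x" by simp
  note cmp = comparable_scaled[OF d e(2) s]
  have "norm (s *\<^sub>R y - x) \<le> norm x"
    using d mult_right_mono[of \<epsilon> 1 "norm x"] e by simp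
  then have q: "0 \<le> q" "q \<le> 1"
    using x power_mono[of "norm (s *\<^sub>R y - x)" "norm x" 2]
    by (auto simp: q_def sqratio_def dot_square_norm)
  have "norm (s *\<^sub>R y) \<le> 8 * norm x"
    using mult_mono[OF s(2) cmp(2)] s by simp
  then have "(norm (s *\<^sub>R y))\<^sup>2 \<le> 64 * (norm x)\<^sup>2"
    using power_mono[of "norm (s *\<^sub>R y)" "8 * norm x" 2] by (simp add: power_mult_distrib)
  then have b: "0 \<le> \<beta>" "\<beta> \<le> 64"
    using x by (auto simp: \<beta>_def dot_square_norm divide_le_eq power_mult_distrib)
  have "\<bar>c * flat j (1 - q / \<epsilon>\<^sup>2)\<bar> \<le> B * fact j"
    unfolding abs_mult using c[OF q b] B flat_le_fact[of j] flat_nonneg[of j]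
    by (intro mult_mono) auto
  then have "\<bar>(x \<bullet> x) ^ k * (c * flat j (1 - q / \<epsilon>\<^sup>2))\<bar> \<le> (x \<bullet> x) ^ k * (B * fact j)"
    unfolding abs_mult[of "(x \<bullet> x) ^ k"] by (simp add: mult_left_mono)
  moreover have "(x, y) \<in> comparable" using cmp by (simp add: comparable_def)
  ultimately show ?thesis by (simp add: majorant_def mult_ac)
qed

lemma kern_ds_le_majorant:
  assumes e: "0 < \<epsilon>" "\<epsilon> \<le> 1/2" and k: "0 < k"
  shows "\<exists>C. \<forall>s x (y :: real ^ 'n::finite). 1/2 \<le> s \<and> s \<le> 2 \<longrightarrow> \<bar>kern_ds k \<epsilon> s x y\<bar> \<le> C * majorant k x y"
proof -
  define B0 where "B0 = real k / \<epsilon> ^ CARD('n) * 2 ^ (k + 1)"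
  define B1 where "B1 = 65 / \<epsilon> ^ CARD('n) / \<epsilon>\<^sup>2 * 2 ^ (k + 1)"
  have B: "0 \<le> B0" "0 \<le> B1" using e by (auto simp: B0_def B1_def)
  have "\<bar>kern_ds k \<epsilon> s x y\<bar> \<le> (B0 * fact 0 + B1 * fact 2) * majorant k x y"
    if s: "1/2 \<le> s" "s \<le> 2" for s and x y :: "real ^ 'n"
  proof -
    define q where "q = sqratio x (s *\<^sub>R y)"
    define b where "b = ((s *\<^sub>R y) \<bullet> (s *\<^sub>R y)) / (x \<bullet> x)"
    define c0 where "c0 = - (real k / \<epsilon> ^ CARD('n) / s ^ (k + 1))"
    define c1 where "c1 = (1 - q - b) / \<epsilon> ^ CARD('n) / \<epsilon>\<^sup>2 / s ^ (k + 1)"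
    have "(1/2) ^ (k + 1) \<le> s ^ (k + 1)" using s by (intro power_mono) auto
    then have inv: "1 / s ^ (k + 1) \<le> 2 ^ (k + 1)"
      using s by (simp add: power_one_over field_simps)
    have d: "\<bar>t\<bar> / s ^ (k + 1) \<le> r * 2 ^ (k + 1)" if "\<bar>t\<bar> \<le> r" for t r
      using mult_mono[OF that inv] that s by simp
    have c0: "\<bar>c0\<bar> \<le> B0"
      using d[of "real k / \<epsilon> ^ CARD('n)" "real k / \<epsilon> ^ CARD('n)"] e s
      by (simp add: c0_def B0_def abs_divide)
    have c1: "\<bar>c1\<bar> \<le> B1" if "0 \<le> q" "q \<le> 1" "0 \<le> b" "b \<le> 64"
    proof -
      have "\<bar>(1 - q - b) / \<epsilon> ^ CARD('n) / \<epsilon>\<^sup>2\<bar> \<le> 65 / \<epsilon> ^ CARD('n) / \<epsilon>\<^sup>2"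
        unfolding abs_divide using that e by (intro frac_le) (auto simp: divide_right_mono)
      from d[OF this] show ?thesis using s by (simp add: c1_def B1_def abs_divide abs_mult)
    qed
    have "kern_ds k \<epsilon> s x y = (x \<bullet> x) ^ k * (c0 * flat 0 (1 - q / \<epsilon>\<^sup>2)) + (x \<bullet> x) ^ k * (c1 * flat 2 (1 - q / \<epsilon>\<^sup>2))"
      using s e unfolding kern_ds_def Let_def q_def[symmetric] b_def[symmetric] c0_def c1_def
      by (simp add: field_simps)
    also have "\<bar>\<dots>\<bar> \<le> B0 * fact 0 * majorant k x y + B1 * fact 2 * majorant k x y"
      using c0 c1 B unfolding q_def b_def
      by (intro order.trans[OF abs_triangle_ineq] add_mono flat_majorant[OF e k s]) auto
    finally show ?thesis by (simp add: distrib_right)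
  qed
  then show ?thesis by blast
qed

lemma kern_lap_le_majorant:
  assumes e: "0 < \<epsilon>" "\<epsilon> \<le> 1/2" and k: "0 < k"
  shows "\<exists>C. \<forall>s x (y :: real ^ 'n::finite). 1/2 \<le> s \<and> s \<le> 2 \<longrightarrow> \<bar>kern_lap k \<epsilon> s x y\<bar> \<le> C * majorant k x y"
proof -
  let ?n = "CARD('n)"
  define B0 where "B0 = (real k + 1) * (2 * real ?n + 4 * real k) / \<epsilon> ^ ?n"
  define B2 where "B2 = (260 * real k + 2 * real ?n) / \<epsilon> ^ ?n / \<epsilon>\<^sup>2"
  define B4 where "B4 = 256 / \<epsilon> ^ ?n / \<epsilon>\<^sup>2 / \<epsilon>\<^sup>2"
  define B3 where "B3 = 512 / \<epsilon> ^ ?n / \<epsilon>\<^sup>2 / \<epsilon>\<^sup>2"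
  have B: "0 \<le> B0" "0 \<le> B2" "0 \<le> B3" "0 \<le> B4" using e by (auto simp: B0_def B2_def B3_def B4_def)
  have "\<bar>kern_lap k \<epsilon> s x y\<bar> \<le> (B0 * fact 0 + B2 * fact 2 + B4 * fact 4 + B3 * fact 3) * majorant k x y"
    if s: "1/2 \<le> s" "s \<le> 2" for s and x y :: "real ^ 'n"
  proof -
    define q where "q = sqratio x (s *\<^sub>R y)"
    define b where "b = ((s *\<^sub>R y) \<bullet> (s *\<^sub>R y)) / (x \<bullet> x)"
    define c2 where "c2 = - ((4 * real k * (1 - q - b) + 2 * real ?n * (1 - q)) / \<epsilon> ^ ?n / \<epsilon>\<^sup>2)"
    define c4 where "c4 = 4 * q * b / \<epsilon> ^ ?n / \<epsilon>\<^sup>2 / \<epsilon>\<^sup>2"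
    define c3 where "c3 = - (2 * (4 * q * b) / \<epsilon> ^ ?n / \<epsilon>\<^sup>2 / \<epsilon>\<^sup>2)"
    have c2: "\<bar>c2\<bar> \<le> B2" if "0 \<le> q" "q \<le> 1" "0 \<le> b" "b \<le> 64"
    proof -
      have "\<bar>4 * real k * (1 - q - b)\<bar> \<le> 4 * real k * 65"
        unfolding abs_mult[of "4 * real k"] using that by (intro mult_mono) auto
      moreover have "\<bar>2 * real ?n * (1 - q)\<bar> \<le> 2 * real ?n * 1"
        unfolding abs_mult[of "2 * real ?n"] using that by (intro mult_mono) auto
      ultimately have "\<bar>4 * real k * (1 - q - b) + 2 * real ?n * (1 - q)\<bar> \<le> 260 * real k + 2 * real ?n"
        by linarith
      then show ?thesis using e by (simp add: c2_def B2_def abs_divide divide_right_mono)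
    qed
    have c34: "\<bar>c4\<bar> \<le> B4" "\<bar>c3\<bar> \<le> B3" if "0 \<le> q" "q \<le> 1" "0 \<le> b" "b \<le> 64"
    proof -
      have "q * b \<le> 1 * 64" using that by (intro mult_mono) auto
      moreover have "0 \<le> q * b" using that by simp
      ultimately have "\<bar>4 * (q * b)\<bar> \<le> 256" "\<bar>2 * (4 * (q * b))\<bar> \<le> 512" by linarith+
      then have "\<bar>4 * q * b\<bar> \<le> 256" "\<bar>2 * (4 * q * b)\<bar> \<le> 512" by (simp_all only: mult.assoc)
      then show "\<bar>c4\<bar> \<le> B4" "\<bar>c3\<bar> \<le> B3"
        using e unfolding c4_def c3_def B4_def B3_def abs_divide abs_minus_cancel
        by (simp_all add: divide_right_mono)
    qed
    have "kern_lap k \<epsilon> s x y = (x \<bullet> x) ^ k * (B0 * flat 0 (1 - q / \<epsilon>\<^sup>2)) + (x \<bullet> x) ^ k * (c2 * flat 2 (1 - q / \<epsilon>\<^sup>2))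
       + (x \<bullet> x) ^ k * (c4 * flat 4 (1 - q / \<epsilon>\<^sup>2)) + (x \<bullet> x) ^ k * (c3 * flat 3 (1 - q / \<epsilon>\<^sup>2))"
    proof -
      define F where "F j = flat j (1 - q / \<epsilon>\<^sup>2)" for j
      show ?thesis
        unfolding kern_lap_def Let_def q_def[symmetric] b_def[symmetric] B0_def c2_def c4_def c3_def
          F_def[symmetric]
        by (simp add: divide_inverse algebra_simps)
    qed
    also have "\<bar>\<dots>\<bar> \<le> B0 * fact 0 * majorant k x y + B2 * fact 2 * majorant k x y
        + B4 * fact 4 * majorant k x y + B3 * fact 3 * majorant k x y"
      using c2 c34 B unfolding q_def b_def
      by (intro order.trans[OF abs_triangle_ineq] add_mono flat_majorant[OF e k s]) auto
    finally show ?thesis by (simp only: distrib_right)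
  qed
  then show ?thesis by blast
qed

lemma kern_ds_measurable [measurable]: "(\<lambda>(x, y). kern_ds k \<epsilon> s x y) \<in> borel_measurable (borel \<Otimes>\<^sub>M borel)"
  unfolding kern_ds_def Let_def by measurable

lemma kern_lap_measurable [measurable]: "(\<lambda>(x, y). kern_lap k \<epsilon> s x y) \<in> borel_measurable (borel \<Otimes>\<^sub>M borel)"
  unfolding kern_lap_def Let_def by measurable

lemma punctured_smooth_sqratio: "(\<lambda>x. sqratio x z) \<in> punctured_smooth"
proof -
  have "(\<lambda>x. (z \<bullet> z + (-2) * (x \<bullet> z) + x \<bullet> x) * inverse (x \<bullet> x)) \<in> punctured_smooth"
    by (intro punctured_smooth.intros punctured_smooth_inner_const punctured_smooth_inner_self)
  moreover have "(\<lambda>x. (z \<bullet> z + (-2) * (x \<bullet> z) + x \<bullet> x) * inverse (x \<bullet> x)) = (\<lambda>x. sqratio x z)"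
    by (auto simp: sqratio_def inner_diff_left inner_diff_right inner_commute divide_inverse)
  ultimately show ?thesis by simp
qed

lemma punctured_smooth_sqratio_point: "(\<lambda>y. sqratio x (s *\<^sub>R y)) \<in> punctured_smooth"
proof -
  have "(\<lambda>y. (s\<^sup>2 * (y \<bullet> y) + (- 2 * s) * (y \<bullet> x) + x \<bullet> x) * inverse (x \<bullet> x)) \<in> punctured_smooth"
    by (intro punctured_smooth.intros punctured_smooth_inner_const punctured_smooth_inner_self)
  moreover have "(\<lambda>y. (s\<^sup>2 * (y \<bullet> y) + (- 2 * s) * (y \<bullet> x) + x \<bullet> x) * inverse (x \<bullet> x)) = (\<lambda>y. sqratio x (s *\<^sub>R y))"
    by (auto simp: sqratio_def inner_diff_left inner_diff_right inner_commute divide_inverse power2_eq_square algebra_simps)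
  ultimately show ?thesis by simp
qed

lemma test_function_kern_centre:
  fixes z :: "real ^ 'n::finite"
  assumes e: "0 < \<epsilon>" "\<epsilon> \<le> 1/2" and k: "0 < k" and z: "z \<noteq> 0"
  shows "test_function (\<lambda>x. (x \<bullet> x) * kern k \<epsilon> x z)"
proof (rule test_function_punctured[OF _ refl, where r="norm z / 2" and R="2 * norm z"])
  have "(\<lambda>x. (x \<bullet> x) * ((x \<bullet> x) ^ k * (flat 0 (1 - sqratio x z * (1 / \<epsilon>\<^sup>2)) * (1 / \<epsilon> ^ CARD('n))))) \<in> punctured_smooth"
    by (intro punctured_smooth.intros punctured_smooth_power punctured_smooth_diff
        punctured_smooth_inner_self punctured_smooth_sqratio)
  then show "(\<lambda>x. (x \<bullet> x) * kern k \<epsilon> x z) \<in> punctured_smooth" by (simp add: kern_def)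
  show "x \<bullet> x * kern k \<epsilon> x z = 0" if "norm x < norm z / 2" for x
    using that kern_zero_far[OF e k, of x z] by auto
  show "x \<bullet> x * kern k \<epsilon> x z = 0" if "2 * norm z < norm x" for x
    using that kern_zero_far[OF e k, of x z] by auto
qed (use z in auto)

lemma test_function_kern_point:
  fixes x :: "real ^ 'n::finite"
  assumes e: "0 < \<epsilon>" "\<epsilon> \<le> 1/2" and k: "0 < k" and x: "x \<noteq> 0" and s: "0 < s"
  shows "test_function (\<lambda>y. (y \<bullet> y) * kern k \<epsilon> x (s *\<^sub>R y))"
proof (rule test_function_punctured[OF _ refl, where r="norm x / (2 * s)" and R="2 * norm x / s"])
  have "(\<lambda>y. (y \<bullet> y) * ((x \<bullet> x) ^ k * (flat 0 (1 - sqratio x (s *\<^sub>R y) * (1 / \<epsilon>\<^sup>2)) * (1 / \<epsilon> ^ CARD('n))))) \<in> punctured_smooth"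
    by (intro punctured_smooth.intros punctured_smooth_diff
        punctured_smooth_inner_self punctured_smooth_sqratio_point)
  then show "(\<lambda>y. (y \<bullet> y) * kern k \<epsilon> x (s *\<^sub>R y)) \<in> punctured_smooth" by (simp add: kern_def)
  show "y \<bullet> y * kern k \<epsilon> x (s *\<^sub>R y) = 0" if "norm y < norm x / (2 * s)" for y
    using that s by (subst kern_zero_far[OF e k]) (auto simp: field_simps)
  show "y \<bullet> y * kern k \<epsilon> x (s *\<^sub>R y) = 0" if "2 * norm x / s < norm y" for y
    using that s by (subst kern_zero_far[OF e k]) (auto simp: field_simps)
qed (use x s in auto)

section \<open>The virial identity and its consequences\<close>

lemma AE_nonzero: "AE x in lborel. x \<noteq> (0 :: real ^ 'n::finite)"
  by (rule AE_lborel_singleton)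

definition weight_inner :: "nat \<Rightarrow> (real ^ 'n::finite \<Rightarrow> real) \<Rightarrow> (real ^ 'n \<Rightarrow> real) \<Rightarrow> real" where
  "weight_inner k v w = (LINT x|lborel. norm x ^ (2 * k + CARD('n)) * (v x * w x))"

text \<open>The smoothed correlation of \<open>v\<close> with the dilate of \<open>w\<close> by \<open>s\<close>; see \<open>kern_corr_dilate\<close> and \<open>kern_corr_limit\<close>.\<close>
definition kern_corr ::
  "nat \<Rightarrow> real \<Rightarrow> real \<Rightarrow> (real ^ 'n::finite \<Rightarrow> real) \<Rightarrow> (real ^ 'n \<Rightarrow> real) \<Rightarrow> real" where
  "kern_corr k \<epsilon> s v w = (LINT (x, y)|(lborel \<Otimes>\<^sub>M lborel). v x * w y * kern k \<epsilon> x (s *\<^sub>R y))"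

lemma weight_inner_self: "weight_inner k v v = weight_norm2 k v"
  by (simp add: weight_inner_def weight_norm2_def power2_eq_square)

context
  fixes k :: nat and \<epsilon> s :: real
  assumes k: "0 < k" and e: "0 < \<epsilon>" "\<epsilon> \<le> 1/2" and s: "1/2 \<le> s" "s \<le> 2"
begin

lemma integrable_kern_scaled:
  assumes "weight_L2 k v" "weight_L2 k w"
  shows "integrable (lborel \<Otimes>\<^sub>M lborel) (\<lambda>(x, y). v x * w y * kern k \<epsilon> x (s *\<^sub>R y))"
  by (rule integrable_product_majorant(1)[OF assms _ kern_le_majorant[OF e k s]]) measurable

lemma integrable_kern_ds:
  fixes v w :: "real ^ 'n::finite \<Rightarrow> real"
  assumes v: "weight_L2 k v" and w: "weight_L2 k w"
  shows "integrable (lborel \<Otimes>\<^sub>M lborel) (\<lambda>(x, y). v x * w y * kern_ds k \<epsilon> s x y)"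
proof -
  obtain C where "\<And>x y :: real ^ 'n. \<bar>kern_ds k \<epsilon> s x y\<bar> \<le> C * majorant k x y"
    using kern_ds_le_majorant[OF e k] s by blast
  then show ?thesis by (rule integrable_product_majorant(1)[OF v w kern_ds_measurable])
qed

lemma integrable_kern_lap:
  fixes v w :: "real ^ 'n::finite \<Rightarrow> real"
  assumes v: "weight_L2 k v" and w: "weight_L2 k w"
  shows "integrable (lborel \<Otimes>\<^sub>M lborel) (\<lambda>(x, y). v x * w y * kern_lap k \<epsilon> s x y)"
proof -
  obtain C where "\<And>x y :: real ^ 'n. \<bar>kern_lap k \<epsilon> s x y\<bar> \<le> C * majorant k x y"
    using kern_lap_le_majorant[OF e k] s by blast
  then show ?thesis by (rule integrable_product_majorant(1)[OF v w kern_lap_measurable])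
qed

lemma kern_corr_dilate:
  fixes v w :: "real ^ 'n::finite \<Rightarrow> real"
  assumes v: "weight_L2 k v" and w: "weight_L2 k w"
  shows "s ^ CARD('n) * kern_corr k \<epsilon> s v w =
    (LINT (x, y)|(lborel \<Otimes>\<^sub>M lborel). v x * dilate s w y * kern k \<epsilon> x y)"
proof -
  have s0: "0 < s" using s by simp
  have ws: "weight_L2 k (dilate s w)" by (rule weight_L2_dilate[OF w s0])
  have [measurable]: "w \<in> borel_measurable borel" "dilate s w \<in> borel_measurable borel"
    using w ws by (auto dest: weight_L2_measurable)
  have "(LINT (x, y)|(lborel \<Otimes>\<^sub>M lborel). v x * dilate s w y * kern k \<epsilon> x y) =
      (LINT x|lborel. LINT y|lborel. v x * dilate s w y * kern k \<epsilon> x y)"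
    using lborel_pair.integral_fst[OF integrable_kern_products(1)[OF k e v ws]] by simp
  also have "\<dots> = (LINT x|lborel. s ^ CARD('n) * (LINT y|lborel. v x * w y * kern k \<epsilon> x (s *\<^sub>R y)))"
    using s0 by (subst integral_lborel_affine[where c=s and t=0]) (auto simp: dilate_def)
  also have "\<dots> = s ^ CARD('n) * kern_corr k \<epsilon> s v w"
    unfolding kern_corr_def using lborel_pair.integral_fst[OF integrable_kern_scaled[OF v w]] by simp
  finally show ?thesis by simp
qed

end

text \<open>The error is bounded through the energy of \<open>dilate s w\<close>, which is at most \<open>2\<^bsup>2k+2n\<^esup>\<close> times the energy of \<open>w\<close>
  for \<open>s \<le> 2\<close>. Hence one \<open>\<epsilon>0\<close> serves all these \<open>s\<close>.\<close>
lemma kern_corr_limit: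
  fixes v w :: "real ^ 'n::finite \<Rightarrow> real"
  assumes k: "0 < k" and v: "weight_L2 k v" and w: "weight_L2 k w" and d: "0 < d"
  shows "\<exists>\<epsilon>0>0. \<forall>\<epsilon> s. 0 < \<epsilon> \<and> \<epsilon> < \<epsilon>0 \<and> \<epsilon> \<le> 1/2 \<and> 1 \<le> s \<and> s \<le> 2 \<longrightarrow>
    \<bar>s ^ CARD('n) * kern_corr k \<epsilon> s v w - bump_mass TYPE('n) * weight_inner k v (dilate s w)\<bar> \<le> d"
proof -
  let ?c = "bump_mass TYPE('n)" and ?m = "2 * k + 2 * CARD('n)"
  have c: "0 < ?c" by (rule bump_mass_pos)
  \<comment> \<open>\<open>t\<close> makes the first error term at most \<open>d / 2\<close>; adding \<open>1\<close> avoids division by zero when \<open>v = 0\<close>\<close>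
  define t where "t = d / (2 * (?c * weight_norm2 k v + 1))"
  have pos: "0 < ?c * weight_norm2 k v + 1"
    using c weight_norm2_nonneg[of k v] by (intro add_nonneg_pos mult_nonneg_nonneg) auto
  then have t: "0 < t" using d by (simp add: t_def)
  have "t * (?c * weight_norm2 k v) \<le> t * (?c * weight_norm2 k v + 1)" using t by (intro mult_left_mono) auto
  also have "\<dots> = d / 2" using pos by (simp add: t_def field_simps)
  finally have A: "t * ?c * weight_norm2 k v \<le> d / 2" by simp
  obtain \<epsilon>0 where \<epsilon>0: "0 < \<epsilon>0" "\<And>\<epsilon>. 0 < \<epsilon> \<and> \<epsilon> < \<epsilon>0 \<and> \<epsilon> \<le> 1/2 \<Longrightarrow> energy k \<epsilon> w < t * d / 2 / 2 ^ ?m"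
    using energy_small[OF w k, of "t * d / 2 / 2 ^ ?m"] t d by auto
  show ?thesis
  proof (intro exI[of _ \<epsilon>0] conjI allI impI \<epsilon>0(1))
    fix \<epsilon> s :: real assume *: "0 < \<epsilon> \<and> \<epsilon> < \<epsilon>0 \<and> \<epsilon> \<le> 1/2 \<and> 1 \<le> s \<and> s \<le> 2"
    then have e: "0 < \<epsilon>" "\<epsilon> \<le> 1/2" and s: "0 < s" "1/2 \<le> s" "s \<le> 2" by auto
    have "energy k \<epsilon> (dilate s w) = s ^ ?m * energy k \<epsilon> w"
      by (rule energy_dilate[OF k e w s(1)])
    also have "\<dots> \<le> 2 ^ ?m * (t * d / 2 / 2 ^ ?m)"
      using s energy_nonneg[OF e(1), of k w] \<epsilon>0(2)[of \<epsilon>] * by (intro mult_mono power_mono) auto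
    also have "\<dots> = t * (d / 2)" by simp
    finally have B: "energy k \<epsilon> (dilate s w) / t \<le> d / 2" using t by (simp add: field_simps)
    show "\<bar>s ^ CARD('n) * kern_corr k \<epsilon> s v w - ?c * weight_inner k v (dilate s w)\<bar> \<le> d"
      unfolding kern_corr_dilate[OF k e s(2,3) v w] weight_inner_def
      using kern_approximates_diagonal[OF k e v weight_L2_dilate[OF w s(1)] t] A B by linarith
  qed
qed

lemma kern_corr_derivative:
  fixes v w :: "real ^ 'n::finite \<Rightarrow> real"
  assumes k: "0 < k" and e: "0 < \<epsilon>" "\<epsilon> \<le> 1/2" and s: "1/2 < s" "s < 2"
    and v: "weight_L2 k v" and w: "weight_L2 k w"
  shows "((\<lambda>s. kern_corr k \<epsilon> s v w / s ^ k) has_real_derivative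
    (LINT (x, y)|(lborel \<Otimes>\<^sub>M lborel). v x * w y * kern_ds k \<epsilon> s x y)) (at s)"
proof -
  have [measurable]: "v \<in> borel_measurable borel" "w \<in> borel_measurable borel"
    using v w by (auto dest: weight_L2_measurable)
  obtain C where C: "\<And>s x (y :: real ^ 'n). 1/2 \<le> s \<Longrightarrow> s \<le> 2 \<Longrightarrow> \<bar>kern_ds k \<epsilon> s x y\<bar> \<le> C * majorant k x y"
    using kern_ds_le_majorant[OF e k] by blast
  have "((\<lambda>s. LINT (x, y)|(lborel \<Otimes>\<^sub>M lborel). v x * w y * (kern k \<epsilon> x (s *\<^sub>R y) / s ^ k)) has_real_derivative
    (LINT (x, y)|(lborel \<Otimes>\<^sub>M lborel). v x * w y * kern_ds k \<epsilon> s x y)) (at s)"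
  proof (rule DERIV_integral_dominated[where a="1/2" and b=2
        and W="\<lambda>(x, y). C * \<bar>v x * w y * majorant k x y\<bar>"])
    show "s \<in> {1/2<..<2}" using s by simp
    show "integrable (lborel \<Otimes>\<^sub>M lborel) (\<lambda>(x, y). v x * w y * (kern k \<epsilon> x (t *\<^sub>R y) / t ^ k))"
      if "t \<in> {1/2<..<2}" for t
      using integrable_mult_left[where c="1 / t ^ k", OF integrable_kern_scaled[OF k e _ _ v w, of t]] that
      by (simp add: split_beta')
    show "((\<lambda>s. case z of (x, y) \<Rightarrow> v x * w y * (kern k \<epsilon> x (s *\<^sub>R y) / s ^ k)) has_real_derivative
        (case z of (x, y) \<Rightarrow> v x * w y * kern_ds k \<epsilon> t x y)) (at t)" if "t \<in> {1/2<..<2}" for t z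
    proof -
      obtain x y where z: "z = (x, y)" by (cases z)
      show ?thesis
        using DERIV_cmult[OF kern_scale_derivative[OF e(1) k, of t x y], of "v x * w y"] that by (simp add: z)
    qed
    show "(\<lambda>(x, y). v x * w y * kern_ds k \<epsilon> s x y) \<in> borel_measurable (lborel \<Otimes>\<^sub>M lborel)"
      by measurable
    have "integrable (lborel \<Otimes>\<^sub>M lborel) (\<lambda>(x, y). v x * w y * majorant k x y)"
      by (rule integrable_product_majorant(1)[OF v w majorant_measurable, where C=1])
         (simp add: majorant_nonneg)
    from integrable_mult_right[where c=C, OF integrable_norm[OF this]]
    show "integrable (lborel \<Otimes>\<^sub>M lborel) (\<lambda>(x, y). C * \<bar>v x * w y * majorant k x y\<bar>)"
      by (simp add: split_beta')
    show "\<bar>case z of (x, y) \<Rightarrow> v x * w y * kern_ds k \<epsilon> t x y\<bar> \<le> (case z of (x, y) \<Rightarrow> C * \<bar>v x * w y * majorant k x y\<bar>)"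
      if "t \<in> {1/2<..<2}" for t z
    proof -
      obtain x y where z: "z = (x, y)" by (cases z)
      have "\<bar>v x * w y\<bar> * \<bar>kern_ds k \<epsilon> t x y\<bar> \<le> \<bar>v x * w y\<bar> * (C * majorant k x y)"
        using C[of t x y] that by (intro mult_left_mono) auto
      then show ?thesis using majorant_nonneg[of k x y] by (simp add: z abs_mult mult_ac)
    qed
  qed
  then show ?thesis by (simp add: kern_corr_def split_beta')
qed

lemma weight_inner_AE_cong:
  fixes v w v' w' :: "real ^ 'n::finite \<Rightarrow> real"
  assumes "weight_L2 k v" "weight_L2 k w" "weight_L2 k v'" "weight_L2 k w'"
    and "AE x in lborel. v x * w x = C * (v' x * w' x)"
  shows "weight_inner k v w = C * weight_inner k v' w'"
proof -
  have [measurable]: "v \<in> borel_measurable borel" "w \<in> borel_measurable borel"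
     "v' \<in> borel_measurable borel" "w' \<in> borel_measurable borel"
    using assms by (auto dest: weight_L2_measurable)
  have "weight_inner k v w = (LINT x|lborel. C * (norm x ^ (2 * k + CARD('n)) * (v' x * w' x)))"
    unfolding weight_inner_def
    by (intro integral_cong_AE) (use assms(5) in \<open>auto elim!: eventually_mono\<close>)
  then show ?thesis by (simp add: weight_inner_def)
qed

text \<open>The situation to which the problem reduces: \<open>f\<close> stands for \<open>|x|\<^sup>2 V u\<close> and \<open>\<theta>\<close> for \<open>\<alpha> + 2\<close>. The assumption
  \<open>weak\<close> is the equation tested with functions divisible by \<open>|x|\<^sup>2\<close>. The potential enters only through
  the homogeneity of \<open>f\<close> relative to \<open>u\<close>, its sign, and the fact that \<open>f\<close> vanishes where \<open>u\<close> does.\<close>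
locale dilation_rigidity =
  fixes u f :: "real ^ 'n::finite \<Rightarrow> real" and k :: nat and \<theta> :: real
  assumes k: "0 < k"
    and u: "weight_L2 k u" and f: "weight_L2 k f"
    and weak: "\<And>\<eta>. \<eta> \<in> borel_measurable borel \<Longrightarrow> test_function (\<lambda>x. (x \<bullet> x) * \<eta> x) \<Longrightarrow>
      (LINT x|lborel. u x * laplacian (\<lambda>x. (x \<bullet> x) * \<eta> x) x) = - (LINT x|lborel. f x * \<eta> x)"
    and homogeneous: "\<And>s. 0 < s \<Longrightarrow>
      AE x in lborel. u x * dilate s f x = s powr (- \<theta>) * (f x * dilate s u x)"
    and sign: "AE x in lborel. 0 \<le> \<theta> * (f x * u x)"
    and zero: "\<And>x. u x = 0 \<Longrightarrow> f x = 0"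
begin

lemma meas [measurable]: "u \<in> borel_measurable borel" "f \<in> borel_measurable borel"
  using u f by (auto dest: weight_L2_measurable)

text \<open>By \<open>kern_lap_point\<close> the integrand on the left is, up to a constant, the difference of the two Laplacians
  tested against \<open>u(x) u(y)\<close>. In one of them \<open>x\<close> is integrated first and the equation is used for \<open>u(x)\<close>; in the
  other \<open>y\<close> is integrated first and the equation is used for \<open>u(y)\<close>.\<close>
lemma virial_identity:
  assumes e: "0 < \<epsilon>" "\<epsilon> \<le> 1/2" and s: "1/2 \<le> s" "s \<le> 2"
  shows "(LINT (x, y)|(lborel \<Otimes>\<^sub>M lborel). u x * u y * kern_ds k \<epsilon> s x y) =
    (kern_corr k \<epsilon> s f u - kern_corr k \<epsilon> s u f) / (2 * (2 * real k + CARD('n) + 2) * s ^ (k + 1))"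
proof -
  define c where "c = 2 * (2 * real k + CARD('n) + 2) * s ^ (k + 1)"
  have s0: "0 < s" using s by simp
  have c0: "0 < c" unfolding c_def using s0 by (intro mult_pos_pos) auto
  note I = integrable_kern_lap[OF k e s u u] integrable_kern_ds[OF k e s u u]
    integrable_kern_scaled[OF k e s f u] integrable_kern_scaled[OF k e s u f]
  have J: "integrable (lborel \<Otimes>\<^sub>M lborel) (\<lambda>(x, y). u x * u y * (kern_lap k \<epsilon> s x y + c * kern_ds k \<epsilon> s x y))"
    using Bochner_Integration.integrable_add[OF I(1) integrable_mult_right[where c=c, OF I(2)]]
    by (simp add: split_beta' algebra_simps)
  have "(LINT (x, y)|(lborel \<Otimes>\<^sub>M lborel). u x * u y * kern_lap k \<epsilon> s x y) =
      (LINT y|lborel. LINT x|lborel. u x * u y * kern_lap k \<epsilon> s x y)"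
    using lborel_pair.integral_snd[OF I(1)] by simp
  also have "\<dots> = (LINT y|lborel. - (LINT x|lborel. f x * u y * kern k \<epsilon> x (s *\<^sub>R y)))"
  proof (rule integral_cong_AE)
    show "(\<lambda>y. LINT x|lborel. u x * u y * kern_lap k \<epsilon> s x y) \<in> borel_measurable lborel"
      using lborel_pair.integrable_snd[OF I(1)] by auto
    show "(\<lambda>y. - (LINT x|lborel. f x * u y * kern k \<epsilon> x (s *\<^sub>R y))) \<in> borel_measurable lborel"
      using lborel_pair.integrable_snd[OF I(3)] by auto
    show "AE y in lborel. (LINT x|lborel. u x * u y * kern_lap k \<epsilon> s x y) =
        - (LINT x|lborel. f x * u y * kern k \<epsilon> x (s *\<^sub>R y))"
      using AE_nonzero
    proof eventually_elim
      case (elim y)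
      then have z: "s *\<^sub>R y \<noteq> 0" using s0 by simp
      have "(LINT x|lborel. u x * kern_lap k \<epsilon> s x y) = - (LINT x|lborel. f x * kern k \<epsilon> x (s *\<^sub>R y))"
        using weak[OF _ test_function_kern_centre[OF e k z]] by (simp add: kern_lap_centre[OF e k z])
      from arg_cong[OF this, of "\<lambda>t. u y * t"]
      show ?case by (simp add: integral_mult_right_zero[symmetric] mult_ac del: integral_mult_right_zero)
    qed
  qed
  also have "\<dots> = - kern_corr k \<epsilon> s f u"
    using lborel_pair.integral_snd[OF I(3)] by (simp add: kern_corr_def)
  finally have A: "(LINT (x, y)|(lborel \<Otimes>\<^sub>M lborel). u x * u y * kern_lap k \<epsilon> s x y) = - kern_corr k \<epsilon> s f u" .
  have "(LINT (x, y)|(lborel \<Otimes>\<^sub>M lborel). u x * u y * (kern_lap k \<epsilon> s x y + c * kern_ds k \<epsilon> s x y)) =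
      (LINT x|lborel. LINT y|lborel. u x * u y * (kern_lap k \<epsilon> s x y + c * kern_ds k \<epsilon> s x y))"
    using lborel_pair.integral_fst[OF J] by simp
  also have "\<dots> = (LINT x|lborel. - (LINT y|lborel. u x * f y * kern k \<epsilon> x (s *\<^sub>R y)))"
  proof (rule integral_cong_AE)
    show "(\<lambda>x. LINT y|lborel. u x * u y * (kern_lap k \<epsilon> s x y + c * kern_ds k \<epsilon> s x y)) \<in> borel_measurable lborel"
      using lborel_pair.integrable_fst[OF J] by auto
    show "(\<lambda>x. - (LINT y|lborel. u x * f y * kern k \<epsilon> x (s *\<^sub>R y))) \<in> borel_measurable lborel"
      using lborel_pair.integrable_fst[OF I(4)] by auto
    show "AE x in lborel. (LINT y|lborel. u x * u y * (kern_lap k \<epsilon> s x y + c * kern_ds k \<epsilon> s x y)) =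
        - (LINT y|lborel. u x * f y * kern k \<epsilon> x (s *\<^sub>R y))"
      using AE_nonzero
    proof eventually_elim
      case (elim x)
      have "(LINT y|lborel. u y * (kern_lap k \<epsilon> s x y + c * kern_ds k \<epsilon> s x y)) =
          - (LINT y|lborel. f y * kern k \<epsilon> x (s *\<^sub>R y))"
        using weak[OF _ test_function_kern_point[OF e k elim s0]]
        by (simp add: kern_lap_point[OF e k s0 elim] c_def mult.assoc)
      from arg_cong[OF this, of "\<lambda>t. u x * t"]
      show ?case by (simp add: integral_mult_right_zero[symmetric] mult_ac del: integral_mult_right_zero)
    qed
  qed
  also have "\<dots> = - kern_corr k \<epsilon> s u f"
    using lborel_pair.integral_fst[OF I(4)] by (simp add: kern_corr_def)
  finally have B: "(LINT (x, y)|(lborel \<Otimes>\<^sub>M lborel). u x * u y * (kern_lap k \<epsilon> s x y + c * kern_ds k \<epsilon> s x y))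
      = - kern_corr k \<epsilon> s u f" .
  have "(LINT (x, y)|(lborel \<Otimes>\<^sub>M lborel). u x * u y * (kern_lap k \<epsilon> s x y + c * kern_ds k \<epsilon> s x y)) =
     (LINT (x, y)|(lborel \<Otimes>\<^sub>M lborel). u x * u y * kern_lap k \<epsilon> s x y) +
     c * (LINT (x, y)|(lborel \<Otimes>\<^sub>M lborel). u x * u y * kern_ds k \<epsilon> s x y)"
    using Bochner_Integration.integral_add[OF I(1) integrable_mult_right[where c=c, OF I(2)]]
    by (simp add: split_beta' algebra_simps)
  then have "c * (LINT (x, y)|(lborel \<Otimes>\<^sub>M lborel). u x * u y * kern_ds k \<epsilon> s x y)
      = kern_corr k \<epsilon> s f u - kern_corr k \<epsilon> s u f"
    unfolding A B by simp
  then show ?thesis using c0 unfolding c_def[symmetric] by (simp add: field_simps)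
qed

lemma L2_dilate: "0 < s \<Longrightarrow> weight_L2 k (dilate s u)" "0 < s \<Longrightarrow> weight_L2 k (dilate s f)"
  using weight_L2_dilate[OF u] weight_L2_dilate[OF f] by auto

lemma weight_inner_homogeneous:
  assumes "0 < s"
  shows "weight_inner k u (dilate s f) = s powr (- \<theta>) * weight_inner k f (dilate s u)"
  by (rule weight_inner_AE_cong[OF u L2_dilate(2)[OF assms] f L2_dilate(1)[OF assms] homogeneous[OF assms]])

text \<open>The factor \<open>1 - s\<^bsup>-\<theta>\<^esup>\<close> vanishes for \<open>\<theta> = 0\<close> and otherwise has the sign of \<open>\<theta>\<close> for \<open>s > 1\<close>, and \<open>\<theta> \<langle>f, u\<rangle> \<ge> 0\<close>. If this number is positive, it
  stays positive for nearby dilates, since \<open>s \<mapsto> \<langle>f, u\<^sub>s\<rangle>\<close> is a uniform limit of continuous functions. If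
  it is zero and \<open>\<theta> \<noteq> 0\<close>, then \<open>f u = 0\<close> almost everywhere, hence \<open>f = 0\<close>.\<close>
lemma correlation_sign:
  "\<exists>S0>1. S0 < 2 \<and> (\<forall>s. 1 \<le> s \<and> s \<le> S0 \<longrightarrow> 0 \<le> (1 - s powr (- \<theta>)) * weight_inner k f (dilate s u))"
proof (cases "\<theta> = 0 \<or> weight_inner k f u = 0")
  case True
  have "(1 - s powr (- \<theta>)) * weight_inner k f (dilate s u) = 0" if "0 < s" for s
  proof (cases "\<theta> = 0")
    case False
    let ?h = "\<lambda>x. norm x ^ (2 * k + CARD('n)) * (f x * u x)"
    have nn: "AE x in lborel. 0 \<le> \<theta> * ?h x"
      using sign by eventually_elim
        (simp add: mult.left_commute[of \<theta>] mult_nonneg_nonneg)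
    have "(LINT x|lborel. \<theta> * ?h x) = 0" using True False by (simp add: weight_inner_def)
    then have "AE x in lborel. \<theta> * ?h x = 0"
      using integrable_mult_right[OF integrable_weight_mult[OF f u]] nn
      by (subst (asm) integral_nonneg_eq_0_iff_AE) auto
    with AE_nonzero have "AE x in lborel. f x = 0"
      by eventually_elim (use False zero in auto)
    then have "AE x in lborel. f x * dilate s u x = 0 * (f x * u x)"
      by eventually_elim simp
    from weight_inner_AE_cong[OF f L2_dilate(1)[OF that] f u this]
    show ?thesis by simp
  qed (use that in simp)
  note vanish = this
  have "0 \<le> (1 - s powr (- \<theta>)) * weight_inner k f (dilate s u)" if "1 \<le> s" for s
  proof -
    have "0 < s" using that by simp
    from vanish[OF this] show ?thesis by (simp only: order_refl)
  qed
  then show ?thesis by (intro exI[of _ "3/2"]) auto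
next
  case False
  let ?c = "bump_mass TYPE('n)" and ?n = "CARD('n)"
  define A where "A = ?c * (\<theta> * weight_inner k f u)"
  have "0 \<le> \<theta> * weight_inner k f u"
  proof -
    have "0 \<le> (LINT x|lborel. \<theta> * (norm x ^ (2 * k + ?n) * (f x * u x)))"
      using sign by (intro integral_nonneg_AE, eventually_elim)
        (simp add: mult.left_commute[of \<theta>] mult_nonneg_nonneg)
    then show ?thesis by (simp add: weight_inner_def)
  qed
  moreover have "\<theta> * weight_inner k f u \<noteq> 0" using False by simp
  ultimately have "0 < \<theta> * weight_inner k f u" by linarith
  then have A: "0 < A" unfolding A_def by (rule mult_pos_pos[OF bump_mass_pos])
  \<comment> \<open>chosen so that \<open>\<theta>\<close> times the smoothed correlation is within \<open>A / 4\<close> of its limit for all \<open>s\<close> in \<open>{1..2}\<close>\<close>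
  define d where "d = A / (4 * \<bar>\<theta>\<bar>)"
  have d: "0 < d" "\<bar>\<theta>\<bar> * d = A / 4" using A False by (auto simp: d_def)
  obtain \<epsilon>0 where \<epsilon>0: "0 < \<epsilon>0" "\<And>\<epsilon> s. 0 < \<epsilon> \<and> \<epsilon> < \<epsilon>0 \<and> \<epsilon> \<le> 1/2 \<and> 1 \<le> s \<and> s \<le> 2 \<Longrightarrow>
    \<bar>s ^ ?n * kern_corr k \<epsilon> s f u - ?c * weight_inner k f (dilate s u)\<bar> \<le> d"
    using kern_corr_limit[OF k f u d(1)] by blast
  define \<epsilon> where "\<epsilon> = min (\<epsilon>0 / 2) (1/2)"
  have e: "0 < \<epsilon>" "\<epsilon> < \<epsilon>0" "\<epsilon> \<le> 1/2" using \<epsilon>0(1) by (auto simp: \<epsilon>_def)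
  have near: "\<bar>\<theta> * (s ^ ?n * kern_corr k \<epsilon> s f u) - ?c * (\<theta> * weight_inner k f (dilate s u))\<bar> \<le> A / 4"
    if "1 \<le> s" "s \<le> 2" for s
  proof -
    have "\<bar>\<theta>\<bar> * \<bar>s ^ ?n * kern_corr k \<epsilon> s f u - ?c * weight_inner k f (dilate s u)\<bar> \<le> \<bar>\<theta>\<bar> * d"
      using \<epsilon>0(2)[of \<epsilon> s] e that by (intro mult_left_mono) auto
    then show ?thesis unfolding d(2) abs_mult[symmetric] by (simp add: algebra_simps)
  qed
  have cont: "isCont (\<lambda>s. \<theta> * (s ^ ?n * (s ^ k * h s))) 1" if "isCont h 1" for h :: "real \<Rightarrow> real"
    using that by (intro continuous_intros)
  have "isCont (\<lambda>s. kern_corr k \<epsilon> s f u / s ^ k) 1"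
    by (rule DERIV_isCont[OF kern_corr_derivative[OF k e(1,3) _ _ f u]]) auto
  then have "isCont (\<lambda>s. \<theta> * (s ^ ?n * (s ^ k * (kern_corr k \<epsilon> s f u / s ^ k)))) 1"
    by (rule cont)
  then have lim: "((\<lambda>s. \<theta> * (s ^ ?n * (s ^ k * (kern_corr k \<epsilon> s f u / s ^ k)))) \<longlongrightarrow> \<theta> * kern_corr k \<epsilon> 1 f u) (at 1)"
    by (simp add: isCont_def)
  have start: "A / 2 < \<theta> * kern_corr k \<epsilon> 1 f u"
  proof -
    have "\<bar>\<theta> * kern_corr k \<epsilon> 1 f u - A\<bar> \<le> A / 4" using near[of 1] by (simp add: A_def)
    then show ?thesis using A by linarith
  qed
  have "\<forall>\<^sub>F s in at 1. A / 2 < \<theta> * (s ^ ?n * (s ^ k * (kern_corr k \<epsilon> s f u / s ^ k)))"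
    using lim start by (rule order_tendstoD(1))
  then obtain r where r: "0 < r" "\<And>s. s \<noteq> 1 \<Longrightarrow> dist s 1 < r \<Longrightarrow>
      A / 2 < \<theta> * (s ^ ?n * (s ^ k * (kern_corr k \<epsilon> s f u / s ^ k)))"
    unfolding eventually_at by auto
  define S0 where "S0 = 1 + min (r / 2) (1/2)"
  have S0: "1 < S0" "S0 < 2" "S0 < 1 + r" using r(1) by (auto simp: S0_def)
  have "0 \<le> (1 - s powr (- \<theta>)) * weight_inner k f (dilate s u)" if s: "1 \<le> s" "s \<le> S0" for s
  proof (cases "s = 1")
    case False
    then have "A / 2 < \<theta> * (s ^ ?n * kern_corr k \<epsilon> s f u)"
      using r(2)[of s] s S0 by (simp add: dist_real_def)
    moreover have "\<bar>\<theta> * (s ^ ?n * kern_corr k \<epsilon> s f u) - ?c * (\<theta> * weight_inner k f (dilate s u))\<bar> \<le> A / 4"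
      using s S0 by (intro near) auto
    ultimately have "0 < ?c * (\<theta> * weight_inner k f (dilate s u))" using A by linarith
    then have pos: "0 < \<theta> * weight_inner k f (dilate s u)"
      using bump_mass_pos[where 'n='n] by (simp add: zero_less_mult_iff)
    show ?thesis
    proof (cases "0 < \<theta>")
      case True
      then have "s powr (- \<theta>) \<le> 1" using powr_mono[of "- \<theta>" 0 s] s by simp
      then show ?thesis using pos True by (simp add: zero_less_mult_iff)
    next
      case False
      then have "1 \<le> s powr (- \<theta>)" using s by (intro ge_one_powr_ge_zero) auto
      then show ?thesis using pos False by (auto simp: zero_less_mult_iff intro: mult_nonpos_nonpos)
    qed
  qed simp
  then show ?thesis using S0 by blast
qed

text \<open>The mean value theorem for the smoothed autocorrelation \<open>G\<close>, whose derivative is bounded below by a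
  quantity that tends to \<open>0\<close> with \<open>\<epsilon>\<close>.\<close>
lemma correlation_ge:
  assumes S: "1 < S" "S < 2"
    and sgn: "\<And>s. 1 \<le> s \<Longrightarrow> s \<le> S \<Longrightarrow> 0 \<le> (1 - s powr (- \<theta>)) * weight_inner k f (dilate s u)"
  shows "S ^ (k + CARD('n)) * weight_norm2 k u \<le> weight_inner k u (dilate S u)"
proof -
  let ?c = "bump_mass TYPE('n)" and ?n = "CARD('n)"
  have c: "0 < ?c" by (rule bump_mass_pos)
  have "?c * weight_norm2 k u \<le> ?c * weight_inner k u (dilate S u) / S ^ (k + ?n) + r" if r: "0 < r" for r
  proof -
    \<comment> \<open>the approximation costs \<open>d\<close> at each end of the interval and \<open>2 * d\<close> in the derivative\<close>
    define d where "d = r / 4"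
    have d: "0 < d" using r by (simp add: d_def)
    obtain \<epsilon>1 where \<epsilon>1: "0 < \<epsilon>1" "\<And>\<epsilon> s. 0 < \<epsilon> \<and> \<epsilon> < \<epsilon>1 \<and> \<epsilon> \<le> 1/2 \<and> 1 \<le> s \<and> s \<le> 2 \<Longrightarrow>
      \<bar>s ^ ?n * kern_corr k \<epsilon> s u u - ?c * weight_inner k u (dilate s u)\<bar> \<le> d"
      using kern_corr_limit[OF k u u d] by blast
    obtain \<epsilon>2 where \<epsilon>2: "0 < \<epsilon>2" "\<And>\<epsilon> s. 0 < \<epsilon> \<and> \<epsilon> < \<epsilon>2 \<and> \<epsilon> \<le> 1/2 \<and> 1 \<le> s \<and> s \<le> 2 \<Longrightarrow>
      \<bar>s ^ ?n * kern_corr k \<epsilon> s f u - ?c * weight_inner k f (dilate s u)\<bar> \<le> d"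
      using kern_corr_limit[OF k f u d] by blast
    obtain \<epsilon>3 where \<epsilon>3: "0 < \<epsilon>3" "\<And>\<epsilon> s. 0 < \<epsilon> \<and> \<epsilon> < \<epsilon>3 \<and> \<epsilon> \<le> 1/2 \<and> 1 \<le> s \<and> s \<le> 2 \<Longrightarrow>
      \<bar>s ^ ?n * kern_corr k \<epsilon> s u f - ?c * weight_inner k u (dilate s f)\<bar> \<le> d"
      using kern_corr_limit[OF k u f d] by blast
    define \<epsilon> where "\<epsilon> = min (min \<epsilon>1 \<epsilon>2) (min \<epsilon>3 1) / 2"
    have e: "0 < \<epsilon>" "\<epsilon> < \<epsilon>1" "\<epsilon> < \<epsilon>2" "\<epsilon> < \<epsilon>3" "\<epsilon> \<le> 1/2"
      using \<epsilon>1(1) \<epsilon>2(1) \<epsilon>3(1) unfolding \<epsilon>_def by (auto simp: min_def)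
    define G where "G s = kern_corr k \<epsilon> s u u / s ^ k" for s
    define D where "D s = (LINT (x, y)|(lborel \<Otimes>\<^sub>M lborel). u x * u y * kern_ds k \<epsilon> s x y)" for s
    have der: "(G has_real_derivative D s) (at s)" if "1 \<le> s" "s \<le> S" for s
      unfolding G_def[abs_def] D_def using kern_corr_derivative[OF k e(1,5) _ _ u u, of s] that S by simp
    have Dlow: "- (2 * d) \<le> D s" if s: "1 \<le> s" "s \<le> S" for s
    proof -
      let ?q = "2 * (2 * real k + real ?n + 2) * s ^ (k + 1)"
      have sn: "1 \<le> s ^ ?n" "1 \<le> s ^ (k + 1)" using s by (intro one_le_power; simp)+
      have "1 * 1 \<le> ?q" using sn by (intro mult_mono) auto
      then have q: "1 \<le> ?q" by simp
      have "s ^ ?n * kern_corr k \<epsilon> s f u \<ge> ?c * weight_inner k f (dilate s u) - d"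
        using \<epsilon>2(2)[of \<epsilon> s] e s S by (auto simp: abs_le_iff)
      moreover have "s ^ ?n * kern_corr k \<epsilon> s u f \<le> ?c * weight_inner k u (dilate s f) + d"
        using \<epsilon>3(2)[of \<epsilon> s] e s S by (auto simp: abs_le_iff)
      moreover have "0 \<le> ?c * ((1 - s powr (- \<theta>)) * weight_inner k f (dilate s u))"
        using sgn[OF s] c by simp
      then have "?c * weight_inner k u (dilate s f) \<le> ?c * weight_inner k f (dilate s u)"
        using weight_inner_homogeneous[of s] s by (simp add: algebra_simps)
      ultimately have low: "- (2 * d) \<le> s ^ ?n * (kern_corr k \<epsilon> s f u - kern_corr k \<epsilon> s u f)"
        by (simp add: algebra_simps)
      have div: "- (2 * d) \<le> t / p" if "- (2 * d) \<le> t" "1 \<le> p" for t p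
      proof -
        have "2 * d * 1 \<le> 2 * d * p" using that d by (intro mult_left_mono) auto
        then have "- (2 * d) * p \<le> t" using that by simp
        then show ?thesis using that by (simp add: le_divide_eq)
      qed
      have "- (2 * d) \<le> s ^ ?n * (kern_corr k \<epsilon> s f u - kern_corr k \<epsilon> s u f) / s ^ ?n"
        by (rule div[OF low sn(1)])
      then have "- (2 * d) \<le> kern_corr k \<epsilon> s f u - kern_corr k \<epsilon> s u f" using s by simp
      from div[OF this q] show ?thesis
        unfolding D_def using virial_identity[OF e(1,5), of s] s S by simp
    qed
    obtain z where z: "1 < z" "z < S" "G S - G 1 = (S - 1) * D z"
      using MVT2[OF S(1), of G D] der by blast
    have "(S - 1) * - (2 * d) \<le> (S - 1) * D z" using Dlow[of z] z S by (intro mult_left_mono) auto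
    moreover have "(S - 1) * (2 * d) \<le> 1 * (2 * d)" using S d by (intro mult_right_mono) auto
    ultimately have GS: "G 1 \<le> G S + 2 * d" using z(3) by simp
    have G1: "?c * weight_norm2 k u - d \<le> G 1"
      using \<epsilon>1(2)[of \<epsilon> 1] e by (auto simp: G_def abs_le_iff weight_inner_self)
    have "S ^ ?n * kern_corr k \<epsilon> S u u \<le> ?c * weight_inner k u (dilate S u) + d"
      using \<epsilon>1(2)[of \<epsilon> S] e S by (auto simp: abs_le_iff)
    then have "S ^ ?n * kern_corr k \<epsilon> S u u / S ^ (k + ?n) \<le> (?c * weight_inner k u (dilate S u) + d) / S ^ (k + ?n)"
      using S by (intro divide_right_mono) auto
    moreover have "S ^ ?n * kern_corr k \<epsilon> S u u / S ^ (k + ?n) = G S"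
      using S by (simp add: G_def power_add)
    moreover have "d / S ^ (k + ?n) \<le> d / 1"
      using S d by (intro divide_left_mono one_le_power) auto
    ultimately have "G S \<le> ?c * weight_inner k u (dilate S u) / S ^ (k + ?n) + d"
      by (simp add: add_divide_distrib)
    then show ?thesis using GS G1 unfolding d_def by simp
  qed
  then have "?c * weight_norm2 k u \<le> ?c * weight_inner k u (dilate S u) / S ^ (k + ?n)"
    by (rule field_le_epsilon)
  then have "weight_norm2 k u \<le> weight_inner k u (dilate S u) / S ^ (k + ?n)"
    using c by (simp add: times_divide_eq_right[symmetric] del: times_divide_eq_right)
  then show ?thesis using S by (simp add: le_divide_eq mult.commute)
qed

text \<open>The case of equality in Cauchy-Schwarz: the squared weighted distance between the two sides equals
  \<open>2 \<kappa> (\<kappa> \<langle>u, u\<rangle> - \<langle>u, u\<^sub>S\<rangle>)\<close> with \<open>\<kappa> = S\<^bsup>k+n\<^esup>\<close>, which \<open>correlation_ge\<close> makes nonpositive.\<close>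
lemma homogeneous_solution:
  assumes S: "1 < S" "S < 2"
    and sgn: "\<And>s. 1 \<le> s \<Longrightarrow> s \<le> S \<Longrightarrow> 0 \<le> (1 - s powr (- \<theta>)) * weight_inner k f (dilate s u)"
  shows "AE x in lborel. dilate S u x = S ^ (k + CARD('n)) * u x"
proof -
  let ?n = "CARD('n)" and ?W = "\<lambda>x::real^'n. norm x ^ (2 * k + CARD('n))"
  define \<kappa> where "\<kappa> = S ^ (k + ?n)"
  have S0: "0 < S" using S by simp
  have \<kappa>: "0 < \<kappa>" "S ^ (2 * k + 2 * ?n) = \<kappa> * \<kappa>"
    using S0 by (auto simp: \<kappa>_def power_add mult_2)
  note Su = L2_dilate(1)[OF S0]
  have [measurable]: "dilate S u \<in> borel_measurable borel" using Su by (rule weight_L2_measurable)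
  have I: "integrable lborel (\<lambda>x. ?W x * (dilate S u x * dilate S u x))" "integrable lborel (\<lambda>x. ?W x * (u x * u x))"
    "integrable lborel (\<lambda>x. ?W x * (u x * dilate S u x))"
    using integrable_weight_mult[OF Su Su] integrable_weight_mult[OF u u] integrable_weight_mult[OF u Su] by auto
  have expand: "?W x * (dilate S u x - \<kappa> * u x)\<^sup>2 = ?W x * (dilate S u x * dilate S u x)
      - 2 * \<kappa> * (?W x * (u x * dilate S u x)) + \<kappa> * \<kappa> * (?W x * (u x * u x))" for x
    by (simp add: power2_eq_square algebra_simps)
  have int: "integrable lborel (\<lambda>x. ?W x * (dilate S u x - \<kappa> * u x)\<^sup>2)"
    unfolding expand using I by auto
  have "(LINT x|lborel. ?W x * (dilate S u x - \<kappa> * u x)\<^sup>2) =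
      weight_norm2 k (dilate S u) - 2 * \<kappa> * weight_inner k u (dilate S u) + \<kappa> * \<kappa> * weight_norm2 k u"
    unfolding expand using I by (simp add: weight_inner_def weight_inner_self[symmetric])
  also have "\<dots> = 2 * \<kappa> * (\<kappa> * weight_norm2 k u - weight_inner k u (dilate S u))"
    unfolding weight_norm2_dilate[OF u S0] \<kappa>(2) by (simp add: algebra_simps)
  also have "\<dots> \<le> 0"
    using correlation_ge[OF S sgn] \<kappa>(1) unfolding \<kappa>_def[symmetric]
    by (intro mult_nonneg_nonpos) auto
  finally have "(LINT x|lborel. ?W x * (dilate S u x - \<kappa> * u x)\<^sup>2) \<le> 0" .
  moreover have "0 \<le> (LINT x|lborel. ?W x * (dilate S u x - \<kappa> * u x)\<^sup>2)"
    by (intro Bochner_Integration.integral_nonneg) auto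
  ultimately have "(LINT x|lborel. ?W x * (dilate S u x - \<kappa> * u x)\<^sup>2) = 0" by simp
  then have "AE x in lborel. ?W x * (dilate S u x - \<kappa> * u x)\<^sup>2 = 0"
    using int by (subst (asm) integral_nonneg_eq_0_iff_AE) auto
  with AE_nonzero show ?thesis
    by eventually_elim (auto simp: \<kappa>_def)
qed

end

text \<open>Dilation by a common factor \<open>S > 1\<close> would multiply \<open>u\<close> by two different powers of \<open>S\<close>.\<close>
lemma rigidity:
  fixes u f :: "real ^ 'n::finite \<Rightarrow> real"
  assumes k: "dilation_rigidity u f k \<theta>" and k': "dilation_rigidity u f (Suc k) \<theta>"
  shows "AE x in lborel. u x = 0"
proof -
  interpret A: dilation_rigidity u f k \<theta> by (rule k)
  interpret B: dilation_rigidity u f "Suc k" \<theta> by (rule k')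
  obtain S1 where S1: "1 < S1" "S1 < 2"
    "\<And>s. 1 \<le> s \<and> s \<le> S1 \<Longrightarrow> 0 \<le> (1 - s powr (- \<theta>)) * weight_inner k f (dilate s u)"
    using A.correlation_sign by blast
  obtain S2 where S2: "1 < S2" "S2 < 2"
    "\<And>s. 1 \<le> s \<and> s \<le> S2 \<Longrightarrow> 0 \<le> (1 - s powr (- \<theta>)) * weight_inner (Suc k) f (dilate s u)"
    using B.correlation_sign by blast
  define S where "S = min S1 S2"
  have S: "1 < S" "S < 2" using S1 S2 by (auto simp: S_def)
  have "AE x in lborel. dilate S u x = S ^ (k + CARD('n)) * u x"
    using S1 S by (intro A.homogeneous_solution) (auto simp: S_def)
  moreover have "AE x in lborel. dilate S u x = S ^ (Suc k + CARD('n)) * u x"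
    using S2 S by (intro B.homogeneous_solution) (auto simp: S_def)
  ultimately show ?thesis
  proof eventually_elim
    case (elim x)
    then have "(S - 1) * (S ^ (k + CARD('n)) * u x) = 0" by (simp add: algebra_simps)
    then show ?case using S by simp
  qed
qed

section \<open>Decaying solutions\<close>

lemma test_function_borel:
  fixes \<phi> :: "real ^ 'n::finite \<Rightarrow> real"
  assumes "test_function \<phi>"
  shows "\<phi> \<in> borel_measurable borel" "laplacian \<phi> \<in> borel_measurable borel"
proof -
  have "Ck 0 \<phi>" "Ck (Suc (Suc 0)) \<phi>" using assms by (auto simp: test_function_def)
  then have c: "continuous_on UNIV \<phi>" "\<And>i. continuous_on UNIV (partial_deriv i (partial_deriv i \<phi>))"
    by auto
  then show "\<phi> \<in> borel_measurable borel" by (intro borel_measurable_continuous_onI)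
  show "laplacian \<phi> \<in> borel_measurable borel"
    unfolding laplacian_def[abs_def] by (intro borel_measurable_continuous_onI continuous_intros c)
qed

text \<open>Decay of the tail faster than \<open>r\<^bsup>-(m+2)\<^esup>\<close> leaves a convergent series \<open>\<Sum> (j+1)\<^bsup>-2\<^esup>\<close> over unit shells.\<close>
lemma nn_integral_moment_finite:
  fixes u :: "real ^ 'n::finite \<Rightarrow> real"
  assumes [measurable]: "u \<in> borel_measurable borel"
    and loc: "\<And>R. (\<integral>\<^sup>+x. ennreal ((u x)\<^sup>2) * indicator (cball 0 R) x \<partial>lborel) < \<infinity>"
    and decay: "\<And>m::real. 0 \<le> m \<Longrightarrow>
      ((\<lambda>r. ennreal (r powr m) * (\<integral>\<^sup>+x. ennreal ((u x)\<^sup>2) * indicator {x. norm x > r} x \<partial>lborel)) \<longlongrightarrow> 0) at_top"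
  shows "(\<integral>\<^sup>+x. ennreal (norm x ^ m * (u x)\<^sup>2) \<partial>lborel) < \<infinity>"
proof -
  define T where "T r = (\<integral>\<^sup>+x. ennreal ((u x)\<^sup>2) * indicator {x. norm x > r} x \<partial>lborel)" for r :: real
  have "\<forall>\<^sub>F r in at_top. ennreal (r powr real (m + 2)) * T r < 1"
    using decay[of "real (m + 2)"] unfolding T_def by (intro order_tendstoD(2)) auto
  then obtain R0 where R0: "\<And>r. R0 \<le> r \<Longrightarrow> ennreal (r powr real (m + 2)) * T r < 1"
    unfolding eventually_at_top_linorder by blast
  define R where "R = Suc (nat \<lceil>R0\<rceil>)"
  have R: "R0 \<le> real R" "1 \<le> R" unfolding R_def by linarith+
  have Tj: "ennreal (real (R + j + 1) ^ m) * T (real (R + j)) \<le> ennreal (2 ^ m / real (Suc j) ^ 2)" for j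
  proof -
    define r where "r = real (R + j)"
    have r: "1 \<le> r" "R0 \<le> r" "real (Suc j) \<le> r" "r + 1 \<le> 2 * r" using R by (auto simp: r_def)
    have "ennreal (r ^ (m + 2)) * T r \<le> 1"
    proof -
      have "r powr real (m + 2) = r ^ (m + 2)" using r(1) by (intro powr_realpow) simp
      then show ?thesis using R0[OF r(2)] by (simp only: less_imp_le)
    qed
    have "(r + 1) ^ m \<le> (2 * r) ^ m" using r by (intro power_mono) auto
    also have "\<dots> = 2 ^ m / r ^ 2 * r ^ (m + 2)"
      using r by (simp add: power_mult_distrib power2_eq_square)
    also have "\<dots> \<le> 2 ^ m / real (Suc j) ^ 2 * r ^ (m + 2)"
      using r by (intro mult_right_mono divide_left_mono power_mono) auto
    finally have "ennreal ((r + 1) ^ m) * T r \<le> ennreal (2 ^ m / real (Suc j) ^ 2 * r ^ (m + 2)) * T r"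
      by (intro mult_right_mono ennreal_leI) auto
    also have "\<dots> = ennreal (2 ^ m / real (Suc j) ^ 2) * (ennreal (r ^ (m + 2)) * T r)"
      using r by (subst ennreal_mult) (auto simp: mult.assoc)
    also have "\<dots> \<le> ennreal (2 ^ m / real (Suc j) ^ 2) * 1"
      by (intro mult_left_mono \<open>ennreal (r ^ (m + 2)) * T r \<le> 1\<close>) auto
    finally show ?thesis by (simp add: r_def add_ac)
  qed
  have pt: "ennreal (norm x ^ m * (u x)\<^sup>2) \<le> ennreal (real R ^ m) * (ennreal ((u x)\<^sup>2) * indicator (cball 0 (real R)) x)
    + (\<Sum>j. ennreal (real (R + j + 1) ^ m) * (ennreal ((u x)\<^sup>2) * indicator {x. norm x > real (R + j)} x))" for x
  proof (cases "norm x \<le> real R")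
    case True
    have "ennreal (norm x ^ m * (u x)\<^sup>2) \<le> ennreal (real R ^ m * (u x)\<^sup>2)"
      using True by (intro ennreal_leI mult_right_mono power_mono) auto
    also have "\<dots> = ennreal (real R ^ m) * (ennreal ((u x)\<^sup>2) * indicator (cball 0 (real R)) x)"
      using True by (simp add: ennreal_mult)
    finally show ?thesis by (rule order.trans) simp
  next
    case False
    \<comment> \<open>the shell \<open>R + j < |x| \<le> R + j + 1\<close> containing \<open>x\<close>\<close>
    define j where "j = nat (\<lceil>norm x\<rceil> - 1) - R"
    have j: "real (R + j) < norm x" "norm x \<le> real (R + j + 1)"
      using False unfolding j_def by linarith+
    have "ennreal (norm x ^ m * (u x)\<^sup>2) \<le> ennreal (real (R + j + 1) ^ m * (u x)\<^sup>2)"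
      using j by (intro ennreal_leI mult_right_mono power_mono) auto
    also have "\<dots> = ennreal (real (R + j + 1) ^ m) * (ennreal ((u x)\<^sup>2) * indicator {x. norm x > real (R + j)} x)"
      using j by (simp add: ennreal_mult)
    also have "\<dots> \<le> (\<Sum>j. ennreal (real (R + j + 1) ^ m) * (ennreal ((u x)\<^sup>2) * indicator {x. norm x > real (R + j)} x))"
      using sum_le_suminf[of "\<lambda>j. ennreal (real (R + j + 1) ^ m) * (ennreal ((u x)\<^sup>2) * indicator {x. norm x > real (R + j)} x)" "{j}"]
      by simp
    finally show ?thesis by (rule order.trans) simp
  qed
  have "(\<integral>\<^sup>+x. ennreal (norm x ^ m * (u x)\<^sup>2) \<partial>lborel) \<le>
    (\<integral>\<^sup>+x. ennreal (real R ^ m) * (ennreal ((u x)\<^sup>2) * indicator (cball 0 (real R)) x)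
    + (\<Sum>j. ennreal (real (R + j + 1) ^ m) * (ennreal ((u x)\<^sup>2) * indicator {x. norm x > real (R + j)} x)) \<partial>lborel)"
    by (intro nn_integral_mono pt)
  also have "\<dots> = ennreal (real R ^ m) * (\<integral>\<^sup>+x. ennreal ((u x)\<^sup>2) * indicator (cball 0 (real R)) x \<partial>lborel)
    + (\<Sum>j. ennreal (real (R + j + 1) ^ m) * T (real (R + j)))"
  proof -
    have [measurable]: "{x :: real ^ 'n. norm x > r} \<in> sets borel" for r
      by (intro borel_open open_Collect_less continuous_intros)
    have [measurable]: "cball (0 :: real ^ 'n) (real R) \<in> sets borel"
      by (intro borel_closed closed_cball)
    show ?thesis
      unfolding T_def
      by (subst nn_integral_add, measurable, subst nn_integral_cmult, measurable,
          subst nn_integral_suminf, measurable, subst nn_integral_cmult, measurable)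
  qed
  also have "\<dots> < \<infinity>"
  proof -
    have "(\<Sum>j. ennreal (real (R + j + 1) ^ m) * T (real (R + j))) \<le> (\<Sum>j. ennreal (2 ^ m / real (Suc j) ^ 2))"
      by (intro suminf_le Tj) auto
    also have "\<dots> < \<infinity>"
    proof -
      have "summable (\<lambda>j. 2 ^ m * inverse (real (Suc j) ^ 2))"
        using inverse_power_summable[of 2, where 'a=real]
        by (intro summable_mult) (subst summable_Suc_iff, simp)
      then have "(\<Sum>j. ennreal (2 ^ m / real (Suc j) ^ 2)) \<noteq> top"
        by (intro ennreal_suminf_neq_top) (auto simp: divide_inverse)
      then show ?thesis by (simp add: less_top)
    qed
    finally show ?thesis using loc[of "real R"] by (simp add: ennreal_mult_less_top)
  qed
  finally show ?thesis .
qed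

text \<open>The bound on the annulus \<open>1 \<le> |x| \<le> 2\<close> is carried to all dyadic annuli by homogeneity. Only countably many
  null sets are collected.\<close>
lemma homogeneous_bound:
  fixes V :: "real ^ 'n::finite \<Rightarrow> real"
  assumes loc: "Linf_loc_on (- {0}) V" and hom: "homogeneous_of_order \<alpha> V"
  shows "\<exists>C\<ge>0. AE x in lborel. \<bar>V x\<bar> \<le> C * norm x powr \<alpha>"
proof -
  define K where "K = cball (0::real^'n) 2 - ball 0 1"
  have "compact K" unfolding K_def by (intro compact_diff) auto
  moreover have "K \<subseteq> - {0}" by (auto simp: K_def)
  ultimately obtain C0 where "AE x in lebesgue_on K. \<bar>V x\<bar> \<le> C0"
    using loc unfolding Linf_loc_on_def by blast
  then have "AE x in lebesgue. x \<in> K \<longrightarrow> \<bar>V x\<bar> \<le> C0"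
    using \<open>compact K\<close> by (subst (asm) AE_restrict_space_iff) (auto intro: fmeasurableD lmeasurable_compact)
  then have "AE x in lborel. x \<in> K \<longrightarrow> \<bar>V x\<bar> \<le> C0" by (simp add: AE_completion_iff)
  then have "AE x in lborel. 0 + (2 powr (- real_of_int j)) *\<^sub>R x \<in> K \<longrightarrow> \<bar>V (0 + (2 powr (- real_of_int j)) *\<^sub>R x)\<bar> \<le> C0" for j
    by (intro AE_lborel_affine) auto
  then have "AE x in lborel. \<forall>j::int. 0 + (2 powr (- real_of_int j)) *\<^sub>R x \<in> K \<longrightarrow> \<bar>V (0 + (2 powr (- real_of_int j)) *\<^sub>R x)\<bar> \<le> C0"
    by (subst AE_all_countable) blast
  with AE_nonzero have "AE x in lborel. \<bar>V x\<bar> \<le> (\<bar>C0\<bar> * 2 powr \<bar>\<alpha>\<bar>) * norm x powr \<alpha>"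
  proof eventually_elim
    case (elim x)
    \<comment> \<open>\<open>t\<close> is the inner radius of the dyadic annulus containing \<open>x\<close>\<close>
    define j where "j = \<lfloor>log 2 (norm x)\<rfloor>"
    define t where "t = 2 powr real_of_int j"
    have t: "0 < t" by (simp add: t_def)
    have nx: "0 < norm x" using elim by simp
    have "t \<le> norm x" "norm x < 2 * t"
    proof -
      have "t \<le> 2 powr log 2 (norm x)" unfolding t_def j_def by (intro powr_mono) auto
      then show "t \<le> norm x" using nx by simp
      have "2 powr log 2 (norm x) < 2 powr (real_of_int j + 1)"
        unfolding j_def by (intro powr_less_mono) linarith+
      then show "norm x < 2 * t" using nx by (simp add: t_def powr_add)
    qed
    define y where "y = (1 / t) *\<^sub>R x"
    have y: "1 \<le> norm y" "norm y \<le> 2"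
      using \<open>t \<le> norm x\<close> \<open>norm x < 2 * t\<close> t by (simp_all add: y_def field_simps)
    have inv: "2 powr (- real_of_int j) = 1 / t" by (simp add: t_def powr_minus divide_inverse)
    have "\<bar>V y\<bar> \<le> C0" using elim(2)[rule_format, of j] y by (simp add: inv y_def K_def)
    moreover have "V x = t powr \<alpha> * V y"
    proof -
      have "y \<noteq> 0" using y by auto
      then have "V (t *\<^sub>R y) = t powr \<alpha> * V y"
        using hom t unfolding homogeneous_of_order_def by blast
      then show ?thesis using t by (simp add: y_def)
    qed
    ultimately have "\<bar>V x\<bar> \<le> t powr \<alpha> * \<bar>C0\<bar>"
      by (simp add: abs_mult mult_left_mono)
    moreover have "norm x powr \<alpha> = t powr \<alpha> * norm y powr \<alpha>"
      using t by (simp add: y_def powr_mult[symmetric])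
    moreover have "1 \<le> 2 powr \<bar>\<alpha>\<bar> * norm y powr \<alpha>"
    proof (cases "0 \<le> \<alpha>")
      case True
      then have "1 * 1 \<le> 2 powr \<bar>\<alpha>\<bar> * norm y powr \<alpha>"
        using y by (intro mult_mono ge_one_powr_ge_zero) auto
      then show ?thesis by simp
    next
      case False
      have "2 powr \<alpha> \<le> norm y powr \<alpha>" using False y by (intro powr_mono2') auto
      then have "2 powr \<bar>\<alpha>\<bar> * 2 powr \<alpha> \<le> 2 powr \<bar>\<alpha>\<bar> * norm y powr \<alpha>" by (intro mult_left_mono) auto
      then show ?thesis using False by (simp add: powr_add[symmetric])
    qed
    then have "t powr \<alpha> * \<bar>C0\<bar> * 1 \<le> t powr \<alpha> * \<bar>C0\<bar> * (2 powr \<bar>\<alpha>\<bar> * norm y powr \<alpha>)"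
      by (intro mult_left_mono) auto
    ultimately show ?case by (simp add: mult_ac)
  qed
  then show ?thesis by (intro exI[of _ "\<bar>C0\<bar> * 2 powr \<bar>\<alpha>\<bar>"]) auto
qed

text \<open>The weight can absorb any power of \<open>|x|\<close>, negative ones included, because \<open>|x|\<^bsup>p\<^esup> \<le> 1 + |x|\<^bsup>m\<^esup>\<close> whenever
  \<open>0 \<le> p \<le> m\<close>.\<close>
lemma weight_L2_of_moments:
  fixes v u :: "real ^ 'n::finite \<Rightarrow> real"
  assumes [measurable]: "u \<in> borel_measurable borel" and v: "v \<in> borel_measurable borel"
    and moments: "\<And>m. (\<integral>\<^sup>+x. ennreal (norm x ^ m * (u x)\<^sup>2) \<partial>lborel) < \<infinity>"
    and bound: "AE x in lborel. \<bar>v x\<bar> \<le> C * norm x powr \<gamma> * \<bar>u x\<bar>"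
    and k: "- \<gamma> \<le> real k"
  shows "weight_L2 k v"
proof -
  \<comment> \<open>the power of \<open>|x|\<close> left over from the weight and the bound on \<open>v\<close>; it is nonnegative since \<open>k \<ge> - \<gamma>\<close>\<close>
  define p where "p = real (2 * k + CARD('n)) + 2 * \<gamma>"
  define m where "m = nat \<lceil>p\<rceil>"
  have p: "0 \<le> p" using k by (simp add: p_def)
  have pm: "p \<le> real m" unfolding m_def by linarith
  have int: "integrable lborel (\<lambda>x. norm x ^ j * (u x)\<^sup>2)" for j
    using moments[of j] by (intro integrableI_nonneg) auto
  have int0: "integrable lborel (\<lambda>x. (u x)\<^sup>2)" using int[of 0] by simp
  have "integrable lborel (\<lambda>x. norm x ^ (2 * k + CARD('n)) * (v x)\<^sup>2)"
  proof (rule Bochner_Integration.integrable_bound)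
    show "integrable lborel (\<lambda>x. C\<^sup>2 * ((u x)\<^sup>2 + norm x ^ m * (u x)\<^sup>2))"
      using int int0 by auto
    show "AE x in lborel. norm (norm x ^ (2 * k + CARD('n)) * (v x)\<^sup>2) \<le> norm (C\<^sup>2 * ((u x)\<^sup>2 + norm x ^ m * (u x)\<^sup>2))"
      using bound AE_nonzero
    proof eventually_elim
      case (elim x)
      have nx: "0 < norm x" using elim by simp
      have "(v x)\<^sup>2 \<le> (C * norm x powr \<gamma> * \<bar>u x\<bar>)\<^sup>2"
        using elim(1) by (metis abs_ge_zero power2_abs power_mono)
      also have "\<dots> = C\<^sup>2 * norm x powr (2 * \<gamma>) * (u x)\<^sup>2"
        using nx by (simp add: power_mult_distrib powr_power mult.commute)
      finally have "norm x ^ (2 * k + CARD('n)) * (v x)\<^sup>2 \<le>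
          norm x ^ (2 * k + CARD('n)) * (C\<^sup>2 * norm x powr (2 * \<gamma>) * (u x)\<^sup>2)"
        by (intro mult_left_mono) auto
      also have "\<dots> = C\<^sup>2 * (norm x powr p * (u x)\<^sup>2)"
        using nx by (simp add: p_def powr_add powr_realpow[symmetric] del: of_nat_add)
      also have "\<dots> \<le> C\<^sup>2 * ((1 + norm x ^ m) * (u x)\<^sup>2)"
      proof (intro mult_left_mono mult_right_mono)
        show "norm x powr p \<le> 1 + norm x ^ m"
        proof (cases "norm x \<le> 1")
          case True
          then have "norm x powr p \<le> 1" using nx p by (simp add: powr_le1)
          then show ?thesis by (rule order.trans) simp
        next
          case False
          then have "norm x powr p \<le> norm x powr real m" using pm by (intro powr_mono) auto
          then show ?thesis using nx by (simp add: powr_realpow)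
        qed
      qed auto
      finally show ?case by (simp add: algebra_simps)
    qed
  qed (use v in auto)
  then show ?thesis using v by (simp add: weight_L2_def)
qed

theorem corollary1p4:
  fixes V u :: "real ^ 'n \<Rightarrow> real" and \<alpha> :: real
  assumes "CARD('n) \<ge> 2"
    and "Linf_loc_on (- {0}) V"
    and "homogeneous_of_order \<alpha> V"
    and "\<alpha> = -2 \<or>
         (\<alpha> > -2 \<and> (AE x in lebesgue. V x \<ge> 0)) \<or>
         (\<alpha> < -2 \<and> (AE x in lebesgue. V x \<le> 0))"
    and "L2_loc u"
    and "weak_solution V u"
    and "rapidly_decaying_L2_tail u"
  shows "AE x in lebesgue. u x = 0"
proof -
  have u_leb [measurable]: "u \<in> borel_measurable lebesgue"
    and Vu_leb [measurable]: "(\<lambda>x. V x * u x) \<in> borel_measurable lebesgue"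
    using assms(5,6) by (auto simp: L2_loc_def weak_solution_def L1_loc_def)
  \<comment> \<open>Borel representatives, so that product measures and dilations can be taken for \<open>lborel\<close>\<close>
  obtain u' where u' [measurable]: "u' \<in> borel_measurable borel" and uu': "AE x in lborel. u x = u' x"
    using completion_ex_borel_measurable_real[OF u_leb] by auto
  have "V \<in> borel_measurable (lebesgue_on (- {0}))" using assms(2) by (simp add: Linf_loc_on_def)
  then have "(\<lambda>x. if x \<in> - {0} then V x else 0) \<in> borel_measurable lebesgue"
    by (subst borel_measurable_if) auto
  from completion_ex_borel_measurable_real[OF this]
  obtain V' where V' [measurable]: "V' \<in> borel_measurable borel"
    and VV0: "AE x in lborel. (if x \<in> - {0} then V x else 0) = V' x" by auto
  have VV': "AE x in lborel. V x = V' x"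
    using VV0 AE_nonzero by eventually_elim auto
  define f where "f x = (x \<bullet> x) * (V' x * u' x)" for x
  have f [measurable]: "f \<in> borel_measurable borel" unfolding f_def by measurable
  have fV: "AE x in lborel. f x = (x \<bullet> x) * (V x * u' x)"
    using VV' by eventually_elim (simp add: f_def)
  have sq: "(\<integral>\<^sup>+x. ennreal ((u x)\<^sup>2) * indicator A x \<partial>lebesgue) = (\<integral>\<^sup>+x. ennreal ((u' x)\<^sup>2) * indicator A x \<partial>lborel)" for A
    unfolding nn_integral_completion
    by (intro nn_integral_cong_AE) (use uu' in eventually_elim, simp)
  have moments: "(\<integral>\<^sup>+x. ennreal (norm x ^ m * (u' x)\<^sup>2) \<partial>lborel) < \<infinity>" for m
  proof (rule nn_integral_moment_finite[OF u'])
    show "(\<integral>\<^sup>+x. ennreal ((u' x)\<^sup>2) * indicator (cball 0 R) x \<partial>lborel) < \<infinity>" for R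
    proof -
      have "set_integrable lebesgue (cball 0 R) (\<lambda>x. (u x)\<^sup>2)"
        using assms(5) compact_cball by (auto simp: L2_loc_def)
      then have "(\<integral>\<^sup>+x. ennreal (norm (indicator (cball 0 R) x *\<^sub>R (u x)\<^sup>2)) \<partial>lebesgue) < \<infinity>"
        by (simp add: set_integrable_def integrable_iff_bounded)
      also have "(\<integral>\<^sup>+x. ennreal (norm (indicator (cball 0 R) x *\<^sub>R (u x)\<^sup>2)) \<partial>lebesgue) =
          (\<integral>\<^sup>+x. ennreal ((u x)\<^sup>2) * indicator (cball 0 R) x \<partial>lebesgue)"
        by (intro nn_integral_cong) (auto split: split_indicator)
      finally show ?thesis by (simp add: sq)
    qed
    show "((\<lambda>r. ennreal (r powr m) * (\<integral>\<^sup>+x. ennreal ((u' x)\<^sup>2) * indicator {x. norm x > r} x \<partial>lborel)) \<longlongrightarrow> 0) at_top"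
      if "0 \<le> m" for m :: real
      using assms(7) that by (simp add: rapidly_decaying_L2_tail_def sq)
  qed
  obtain C where C: "0 \<le> C" "AE x in lborel. \<bar>V x\<bar> \<le> C * norm x powr \<alpha>"
    using homogeneous_bound[OF assms(2,3)] by blast
  have u_L2: "weight_L2 k u'" for k
    by (rule weight_L2_of_moments[OF u' u' moments, where C=1 and \<gamma>=0])
       (use AE_nonzero in \<open>eventually_elim, simp\<close>, simp)
  have f_L2: "weight_L2 k f" if "\<bar>\<alpha>\<bar> \<le> real k" for k
  proof (rule weight_L2_of_moments[OF u' f moments, where C=C and \<gamma>="\<alpha> + 2"])
    show "AE x in lborel. \<bar>f x\<bar> \<le> C * norm x powr (\<alpha> + 2) * \<bar>u' x\<bar>"
      using fV C(2) AE_nonzero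
    proof eventually_elim
      case (elim x)
      have "\<bar>f x\<bar> = (norm x)\<^sup>2 * \<bar>V x\<bar> * \<bar>u' x\<bar>"
        by (simp add: elim(1) abs_mult dot_square_norm)
      also have "\<dots> \<le> (norm x)\<^sup>2 * (C * norm x powr \<alpha>) * \<bar>u' x\<bar>"
        using elim(2) by (intro mult_right_mono mult_left_mono) auto
      also have "(norm x)\<^sup>2 = norm x powr 2" using elim(3) by (simp add: powr_numeral)
      finally show ?case by (simp add: powr_add mult_ac)
    qed
    show "- (\<alpha> + 2) \<le> real k" using that by linarith
  qed
  have weak: "(LINT x|lborel. u' x * laplacian (\<lambda>x. (x \<bullet> x) * \<eta> x) x) = - (LINT x|lborel. f x * \<eta> x)"
    if [measurable]: "\<eta> \<in> borel_measurable borel" and test: "test_function (\<lambda>x. (x \<bullet> x) * \<eta> x)" for \<eta>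
  proof -
    let ?\<phi> = "\<lambda>x. (x \<bullet> x) * \<eta> x"
    note [measurable] = test_function_borel[OF test]
    have [measurable]: "\<eta> \<in> borel_measurable lebesgue" "?\<phi> \<in> borel_measurable lebesgue"
       "laplacian ?\<phi> \<in> borel_measurable lebesgue" "u' \<in> borel_measurable lebesgue" "f \<in> borel_measurable lebesgue"
      by (auto intro!: measurable_completion)
    have "(LINT x|lebesgue. u x * (- laplacian ?\<phi> x)) = (LINT x|lebesgue. V x * u x * ?\<phi> x)"
      using assms(6) test by (auto simp: weak_solution_def)
    moreover have "(LINT x|lebesgue. u x * (- laplacian ?\<phi> x)) = (LINT x|lebesgue. u' x * (- laplacian ?\<phi> x))"
      using AE_completion[OF uu'] by (intro integral_cong_AE) (auto elim!: eventually_mono)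
    moreover have "(LINT x|lebesgue. u' x * (- laplacian ?\<phi> x)) = (LINT x|lborel. u' x * (- laplacian ?\<phi> x))"
      by (rule integral_completion) measurable
    moreover have "(LINT x|lebesgue. V x * u x * ?\<phi> x) = (LINT x|lebesgue. f x * \<eta> x)"
    proof (rule integral_cong_AE)
      show "AE x in lebesgue. V x * u x * ?\<phi> x = f x * \<eta> x"
        using AE_completion[OF uu'] AE_completion[OF fV] by eventually_elim simp
    qed measurable
    moreover have "(LINT x|lebesgue. f x * \<eta> x) = (LINT x|lborel. f x * \<eta> x)"
      by (rule integral_completion) measurable
    ultimately show ?thesis by simp
  qed
  have hom: "AE x in lborel. u' x * dilate s f x = s powr (- (\<alpha> + 2)) * (f x * dilate s u' x)" if s: "0 < s" for s
  proof -
    have "AE x in lborel. f (0 + (1 / s) *\<^sub>R x) = ((0 + (1 / s) *\<^sub>R x) \<bullet> (0 + (1 / s) *\<^sub>R x)) * (V (0 + (1 / s) *\<^sub>R x) * u' (0 + (1 / s) *\<^sub>R x))"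
      using s by (intro AE_lborel_affine fV) auto
    with fV AE_nonzero show ?thesis
    proof eventually_elim
      case (elim x)
      have "V ((1 / s) *\<^sub>R x) = (1 / s) powr \<alpha> * V x"
        using assms(3) s elim(2) unfolding homogeneous_of_order_def by (metis zero_less_divide_1_iff)
      then have "f (x /\<^sub>R s) = (1 / s) powr 2 * (1 / s) powr \<alpha> * ((x \<bullet> x) * V x * u' (x /\<^sub>R s))"
        using elim(3) s by (simp add: divide_inverse powr_numeral power2_eq_square mult_ac)
      moreover have "(1 / s) powr 2 * (1 / s) powr \<alpha> = s powr (- (\<alpha> + 2))"
      proof -
        have "(1 / s) powr 2 * (1 / s) powr \<alpha> = (1 / s) powr (\<alpha> + 2)"
          by (simp only: powr_add[symmetric] add.commute)
        also have "\<dots> = s powr (- (\<alpha> + 2))" using s powr_minus_divide[of s "\<alpha> + 2"] by (simp add: powr_divide)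
        finally show ?thesis .
      qed
      ultimately show ?case
        using elim(1) by (simp add: dilate_def mult_ac)
    qed
  qed
  have sgn: "AE x in lborel. 0 \<le> (\<alpha> + 2) * (f x * u' x)"
  proof -
    have "AE x in lborel. 0 \<le> (\<alpha> + 2) * V x"
      using assms(4)
    proof (elim disjE conjE)
      assume "\<alpha> > -2" "AE x in lebesgue. V x \<ge> 0"
      then show ?thesis by (auto simp: AE_completion_iff elim!: eventually_mono intro!: mult_nonneg_nonneg)
    next
      assume "\<alpha> < -2" "AE x in lebesgue. V x \<le> 0"
      then show ?thesis by (auto simp: AE_completion_iff elim!: eventually_mono intro!: mult_nonpos_nonpos)
    qed simp
    with fV show ?thesis
    proof eventually_elim
      case (elim x)
      have "0 \<le> ((\<alpha> + 2) * V x) * ((x \<bullet> x) * (u' x)\<^sup>2)" using elim(2) by (rule mult_nonneg_nonneg) simp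
      then show ?case by (simp add: elim(1) power2_eq_square mult_ac)
    qed
  qed
  have rig: "dilation_rigidity u' f k (\<alpha> + 2)" if "0 < k" "\<bar>\<alpha>\<bar> \<le> real k" for k
  proof unfold_locales
    show "weight_L2 k u'" by (rule u_L2)
    show "weight_L2 k f" by (rule f_L2[OF that(2)])
    show "f x = 0" if "u' x = 0" for x using that by (simp add: f_def)
  qed (use that(1) weak hom sgn in blast)+
  \<comment> \<open>any \<open>k \<ge> |\<alpha>|\<close> makes \<open>f\<close> square integrable for the weight, whichever sign \<open>\<alpha> + 2\<close> has\<close>
  define k where "k = Suc (nat \<lceil>\<bar>\<alpha>\<bar>\<rceil>)"
  have "\<bar>\<alpha>\<bar> \<le> real k" unfolding k_def by linarith
  then have "AE x in lborel. u' x = 0"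
    by (intro rigidity[of u' f k "\<alpha> + 2"] rig) (auto simp: k_def)
  with uu' have "AE x in lborel. u x = 0" by eventually_elim simp
  then show ?thesis by (rule AE_completion)
qed

end
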